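(* Let $A$ be an $n\times n$ dilation matrix in $M(n,\mathbb{Z})\cap \mathrm{GL}(n,\mathbb{Q})$, and let $E\subseteq\mathbb{R}^n$ be a transformation wavelet set for the matrix $B=A^T$. Then the wavelet representation $W$ of $\mathbb{Q}_A\rtimes_{\vartheta}\mathbb{Z}$ on $L^2(\mathbb{R}^n)$ is unitarily equivalent to the direct integral $\int_E^{\oplus}\widetilde{W}_x\,dx$ of representations $\{\widetilde{W}_x \mid x\in E\}$, where each $\widetilde{W}_x$ is an irreducible monomial representation induced from a character on the normal abelian subgroup $\mathbb{Q}_A\rtimes_{\vartheta}\{0\}$ of $\mathbb{Q}_A\rtimes_{\vartheta}\mathbb{Z}$. Indeed, for each $x\in E$, the representation $\widetilde{W}_x:\mathbb{Q}_A\rtimes_{\vartheta}\mathbb{Z}\to\mathcal{U}(l^2(\mathbb{Z}))$ is defined by $$[\widetilde{W}_x(\beta,m)g](k)=e^{-i\langle x, A^k\beta\rangle}\,g(k-m)$$ for $(\beta,m)\in\mathbb{Q}_A\rtimes_{\vartheta}\mathbb{Z}$, $k\in\mathbb{Z}$ and $g\in l^2(\mathbb{Z})$.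
   Context: A matrix $A\in M(n,\mathbb{Z})\cap \mathrm{GL}(n,\mathbb{Q})$ is a dilation matrix if all of its (complex) eigenvalues have modulus strictly greater than one. The group: $\mathbb{Q}_A=\bigcup_{j=0}^{\infty}\{A^{-j}v\mid v\in\mathbb{Z}^n\}$, a subgroup of $\mathbb{Q}^n$, regarded as a discrete group. For $m\in\mathbb{Z}$, $\vartheta(m)$ is the automorphism $\vartheta(m)\beta=A^{-m}\beta$ of $\mathbb{Q}_A$. The discrete group $\mathbb{Q}_A\rtimes_{\vartheta}\mathbb{Z}$ has operation $(\beta_1,m_1)\cdot(\beta_2,m_2)=(\beta_1+\vartheta(m_1)\beta_2,\,m_1+m_2)$. Wavelet representation: On $L^2(\mathbb{R}^n)$ define the unitaries $D_Af(t)=|\det A|^{1/2}f(At)$ and, for $\beta\in\mathbb{Q}_A$, $T_\beta f(t)=f(t-\beta)$. The wavelet representation is the unitary representation $W:\mathbb{Q}_A\rtimes_{\vartheta}\mathbb{Z}\to\mathcal{U}(L^2(\mathbb{R}^n))$, $W(\beta,m)=T_\beta D_A^m$. Here $\mathcal{U}(\mathcal{H})$ denotes the unitary group of a Hilbert space $\mathcal{H}$. Transformation wavelet set: $\mu$ is Lebesgue measure on $\mathbb{R}^n$. A set $E\subseteq\mathbb{R}^n$ is a transformation wavelet set for $B$ if (i) $E$ is measurable and $B^j(E)\cap B^k(E)=\emptyset$ for all $j\neq k$ in $\mathbb{Z}$; (ii) $\mu(\mathbb{R}^n\setminus\bigcup_{j\in\mathbb{Z}}B^j(E))=0$; (iii)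 $E$ is translation congruent to $[-\pi,\pi)^n$ modulo the lattice $\{2\pi v\mid v\in\mathbb{Z}^n\}$, equivalently, the sets $E+2\pi v$, $v\in\mathbb{Z}^n$, are pairwise disjoint up to sets of measure zero and $\mu(\mathbb{R}^n\setminus\bigcup_{v\in\mathbb{Z}^n}(E+2\pi v))=0$. A monomial representation of $\mathbb{Q}_A\rtimes_{\vartheta}\mathbb{Z}$ here means a representation (unitarily equivalent to one) induced from a character (one-dimensional unitary representation) of the normal subgroup $\mathbb{Q}_A\rtimes_{\vartheta}\{0\}\cong\mathbb{Q}_A$. The direct integral over $E$ is with respect to Lebesgue measure $dx$ on $E$, over the constant field of Hilbert spaces $l^2(\mathbb{Z})$; it acts on $L^2(E)\otimes l^2(\mathbb{Z})\cong L^2(E\times\mathbb{Z})$ by $[(\int_E^{\oplus}\widetilde{W}_x\,dx)(\beta,m)f](x,\cdot)=\widetilde{W}_x(\beta,m)[f(x,\cdot)]$ for almost every $x\in E$. *)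

theory Defs
  imports "HOL-Analysis.Analysis" "HOL-Algebra.Coset" "HOL-Algebra.Bij"
begin

section \<open>Complex inner product spaces with explicit carriers\<close>

text \<open>
  The concrete spaces below (\<open>L\<^sup>2\<close> of a measure, \<open>l\<^sup>2\<close>, the space of an induced representation) have
  different vector types and depend on parameters, so they are records with a carrier set. All of
  them are standard Hilbert spaces. The inner product is linear in the first argument.
\<close>

record 'v cinner_space = "'v partial_object" +
  vadd :: "'v \<Rightarrow> 'v \<Rightarrow> 'v"
  vscale :: "complex \<Rightarrow> 'v \<Rightarrow> 'v"
  vzero :: 'v
  cinner :: "'v \<Rightarrow> 'v \<Rightarrow> complex"

definition vnorm :: "'v cinner_space \<Rightarrow> 'v \<Rightarrow> real" where
  "vnorm H v = sqrt (Re (cinner H v v))"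

definition unitary_map :: "'v cinner_space \<Rightarrow> 'w cinner_space \<Rightarrow> ('v \<Rightarrow> 'w) \<Rightarrow> bool" where
  "unitary_map H K U \<longleftrightarrow>
     bij_betw U (carrier H) (carrier K) \<and>
     (\<forall>u\<in>carrier H. \<forall>v\<in>carrier H. U (vadd H u v) = vadd K (U u) (U v)) \<and>
     (\<forall>c. \<forall>v\<in>carrier H. U (vscale H c v) = vscale K c (U v)) \<and>
     (\<forall>u\<in>carrier H. \<forall>v\<in>carrier H. cinner K (U u) (U v) = cinner H u v)"

text \<open>As in \<^const>\<open>BijGroup\<close>, the elements are extensional functions on the carrier.\<close>

definition unitary_group :: "'v cinner_space \<Rightarrow> ('v \<Rightarrow> 'v) monoid" where
  "unitary_group H =
     (BijGroup (carrier H)) \<lparr>carrier := {U \<in> Bij (carrier H). unitary_map H H U}\<rparr>"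

definition closed_subspace :: "'v cinner_space \<Rightarrow> 'v set \<Rightarrow> bool" where
  "closed_subspace H S \<longleftrightarrow>
     S \<subseteq> carrier H \<and> vzero H \<in> S \<and>
     (\<forall>u\<in>S. \<forall>v\<in>S. vadd H u v \<in> S) \<and>
     (\<forall>c. \<forall>v\<in>S. vscale H c v \<in> S) \<and>
     (\<forall>s. \<forall>v\<in>carrier H. (\<forall>n::nat. s n \<in> S) \<and>
        (\<lambda>n. vnorm H (vadd H (s n) (vscale H (-1) v))) \<longlonglongrightarrow> 0 \<longrightarrow> v \<in> S)"

section \<open>Unitary representations of discrete groups\<close>

definition unitary_rep ::
    "('g, 'x) monoid_scheme \<Rightarrow> 'v cinner_space \<Rightarrow> ('g \<Rightarrow> 'v \<Rightarrow> 'v) \<Rightarrow> bool" where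
  "unitary_rep G H \<pi> \<longleftrightarrow> group G \<and> \<pi> \<in> hom G (unitary_group H)"

definition unitarily_equivalent ::
    "('g, 'x) monoid_scheme \<Rightarrow> 'v cinner_space \<Rightarrow> ('g \<Rightarrow> 'v \<Rightarrow> 'v) \<Rightarrow>
     'w cinner_space \<Rightarrow> ('g \<Rightarrow> 'w \<Rightarrow> 'w) \<Rightarrow> bool" where
  "unitarily_equivalent G H \<pi> K \<rho> \<longleftrightarrow>
     unitary_rep G H \<pi> \<and> unitary_rep G K \<rho> \<and>
     (\<exists>U. unitary_map H K U \<and>
          (\<forall>g\<in>carrier G. \<forall>v\<in>carrier H. U (\<pi> g v) = \<rho> g (U v)))"

definition irreducible_rep ::
    "('g, 'x) monoid_scheme \<Rightarrow> 'v cinner_space \<Rightarrow> ('g \<Rightarrow> 'v \<Rightarrow> 'v) \<Rightarrow> bool" where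
  "irreducible_rep G H \<pi> \<longleftrightarrow>
     unitary_rep G H \<pi> \<and> carrier H \<noteq> {vzero H} \<and>
     (\<forall>S. closed_subspace H S \<and> (\<forall>g\<in>carrier G. \<forall>v\<in>S. \<pi> g v \<in> S) \<longrightarrow>
          S = {vzero H} \<or> S = carrier H)"

definition circle_group :: "complex monoid" where
  "circle_group = \<lparr>carrier = {z. cmod z = 1}, mult = (*), one = 1\<rparr>"

definition group_character :: "('g, 'x) monoid_scheme \<Rightarrow> ('g \<Rightarrow> complex) \<Rightarrow> bool" where
  "group_character G \<eta> \<longleftrightarrow> \<eta> \<in> hom G circle_group"

text \<open>
  The representation of \<open>G\<close> induced from a character \<open>\<eta>\<close> of a subgroup \<open>N\<close>: functions with
  \<open>f (h g) = \<eta> h * f g\<close> for \<open>h\<close> in \<open>N\<close>, square summable over the right cosets of \<open>N\<close>, on which \<open>G\<close>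
  acts by right translation. Both \<open>\<bar>f\<bar>\<^sup>2\<close> and the product of \<open>f\<^sub>1\<close> with the conjugate of \<open>f\<^sub>2\<close> are
  constant on each right coset, so the choice of coset representatives is irrelevant. Outside
  the carrier of \<open>G\<close> the functions are fixed to be \<open>0\<close>.
\<close>

definition coset_rep :: "'g set \<Rightarrow> 'g" where
  "coset_rep C = (SOME g. g \<in> C)"

definition induced_space ::
    "('g, 'x) monoid_scheme \<Rightarrow> 'g set \<Rightarrow> ('g \<Rightarrow> complex) \<Rightarrow> ('g \<Rightarrow> complex) cinner_space" where
  "induced_space G N \<eta> =
     \<lparr>carrier = {f. (\<forall>g. g \<notin> carrier G \<longrightarrow> f g = 0) \<and>
                    (\<forall>h\<in>N. \<forall>g\<in>carrier G. f (h \<otimes>\<^bsub>G\<^esub> g) = \<eta> h * f g) \<and>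
                    (\<lambda>C. (cmod (f (coset_rep C)))\<^sup>2) summable_on (rcosets\<^bsub>G\<^esub> N)},
      vadd = (\<lambda>f1 f2 g. f1 g + f2 g),
      vscale = (\<lambda>c f g. c * f g),
      vzero = (\<lambda>g. 0),
      cinner = (\<lambda>f1 f2. \<Sum>\<^sub>\<infinity>C\<in>rcosets\<^bsub>G\<^esub> N. f1 (coset_rep C) * cnj (f2 (coset_rep C)))\<rparr>"

definition induced_rep ::
    "('g, 'x) monoid_scheme \<Rightarrow> 'g set \<Rightarrow> ('g \<Rightarrow> complex) \<Rightarrow>
     'g \<Rightarrow> ('g \<Rightarrow> complex) \<Rightarrow> ('g \<Rightarrow> complex)" where
  "induced_rep G N \<eta> g =
     (\<lambda>f\<in>carrier (induced_space G N \<eta>). \<lambda>s. if s \<in> carrier G then f (s \<otimes>\<^bsub>G\<^esub> g) else 0)"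

definition monomial_rep ::
    "('g, 'x) monoid_scheme \<Rightarrow> 'g set \<Rightarrow> 'v cinner_space \<Rightarrow> ('g \<Rightarrow> 'v \<Rightarrow> 'v) \<Rightarrow> bool" where
  "monomial_rep G N H \<pi> \<longleftrightarrow>
     (\<exists>\<eta>. group_character (G\<lparr>carrier := N\<rparr>) \<eta> \<and>
          unitarily_equivalent G H \<pi> (induced_space G N \<eta>) (induced_rep G N \<eta>))"

section \<open>The Hilbert spaces \<open>L\<^sup>2\<close> and \<open>l\<^sup>2\<close>\<close>

definition sq_integrable :: "'a measure \<Rightarrow> ('a \<Rightarrow> complex) set" where
  "sq_integrable M = {f \<in> borel_measurable M. integrable M (\<lambda>x. (cmod (f x))\<^sup>2)}"

definition ae_rel :: "'a measure \<Rightarrow> (('a \<Rightarrow> complex) \<times> ('a \<Rightarrow> complex)) set" where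
  "ae_rel M = {(f, g). f \<in> sq_integrable M \<and> g \<in> sq_integrable M \<and> (AE x in M. f x = g x)}"

definition L2_class :: "'a measure \<Rightarrow> ('a \<Rightarrow> complex) \<Rightarrow> ('a \<Rightarrow> complex) set" where
  "L2_class M f = ae_rel M `` {f}"

definition L2_rep :: "('a \<Rightarrow> complex) set \<Rightarrow> 'a \<Rightarrow> complex" where
  "L2_rep F = (SOME f. f \<in> F)"

definition L2_space :: "'a measure \<Rightarrow> ('a \<Rightarrow> complex) set cinner_space" where
  "L2_space M =
     \<lparr>carrier = sq_integrable M // ae_rel M,
      vadd = (\<lambda>F G. L2_class M (\<lambda>x. L2_rep F x + L2_rep G x)),
      vscale = (\<lambda>c F. L2_class M (\<lambda>x. c * L2_rep F x)),
      vzero = L2_class M (\<lambda>x. 0),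
      cinner = (\<lambda>F G. \<integral>x. L2_rep F x * cnj (L2_rep G x) \<partial>M)\<rparr>"

text \<open>
  The operator on \<open>L\<^sup>2\<close> given by an operation \<open>\<Phi>\<close> on functions. It is independent of the chosen
  representatives when \<open>\<Phi>\<close> respects almost-everywhere equality, as is the case below.
\<close>

definition L2_op ::
    "'a measure \<Rightarrow> (('a \<Rightarrow> complex) \<Rightarrow> ('a \<Rightarrow> complex)) \<Rightarrow>
     ('a \<Rightarrow> complex) set \<Rightarrow> ('a \<Rightarrow> complex) set" where
  "L2_op M \<Phi> = (\<lambda>F\<in>carrier (L2_space M). L2_class M (\<Phi> (L2_rep F)))"

definition l2_int :: "(int \<Rightarrow> complex) cinner_space" where
  "l2_int =
     \<lparr>carrier = {g. (\<lambda>k. (cmod (g k))\<^sup>2) summable_on UNIV},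
      vadd = (\<lambda>g h k. g k + h k),
      vscale = (\<lambda>c g k. c * g k),
      vzero = (\<lambda>k. 0),
      cinner = (\<lambda>g h. \<Sum>\<^sub>\<infinity>k. g k * cnj (h k))\<rparr>"

text \<open>
  The direct integral over \<open>E\<close>, with respect to Lebesgue measure and over the constant field
  \<open>l\<^sup>2(\<int>)\<close>, acting on \<open>L\<^sup>2(E \<times> \<int>)\<close>. The slice \<open>f(x, \<cdot>)\<close> of a square integrable \<open>f\<close> is in \<open>l\<^sup>2(\<int>)\<close>
  for almost every \<open>x\<close> only, and the null set of the remaining \<open>x\<close> does not affect the class.
\<close>

definition E_times_int :: "(real^'n) set \<Rightarrow> ((real^'n) \<times> int) measure" where
  "E_times_int E = lebesgue_on E \<Otimes>\<^sub>M count_space UNIV"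

definition direct_integral_rep ::
    "(real^'n) set \<Rightarrow> (real^'n \<Rightarrow> 'g \<Rightarrow> (int \<Rightarrow> complex) \<Rightarrow> (int \<Rightarrow> complex)) \<Rightarrow>
     'g \<Rightarrow> ((real^'n) \<times> int \<Rightarrow> complex) set \<Rightarrow> ((real^'n) \<times> int \<Rightarrow> complex) set" where
  "direct_integral_rep E \<pi> g =
     L2_op (E_times_int E) (\<lambda>f (x, k). \<pi> x g (\<lambda>j. f (x, j)) k)"

section \<open>Dilation matrices and the group \<open>\<rat>\<^sub>A \<rtimes> \<int>\<close>\<close>

definition dilation_matrix :: "int^'n^'n \<Rightarrow> bool" where
  "dilation_matrix A \<longleftrightarrow>
     invertible (map_matrix of_int A :: rat^'n^'n) \<and>
     (\<forall>z. (\<exists>v. v \<noteq> 0 \<and> (map_matrix of_int A :: complex^'n^'n) *v v = z *s v) \<longrightarrow> 1 < cmod z)"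

definition real_mat :: "int^'n^'n \<Rightarrow> real^'n^'n" where
  "real_mat A = map_matrix real_of_int A"

definition mat_pow :: "real^'n^'n \<Rightarrow> nat \<Rightarrow> real^'n^'n" where
  "mat_pow A j = (((**) A) ^^ j) (mat 1)"

definition mat_powi :: "real^'n^'n \<Rightarrow> int \<Rightarrow> real^'n^'n" where
  "mat_powi A k = (if 0 \<le> k then mat_pow A (nat k) else mat_pow (matrix_inv A) (nat (- k)))"

definition int_lattice :: "(real^'n) set" where
  "int_lattice = {v. \<forall>i. v $ i \<in> \<int>}"

text \<open>\<open>\<rat>\<^sub>A\<close>, as a subgroup of \<open>\<rat>\<^sup>n \<subseteq> \<real>\<^sup>n\<close>.\<close>

definition QA :: "int^'n^'n \<Rightarrow> (real^'n) set" where
  "QA A = (\<Union>j::nat. {mat_powi (real_mat A) (- int j) *v v |v. v \<in> int_lattice})"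

definition theta :: "int^'n^'n \<Rightarrow> int \<Rightarrow> real^'n \<Rightarrow> real^'n" where
  "theta A m \<beta> = mat_powi (real_mat A) (- m) *v \<beta>"

definition QA_group :: "int^'n^'n \<Rightarrow> ((real^'n) \<times> int) monoid" where
  "QA_group A =
     \<lparr>carrier = QA A \<times> UNIV,
      mult = (\<lambda>(\<beta>1, m1) (\<beta>2, m2). (\<beta>1 + theta A m1 \<beta>2, m1 + m2)),
      one = (0, 0)\<rparr>"

definition QA_normal :: "int^'n^'n \<Rightarrow> ((real^'n) \<times> int) set" where
  "QA_normal A = QA A \<times> {0}"

section \<open>The representations \<open>W\<close> and \<open>W\<^sub>x\<close>, and wavelet sets\<close>

definition dilation_op ::
    "int^'n^'n \<Rightarrow> (real^'n \<Rightarrow> complex) set \<Rightarrow> (real^'n \<Rightarrow> complex) set" where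
  "dilation_op A =
     L2_op lebesgue (\<lambda>f t. of_real (\<bar>det (real_mat A)\<bar> powr (1/2)) * f (real_mat A *v t))"

definition translation_op ::
    "real^'n \<Rightarrow> (real^'n \<Rightarrow> complex) set \<Rightarrow> (real^'n \<Rightarrow> complex) set" where
  "translation_op \<beta> = L2_op lebesgue (\<lambda>f t. f (t - \<beta>))"

definition wavelet_rep ::
    "int^'n^'n \<Rightarrow> (real^'n) \<times> int \<Rightarrow> (real^'n \<Rightarrow> complex) set \<Rightarrow> (real^'n \<Rightarrow> complex) set" where
  "wavelet_rep A = (\<lambda>(\<beta>, m).
     translation_op \<beta> \<otimes>\<^bsub>unitary_group (L2_space lebesgue)\<^esub>
       (dilation_op A [^]\<^bsub>unitary_group (L2_space lebesgue)\<^esub> m))"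

definition W_tilde ::
    "int^'n^'n \<Rightarrow> real^'n \<Rightarrow> (real^'n) \<times> int \<Rightarrow> (int \<Rightarrow> complex) \<Rightarrow> (int \<Rightarrow> complex)" where
  "W_tilde A x = (\<lambda>(\<beta>, m). \<lambda>g\<in>carrier l2_int. \<lambda>k.
     exp (- \<i> * of_real (x \<bullet> (mat_powi (real_mat A) k *v \<beta>))) * g (k - m))"

text \<open>
  The last two conjuncts express that \<open>E\<close> is translation congruent to \<open>[-\<pi>, \<pi>)\<^sup>n\<close> modulo the lattice
  \<open>2 \<pi> \<int>\<^sup>n\<close>. Membership in \<^term>\<open>null_sets lebesgue\<close> includes measurability.
\<close>

definition transformation_wavelet_set :: "real^'n^'n \<Rightarrow> (real^'n) set \<Rightarrow> bool" where
  "transformation_wavelet_set B E \<longleftrightarrow>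
     E \<in> sets lebesgue \<and>
     (\<forall>j k. j \<noteq> k \<longrightarrow> ((*v) (mat_powi B j) ` E) \<inter> ((*v) (mat_powi B k) ` E) = {}) \<and>
     UNIV - (\<Union>j. (*v) (mat_powi B j) ` E) \<in> null_sets lebesgue \<and>
     (\<forall>v\<in>int_lattice. \<forall>w\<in>int_lattice. v \<noteq> w \<longrightarrow>
        ((\<lambda>x. x + (2 * pi) *\<^sub>R v) ` E) \<inter> ((\<lambda>x. x + (2 * pi) *\<^sub>R w) ` E) \<in> null_sets lebesgue) \<and>
     UNIV - (\<Union>v\<in>int_lattice. (\<lambda>x. x + (2 * pi) *\<^sub>R v) ` E) \<in> null_sets lebesgue"

end

theory Submission
  imports Defs "HOL-Probability.Characteristic_Functions"
    "HOL-Computational_Algebra.Fundamental_Theorem_Algebra"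
begin

text \<open>
  Write \<open>B = A\<^sup>T\<close>. The Fourier transform turns the translation \<open>T\<^sub>\<beta>\<close> into multiplication by
  \<open>exp (-i \<xi> \<bullet> \<beta>)\<close> and the dilation \<open>D\<^sub>A\<close> into the unitary dilation by \<open>B\<^sup>-\<^sup>1\<close>. Since the sets \<open>B\<^sup>k E\<close>
  tile \<open>\<real>\<^sup>n\<close>, the map \<open>(x, k) \<mapsto> B\<^sup>k x\<close> identifies \<open>E \<times> \<int>\<close> with \<open>\<real>\<^sup>n\<close> up to a null set, and
  \<open>(V g)(x, k) = \<bar>det A\<bar>\<^sup>k\<^sup>/\<^sup>2 g(B\<^sup>k x)\<close> is unitary from \<open>L\<^sup>2(\<real>\<^sup>n)\<close> to \<open>L\<^sup>2(E \<times> \<int>)\<close>. In the coordinates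
  \<open>(x, k)\<close> the dilation becomes the shift of \<open>k\<close> and the translation becomes multiplication by
  \<open>exp (-i B\<^sup>k x \<bullet> \<beta>) = exp (-i x \<bullet> A\<^sup>k \<beta>)\<close>. So \<open>V\<close> after the Fourier transform intertwines \<open>W\<close> with the
  direct integral (lemmas \<open>decompose_unitary\<close>, \<open>decompose_wavelet_fun\<close> and \<open>wavelet_rep_equivalent\<close>).

  The Plancherel theorem on \<open>\<real>\<^sup>n\<close> is obtained as follows. Call \<open>(f, g)\<close> a Fourier pair if both functions
  are integrable and square integrable and each is the (inverse) transform of the other. For such pairs
  Parseval's identity is Fubini's theorem, and all covariance properties are substitutions in an
  integral. The indicator function of an open set \<open>S\<close> of finite measure, convolved with a Gaussian, is the
  first component of a Fourier pair: its transform is a bounded function times a Gaussian. These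
  convolutions approximate the indicator function of \<open>S\<close> in \<open>L\<^sup>2\<close>, and by outer regularity such indicator
  functions span a dense subspace. The Plancherel relation is the closure of the set of Fourier pairs in
  \<open>L\<^sup>2 \<times> L\<^sup>2\<close>. Being the closure of an isometric graph, it is the graph of an isometry; it is
  everywhere defined because \<open>L\<^sup>2\<close> is complete, and it is onto because complex conjugation exchanges the
  two components.

  The fibre representation at \<open>x\<close> is induced from the character \<open>\<beta> \<mapsto> exp (-i x \<bullet> \<beta>)\<close> because a function of
  the induced space is determined by its values on the representatives \<open>(0, -k)\<close> of the cosets
  (\<open>monomial_W_tilde\<close>). It is irreducible because the characters \<open>\<beta> \<mapsto> exp (-i B\<^sup>k x \<bullet> \<beta>)\<close>, which
  \<open>\<rat>\<^sub>A\<close> has on the coordinates \<open>k\<close>, are pairwise different (\<open>irreducible_W_tilde\<close>): if two of them agree, then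
  \<open>y = B\<^sup>j x - B\<^sup>k x\<close> has \<open>y \<bullet> A\<^sup>-\<^sup>l v \<in> 2 \<pi> \<int>\<close> for all integer vectors \<open>v\<close> and all \<open>l\<close>. But \<open>A\<^sup>-\<^sup>l v\<close> tends to
  \<open>0\<close> because the eigenvalues of \<open>A\<close> lie outside the closed unit disc, so these numbers vanish for large \<open>l\<close>.
  This gives \<open>y = 0\<close>, which is impossible as \<open>B\<^sup>j E\<close> and \<open>B\<^sup>k E\<close> are disjoint.
\<close>

section \<open>Linear change of variables\<close>

text \<open>
  Both sides are multiplicative under composition, and every linear map is a composition of
  elementary ones. Coordinate swaps and shears have determinant \<open>\<plusminus>1\<close>, and it suffices to see that they
  preserve the measure of boxes.
\<close>

lemma measure_linear_image_cart:
  fixes f :: "real^'n \<Rightarrow> real^'n"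
  assumes "linear f" "S \<in> lmeasurable"
  shows "f ` S \<in> lmeasurable \<and> measure lebesgue (f ` S) = \<bar>det (matrix f)\<bar> * measure lebesgue S"
proof -
  have "\<forall>S \<in> lmeasurable. f ` S \<in> lmeasurable \<and>
          measure lebesgue (f ` S) = \<bar>det (matrix f)\<bar> * measure lebesgue S" (is "?P f")
  proof (rule induct_linear_elementary [OF \<open>linear f\<close>])
    fix f g :: "real^'n \<Rightarrow> real^'n"
    assume "linear f" "linear g" and f: "?P f" and g: "?P g"
    show "?P (f \<circ> g)"
    proof
      fix S :: "(real^'n) set" assume S: "S \<in> lmeasurable"
      have "(f \<circ> g) ` S = f ` (g ` S)"
        by (simp only: image_comp)
      then show "(f \<circ> g) ` S \<in> lmeasurable \<and>
          measure lebesgue ((f \<circ> g) ` S) = \<bar>det (matrix (f \<circ> g))\<bar> * measure lebesgue S"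
        using f g S
        by (simp only: matrix_compose[OF \<open>linear g\<close> \<open>linear f\<close>] det_mul abs_mult) simp
    qed
  next
    fix f :: "real^'n \<Rightarrow> real^'n" and i
    assume lin: "linear f" and 0: "\<And>x. f x $ i = 0"
    have "\<not> surj f"
      using 0 by (metis surjE one_neq_zero vec_component)
    then have ninj: "\<not> inj f"
      using lin linear_injective_imp_surjective by blast
    then have "negligible (f ` S)" for S
      using lin negligible_linear_singular_image by blast
    moreover have "det (matrix f) = 0"
      using ninj det_nz_iff_inj[OF lin] by blast
    ultimately show "?P f"
      by (simp add: negligible_iff_measure)
  next
    fix c :: "'n \<Rightarrow> real"
    show "?P (\<lambda>x. \<chi> i. c i * x $ i)"
      by (simp add: measurable_stretch measure_stretch axis_def matrix_def det_diagonal)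
  next
    fix m n :: 'n assume "m \<noteq> n"
    let ?t = "Transposition.transpose m n"
    let ?h = "\<lambda>x::real^'n. \<chi> i. x $ ?t i"
    have lin: "linear ?h"
      by (rule linearI) (simp_all add: vec_eq_iff)
    have box: "measure lebesgue (?h ` cbox a b) = 1 * measure lebesgue (cbox a b)" for a b
    proof (cases "cbox a b = {}")
      case False
      have eq: "?h ` cbox a b = cbox (?h a) (?h b)"
        by (auto simp: image_iff lambda_swap_Galois mem_box_cart) (metis transpose_involutory)+
      have ne: "cbox (?h a) (?h b) \<noteq> {}"
        using False unfolding eq[symmetric] by blast
      have "measure lebesgue (?h ` cbox a b) = (\<Prod>i\<in>UNIV. (b - a) $ ?t i)"
        unfolding eq using content_cbox_cart[OF ne] by simp
      also have "\<dots> = (\<Prod>i\<in>UNIV. (b - a) $ i)"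
        using prod.permute [OF permutes_swap_id, where S=UNIV and g="\<lambda>i. (b - a) $ i", of m n]
        by (simp only: o_def UNIV_I)
      also have "\<dots> = 1 * measure lebesgue (cbox a b)"
        using content_cbox_cart[OF False] by simp
      finally show ?thesis .
    qed simp
    have "matrix ?h = (\<chi> i. mat 1 $ ?t i)"
      by (auto simp: matrix_def vec_eq_iff axis_def mat_def)
    then have "\<bar>det (matrix ?h)\<bar> = 1"
      by (simp add: det_permute_rows permutes_swap_id sign_swap_id abs_mult)
    then show "?P ?h"
      using measure_linear_sufficient [OF lin _ box] by (metis (no_types, lifting) mult_1)
  next
    fix m n :: 'n assume mn: "m \<noteq> n"
    let ?h = "\<lambda>x::real^'n. \<chi> i. if i = m then x $ m + x $ n else x $ i"
    have lin: "linear ?h"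
      by (rule linearI) (simp_all add: vec_eq_iff algebra_simps)
    have box: "measure lebesgue (?h ` cbox a b) = 1 * measure lebesgue (cbox a b)" for a b
    proof (cases "cbox a b = {}")
      case False
      have tr: "cbox a b = (+) a ` cbox 0 (b - a)"
        using cbox_translation[of a 0 "b - a"] by simp
      then have ne: "cbox 0 (b - a) \<noteq> {}"
        using False by auto
      have "?h ` cbox a b = (+) (?h a) ` ?h ` cbox 0 (b - a)"
        unfolding tr image_image by (intro image_cong) (auto simp: vec_eq_iff)
      then have "measure lebesgue (?h ` cbox a b) = measure lebesgue (?h ` cbox 0 (b - a))"
        by (simp add: measure_translation)
      also have "\<dots> = measure lebesgue (cbox 0 (b - a))"
        using mn ne by (intro measure_shear_interval) auto
      also have "\<dots> = measure lebesgue (cbox a b)"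
        unfolding tr by (rule measure_translation[symmetric])
      finally show ?thesis by simp
    qed simp
    have "matrix ?h = (\<chi> k. if k = m then row m (mat 1) + 1 *s row n (mat 1) else row k (mat 1))"
      using mn by (auto simp: matrix_def vec_eq_iff axis_def mat_def row_def)
    then have "\<bar>det (matrix ?h)\<bar> = 1"
      using det_row_operation[OF mn, of "mat 1 :: real^'n^'n" 1] by simp
    then show "?P ?h"
      using measure_linear_sufficient [OF lin _ box] by (metis (no_types, lifting) mult_1)
  qed
  with assms show ?thesis
    by blast
qed

lemma lborel_linear:
  fixes A :: "real^'n^'n"
  assumes A: "invertible A"
  shows "lborel = density (distr lborel borel ((*v) A)) (\<lambda>_. ennreal \<bar>det A\<bar>)"
proof (rule lborel_eqI)
  fix l u :: "real^'n" assume le: "\<And>b. b \<in> Basis \<Longrightarrow> l \<bullet> b \<le> u \<bullet> b"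
  obtain A' where A': "A ** A' = mat 1" "A' ** A = mat 1"
    using A unfolding invertible_def by blast
  have [measurable]: "(*v) A \<in> borel \<rightarrow>\<^sub>M borel"
    by (simp add: borel_measurable_continuous_onI matrix_vector_mult_linear_continuous_on)
  have vim: "(*v) A -` box l u = (*v) A' ` box l u"
  proof (intro equalityI subsetI)
    fix x assume "x \<in> (*v) A -` box l u"
    then have "A *v x \<in> box l u" "x = A' *v (A *v x)"
      using A' by (simp_all add: matrix_vector_mul_assoc)
    then show "x \<in> (*v) A' ` box l u" by blast
  next
    fix x assume "x \<in> (*v) A' ` box l u"
    then show "x \<in> (*v) A -` box l u"
      using A' by (auto simp: matrix_vector_mul_assoc)
  qed
  have im: "(*v) A' ` box l u \<in> lmeasurable"
    "measure lebesgue ((*v) A' ` box l u) = \<bar>det A'\<bar> * measure lebesgue (box l u)"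
    using measure_linear_image_cart[of "(*v) A'" "box l u"] by auto
  have "det A * det A' = 1"
    using A'(1) by (metis det_mul det_I)
  then have dd: "\<bar>det A\<bar> * \<bar>det A'\<bar> = 1"
    by (metis abs_mult abs_one)
  have "emeasure lborel ((*v) A' ` box l u) = emeasure lebesgue ((*v) A' ` box l u)"
    using vim measurable_sets_borel[of "(*v) A" borel "box l u"] by simp
  also have "\<dots> = ennreal (measure lebesgue ((*v) A' ` box l u))"
    using im(1) by (intro emeasure_eq_measure2) (auto simp: fmeasurable_def)
  finally have "emeasure lborel ((*v) A' ` box l u) = ennreal (\<bar>det A'\<bar> * measure lebesgue (box l u))"
    by (simp add: im)
  then have "emeasure (density (distr lborel borel ((*v) A)) (\<lambda>_. ennreal \<bar>det A\<bar>)) (box l u)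
      = ennreal \<bar>det A\<bar> * ennreal (\<bar>det A'\<bar> * measure lebesgue (box l u))"
    by (simp add: emeasure_density nn_integral_cmult emeasure_distr vim)
  also have "\<dots> = ennreal (measure lebesgue (box l u))"
    using dd by (simp add: ennreal_mult'[symmetric] mult.assoc[symmetric])
  also have "\<dots> = emeasure lborel (box l u)"
    using emeasure_lborel_box_finite[of l u] by (subst emeasure_eq_ennreal_measure) auto
  also have "\<dots> = (\<Prod>b\<in>Basis. (u - l) \<bullet> b)"
    using le by simp
  finally show "emeasure (density (distr lborel borel ((*v) A)) (\<lambda>_. ennreal \<bar>det A\<bar>)) (box l u)
      = (\<Prod>b\<in>Basis. (u - l) \<bullet> b)" .
qed simp

text \<open>
  By the Borel version a set is null if and only if its preimage is null, so the formula passes to the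
  completion.
\<close>

lemma
  fixes A :: "real^'n^'n"
  assumes A: "invertible A"
  shows lebesgue_linear_measurable: "(*v) A \<in> lebesgue \<rightarrow>\<^sub>M lebesgue"
    and lebesgue_linear: "lebesgue = density (distr lebesgue lebesgue ((*v) A)) (\<lambda>_. ennreal \<bar>det A\<bar>)"
proof -
  have d: "\<bar>det A\<bar> > 0"
    using A by (simp add: invertible_det_nz)
  have T_borel[measurable]: "(*v) A \<in> borel \<rightarrow>\<^sub>M borel"
    by (simp add: borel_measurable_continuous_onI matrix_vector_mult_linear_continuous_on)
  have "emeasure lborel S = 0 \<longleftrightarrow> emeasure (distr lebesgue lborel ((*v) A)) S = 0" 
    if S: "S \<in> sets borel" for S
  proof -
    have "emeasure lborel S = 0 \<longleftrightarrow>
        emeasure (density (distr lborel borel ((*v) A)) (\<lambda>_. ennreal \<bar>det A\<bar>)) S = 0"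
      by (subst lborel_linear[OF A]) simp
    also have "\<dots> \<longleftrightarrow> emeasure (distr lebesgue lborel ((*v) A)) S = 0"
      using S d by (simp add: distr_completion emeasure_density nn_integral_cmult cong: distr_cong)
    finally show ?thesis .
  qed
  then have eq: "null_sets lborel = null_sets (distr lebesgue lborel ((*v) A))"
    by (auto simp: null_sets_def)
  show "(*v) A \<in> lebesgue \<rightarrow>\<^sub>M lebesgue"
    by (simp add: completion.measurable_completion2 eq measurable_completion)
  have "lebesgue = completion (density (distr lborel borel ((*v) A)) (\<lambda>_. ennreal \<bar>det A\<bar>))"
    by (subst lborel_linear[OF A]) simp
  also have "\<dots> = density (completion (distr lebesgue lborel ((*v) A))) (\<lambda>_. ennreal \<bar>det A\<bar>)"
    using d by (auto intro!: completion_density_eq simp: distr_completion cong: distr_cong)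
  also have "\<dots> = density (distr lebesgue lebesgue ((*v) A)) (\<lambda>_. ennreal \<bar>det A\<bar>)"
    by (subst completion.completion_distr_eq) (auto simp: eq measurable_completion)
  finally show "lebesgue = density (distr lebesgue lebesgue ((*v) A)) (\<lambda>_. ennreal \<bar>det A\<bar>)" .
qed

section \<open>Unitary maps and representations\<close>

text \<open>
  The records carry no vector space axioms. Closure under the two operations is what makes the inverse of
  a unitary map linear, and what allows operators to be transported along unitary maps.
\<close>

definition closed_ops :: "'v cinner_space \<Rightarrow> bool" where
  "closed_ops H \<longleftrightarrow>
     (\<forall>u\<in>carrier H. \<forall>v\<in>carrier H. vadd H u v \<in> carrier H) \<and>
     (\<forall>c. \<forall>v\<in>carrier H. vscale H c v \<in> carrier H)"

lemma unitary_map_in: "unitary_map H K U \<Longrightarrow> v \<in> carrier H \<Longrightarrow> U v \<in> carrier K"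
  unfolding unitary_map_def by (auto dest: bij_betwE)

text \<open>
  The homomorphism property makes \<open>\<pi> g\<close> bijective, with inverse \<open>\<pi> (g\<^sup>-\<^sup>1)\<close>.
\<close>

lemma unitary_repI:
  assumes G: "group G"
    and ext: "\<And>g. g \<in> carrier G \<Longrightarrow> \<pi> g \<in> extensional (carrier H)"
    and into: "\<And>g v. \<lbrakk>g \<in> carrier G; v \<in> carrier H\<rbrakk> \<Longrightarrow> \<pi> g v \<in> carrier H"
    and add: "\<And>g u v. \<lbrakk>g \<in> carrier G; u \<in> carrier H; v \<in> carrier H\<rbrakk>
                \<Longrightarrow> \<pi> g (vadd H u v) = vadd H (\<pi> g u) (\<pi> g v)"
    and scale: "\<And>g c v. \<lbrakk>g \<in> carrier G; v \<in> carrier H\<rbrakk> \<Longrightarrow> \<pi> g (vscale H c v) = vscale H c (\<pi> g v)"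
    and inner: "\<And>g u v. \<lbrakk>g \<in> carrier G; u \<in> carrier H; v \<in> carrier H\<rbrakk>
                \<Longrightarrow> cinner H (\<pi> g u) (\<pi> g v) = cinner H u v"
    and one: "\<And>v. v \<in> carrier H \<Longrightarrow> \<pi> \<one>\<^bsub>G\<^esub> v = v"
    and mult: "\<And>g h v. \<lbrakk>g \<in> carrier G; h \<in> carrier G; v \<in> carrier H\<rbrakk>
                \<Longrightarrow> \<pi> (g \<otimes>\<^bsub>G\<^esub> h) v = \<pi> g (\<pi> h v)"
  shows "unitary_rep G H \<pi>"
proof -
  interpret group G by fact
  have bij: "bij_betw (\<pi> g) (carrier H) (carrier H)" if g: "g \<in> carrier G" for g
  proof (rule bij_betw_byWitness[where f' = "\<pi> (inv\<^bsub>G\<^esub> g)"])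
    show "\<forall>v\<in>carrier H. \<pi> (inv\<^bsub>G\<^esub> g) (\<pi> g v) = v" "\<forall>v\<in>carrier H. \<pi> g (\<pi> (inv\<^bsub>G\<^esub> g) v) = v"
      using g mult[of "inv\<^bsub>G\<^esub> g" g] mult[of g "inv\<^bsub>G\<^esub> g"] one by auto
  qed (use g into in auto)
  have Bij: "\<pi> g \<in> Bij (carrier H)" if g: "g \<in> carrier G" for g
    using bij[OF g] ext[OF g] by (simp add: Bij_def)
  have carr: "\<pi> g \<in> carrier (unitary_group H)" if g: "g \<in> carrier G" for g
    using bij[OF g] Bij[OF g] g add scale inner
    by (simp add: unitary_group_def unitary_map_def)
  have "\<pi> \<in> hom G (unitary_group H)"
  proof (rule homI)
    fix g h assume g: "g \<in> carrier G" and h: "h \<in> carrier G"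
    have "\<pi> (g \<otimes>\<^bsub>G\<^esub> h) = compose (carrier H) (\<pi> g) (\<pi> h)"
    proof (rule extensionalityI[where A="carrier H"])
      show "\<pi> (g \<otimes>\<^bsub>G\<^esub> h) \<in> extensional (carrier H)" using ext g h by simp
      show "compose (carrier H) (\<pi> g) (\<pi> h) \<in> extensional (carrier H)"
        by (simp add: compose_def)
    qed (use g h mult in \<open>auto simp: compose_def\<close>)
    then show "\<pi> (g \<otimes>\<^bsub>G\<^esub> h) = \<pi> g \<otimes>\<^bsub>unitary_group H\<^esub> \<pi> h"
      using Bij[OF g] Bij[OF h] by (simp add: unitary_group_def BijGroup_def)
  qed (use carr in auto)
  then show ?thesis
    using G by (simp add: unitary_rep_def)
qed

lemma unitary_repD:
  assumes rep: "unitary_rep G H \<pi>"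
  shows "group G"
    and "g \<in> carrier G \<Longrightarrow> unitary_map H H (\<pi> g)"
    and "g \<in> carrier G \<Longrightarrow> \<pi> g \<in> carrier (unitary_group H)"
    and "\<lbrakk>g \<in> carrier G; h \<in> carrier G; v \<in> carrier H\<rbrakk> \<Longrightarrow> \<pi> (g \<otimes>\<^bsub>G\<^esub> h) v = \<pi> g (\<pi> h v)"
    and "v \<in> carrier H \<Longrightarrow> \<pi> \<one>\<^bsub>G\<^esub> v = v"
proof -
  show G: "group G" using rep by (simp add: unitary_rep_def)
  interpret group G by fact
  have hom: "\<pi> \<in> hom G (unitary_group H)" using rep by (simp add: unitary_rep_def)
  show carr: "\<pi> g \<in> carrier (unitary_group H)" if "g \<in> carrier G" for g
    using hom that by (rule hom_in_carrier)
  then show um: "unitary_map H H (\<pi> g)" if "g \<in> carrier G" for g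
    using that by (simp add: unitary_group_def)
  show mult: "\<pi> (g \<otimes>\<^bsub>G\<^esub> h) v = \<pi> g (\<pi> h v)" 
    if g: "g \<in> carrier G" and h: "h \<in> carrier G" and v: "v \<in> carrier H" for g h v
    using hom_mult[OF hom g h] carr[OF g] carr[OF h] v
    by (simp add: unitary_group_def BijGroup_def compose_def)
  show "\<pi> \<one>\<^bsub>G\<^esub> v = v" if v: "v \<in> carrier H" for v
  proof -
    have "\<pi> \<one>\<^bsub>G\<^esub> (\<pi> \<one>\<^bsub>G\<^esub> v) = \<pi> \<one>\<^bsub>G\<^esub> v"
      using mult[of "\<one>\<^bsub>G\<^esub>" "\<one>\<^bsub>G\<^esub>" v] v by simp
    moreover have "inj_on (\<pi> \<one>\<^bsub>G\<^esub>) (carrier H)"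
      using um[of "\<one>\<^bsub>G\<^esub>"] by (simp add: unitary_map_def bij_betw_def)
    ultimately show ?thesis
      using unitary_map_in[OF um[of "\<one>\<^bsub>G\<^esub>"] v] v by (simp add: inj_on_def)
  qed
qed

text \<open>
  The unitary \<open>U\<close> transports the axioms of a unitary representation from \<open>\<pi>\<close> to \<open>\<rho>\<close>. In this way the induced
  representation and the direct integral are seen to be representations.
\<close>

lemma unitarily_equivalentI:
  assumes rep: "unitary_rep G H \<pi>" and U: "unitary_map H K U" and cl: "closed_ops H"
    and ext: "\<And>g. g \<in> carrier G \<Longrightarrow> \<rho> g \<in> extensional (carrier K)"
    and tw: "\<And>g v. \<lbrakk>g \<in> carrier G; v \<in> carrier H\<rbrakk> \<Longrightarrow> U (\<pi> g v) = \<rho> g (U v)"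
  shows "unitarily_equivalent G H \<pi> K \<rho>"
proof -
  interpret group G using unitary_repD(1)[OF rep] .
  note um = unitary_repD(2)[OF rep] and mult = unitary_repD(4)[OF rep] and one = unitary_repD(5)[OF rep]
  have surj: "\<exists>v\<in>carrier H. w = U v" if "w \<in> carrier K" for w
    using U that by (auto simp: unitary_map_def bij_betw_def)
  note Uin = unitary_map_in[OF U] and \<pi>in = unitary_map_in[OF um]
  have Uadd: "U (vadd H u v) = vadd K (U u) (U v)" and Uscale: "U (vscale H c v) = vscale K c (U v)"
    and Uinner: "cinner K (U u) (U v) = cinner H u v"
    if "u \<in> carrier H" "v \<in> carrier H" for u v c
    using U that by (auto simp: unitary_map_def)
  have padd: "\<pi> g (vadd H u v) = vadd H (\<pi> g u) (\<pi> g v)"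
      and pscale: "\<pi> g (vscale H c v) = vscale H c (\<pi> g v)"
    and pinner: "cinner H (\<pi> g u) (\<pi> g v) = cinner H u v"
    if "g \<in> carrier G" "u \<in> carrier H" "v \<in> carrier H" for g u v c
    using um[OF that(1)] that by (auto simp: unitary_map_def)
  have cla: "vadd H u v \<in> carrier H" and cls: "vscale H c v \<in> carrier H"
    if "u \<in> carrier H" "v \<in> carrier H" for u v c
    using cl that by (auto simp: closed_ops_def)
  have "unitary_rep G K \<rho>"
  proof (rule unitary_repI)
    show "group G" by (rule is_group)
  next
    fix g w assume g: "g \<in> carrier G" and "w \<in> carrier K"
    then obtain v where v: "v \<in> carrier H" "w = U v" using surj by blast
    show "\<rho> g w \<in> carrier K"
      using tw[OF g v(1)] Uin[OF \<pi>in[OF g v(1)]] v(2) by simp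
    show "\<rho> g (vscale K c w) = vscale K c (\<rho> g w)" for c
      using g v by (metis Uscale pscale \<pi>in cls tw)
  next
    fix g w w' assume g: "g \<in> carrier G" and "w \<in> carrier K" "w' \<in> carrier K"
    then obtain v v' where v: "v \<in> carrier H" "w = U v" "v' \<in> carrier H" "w' = U v'" 
      using surj by blast
    show "\<rho> g (vadd K w w') = vadd K (\<rho> g w) (\<rho> g w')"
      using g v by (metis Uadd padd \<pi>in cla tw)
    show "cinner K (\<rho> g w) (\<rho> g w') = cinner K w w'"
      using g v by (metis Uinner pinner \<pi>in tw)
  next
    fix w assume "w \<in> carrier K"
    then obtain v where v: "v \<in> carrier H" "w = U v" using surj by blast
    then show "\<rho> \<one>\<^bsub>G\<^esub> w = w"
      using tw[of "\<one>\<^bsub>G\<^esub>" v] one by simp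
  next
    fix g h w assume gh: "g \<in> carrier G" "h \<in> carrier G" and "w \<in> carrier K"
    then obtain v where v: "v \<in> carrier H" "w = U v" using surj by blast
    then show "\<rho> (g \<otimes>\<^bsub>G\<^esub> h) w = \<rho> g (\<rho> h w)"
      using gh tw[of "g \<otimes>\<^bsub>G\<^esub> h" v] tw[of h v] tw[of g "\<pi> h v"] mult \<pi>in by simp
  qed (use ext in auto)
  then show ?thesis
    using rep U tw by (auto simp: unitarily_equivalent_def)
qed

lemma group_unitary_group:
  assumes cl: "closed_ops H"
  shows "group (unitary_group H)"
proof -
  let ?S = "{U \<in> Bij (carrier H). unitary_map H H U}"
  have "subgroup ?S (BijGroup (carrier H))"
  proof (rule group.subgroupI[OF group_BijGroup])
    show "?S \<subseteq> carrier (BijGroup (carrier H))" by (auto simp: BijGroup_def)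
    have "(\<lambda>v\<in>carrier H. v) \<in> ?S"
      using cl by (auto simp: id_Bij unitary_map_def closed_ops_def bij_betw_def inj_on_def)
    then show "?S \<noteq> {}" by blast
  next
    fix U assume U: "U \<in> ?S"
    define V where "V = (\<lambda>v\<in>carrier H. inv_into (carrier H) U v)"
    have bij: "bij_betw U (carrier H) (carrier H)" using U by (simp add: Bij_def)
    have V_in: "V v \<in> carrier H" "U (V v) = v" if "v \<in> carrier H" for v
      using bij that by (auto simp: V_def bij_betw_def inv_into_into f_inv_into_f)
    have VU: "V (U v) = v" if "v \<in> carrier H" for v
      using bij that unitary_map_in[of H H U v] U by (simp add: V_def bij_betw_def)
    have Uu: "unitary_map H H U" using U by simp
    have "V \<in> Bij (carrier H)"
      unfolding V_def using U by (intro restrict_inv_into_Bij) simp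
    moreover have "unitary_map H H V"
      unfolding unitary_map_def
    proof (intro conjI ballI allI)
      show "bij_betw V (carrier H) (carrier H)"
        using \<open>V \<in> Bij (carrier H)\<close> by (simp add: Bij_def)
    next
      fix u v assume uv: "u \<in> carrier H" "v \<in> carrier H"
      have "V (vadd H (U (V u)) (U (V v))) = V (U (vadd H (V u) (V v)))"
        using Uu V_in uv by (simp add: unitary_map_def)
      then show "V (vadd H u v) = vadd H (V u) (V v)"
        using V_in uv cl by (simp add: VU closed_ops_def)
      have "cinner H (U (V u)) (U (V v)) = cinner H (V u) (V v)"
        using Uu V_in(1)[OF uv(1)] V_in(1)[OF uv(2)] unfolding unitary_map_def by blast
      then show "cinner H (V u) (V v) = cinner H u v"
        using V_in uv by simp
    next
      fix c v assume v: "v \<in> carrier H"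
      have "V (vscale H c (U (V v))) = V (U (vscale H c (V v)))"
        using Uu V_in(1)[OF v] unfolding unitary_map_def by metis
      then show "V (vscale H c v) = vscale H c (V v)"
        using V_in v cl by (simp add: VU closed_ops_def)
    qed
    ultimately show "inv\<^bsub>BijGroup (carrier H)\<^esub> U \<in> ?S"
      using U inv_BijGroup[of U "carrier H"] by (simp add: V_def)
  next
    fix U V assume UV: "U \<in> ?S" "V \<in> ?S"
    have "unitary_map H H (compose (carrier H) U V)"
      using UV cl unitary_map_in[of H H V] bij_betw_compose[of V "carrier H" "carrier H" U "carrier H"]
      by (auto simp: unitary_map_def compose_def closed_ops_def)
    then show "U \<otimes>\<^bsub>BijGroup (carrier H)\<^esub> V \<in> ?S"
      using UV by (simp add: BijGroup_def compose_Bij)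
  qed
  then show ?thesis
    unfolding unitary_group_def using subgroup.subgroup_is_group[OF _ group_BijGroup] by fastforce
qed

section \<open>Square integrable functions\<close>

definition L2_inner :: "'a measure \<Rightarrow> ('a \<Rightarrow> complex) \<Rightarrow> ('a \<Rightarrow> complex) \<Rightarrow> complex" where
  "L2_inner M f g = (\<integral>x. f x * cnj (g x) \<partial>M)"

definition L2_norm :: "'a measure \<Rightarrow> ('a \<Rightarrow> complex) \<Rightarrow> real" where
  "L2_norm M f = sqrt (\<integral>x. (cmod (f x))\<^sup>2 \<partial>M)"

lemma borel_measurable_cnj [measurable]: "cnj \<in> borel \<rightarrow>\<^sub>M borel"
  by (intro borel_measurable_continuous_onI continuous_intros)

lemma sq_integrableD:
  "f \<in> sq_integrable M \<Longrightarrow> f \<in> borel_measurable M"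
  "f \<in> sq_integrable M \<Longrightarrow> integrable M (\<lambda>x. (cmod (f x))\<^sup>2)"
  by (auto simp: sq_integrable_def)

lemma sq_integrableI_bound:
  assumes f: "f \<in> borel_measurable M" and "integrable M h" and "AE x in M. (cmod (f x))\<^sup>2 \<le> h x"
  shows "f \<in> sq_integrable M"
  unfolding sq_integrable_def
  using assms by (auto intro!: Bochner_Integration.integrable_bound[of M h] elim!: eventually_mono)

lemma sq_integrable_scale:
  "f \<in> sq_integrable M \<Longrightarrow> (\<lambda>x. c * f x) \<in> sq_integrable M"
  by (auto simp: sq_integrable_def norm_mult power_mult_distrib)

lemma sq_integrable_add:
  assumes "f \<in> sq_integrable M" "g \<in> sq_integrable M"
  shows "(\<lambda>x. f x + g x) \<in> sq_integrable M"
proof (rule sq_integrableI_bound)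
  note [measurable] = sq_integrableD(1)[OF assms(1)] sq_integrableD(1)[OF assms(2)]
  show "(\<lambda>x. f x + g x) \<in> borel_measurable M" by simp
  show "integrable M (\<lambda>x. 2 * (cmod (f x))\<^sup>2 + 2 * (cmod (g x))\<^sup>2)"
    using assms by (auto simp: sq_integrable_def)
  have "(cmod (a + b))\<^sup>2 \<le> 2 * (cmod a)\<^sup>2 + 2 * (cmod b)\<^sup>2" for a b
  proof -
    have "(cmod (a + b))\<^sup>2 \<le> (cmod a + cmod b)\<^sup>2"
      by (simp add: norm_triangle_ineq power_mono)
    also have "\<dots> \<le> 2 * (cmod a)\<^sup>2 + 2 * (cmod b)\<^sup>2"
      using sum_squares_bound[of "cmod a" "cmod b"] by (simp add: power2_sum)
    finally show ?thesis .
  qed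
  then show "AE x in M. (cmod (f x + g x))\<^sup>2 \<le> 2 * (cmod (f x))\<^sup>2 + 2 * (cmod (g x))\<^sup>2"
    by simp
qed

lemma sq_integrable_diff:
  assumes "f \<in> sq_integrable M" "g \<in> sq_integrable M"
  shows "(\<lambda>x. f x - g x) \<in> sq_integrable M"
  using sq_integrable_add[OF assms(1) sq_integrable_scale[OF assms(2), of "-1"]] by simp

lemma sq_integrable_AE_cong:
  assumes "f \<in> sq_integrable M" "g \<in> borel_measurable M" "AE x in M. f x = g x"
  shows "g \<in> sq_integrable M"
  using assms by (intro sq_integrableI_bound[of _ _ "\<lambda>x. (cmod (f x))\<^sup>2"])
    (auto dest: sq_integrableD elim: eventually_mono)

lemma integrable_prod_norm:
  assumes "f \<in> sq_integrable M" "g \<in> sq_integrable M"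
  shows "integrable M (\<lambda>x. cmod (f x) * cmod (g x))"
proof (rule Bochner_Integration.integrable_bound)
  note [measurable] = sq_integrableD(1)[OF assms(1)] sq_integrableD(1)[OF assms(2)]
  show "integrable M (\<lambda>x. (cmod (f x))\<^sup>2 + (cmod (g x))\<^sup>2)"
    using assms by (auto simp: sq_integrable_def)
  show "(\<lambda>x. cmod (f x) * cmod (g x)) \<in> borel_measurable M" by simp
  have "a * b \<le> a\<^sup>2 + b\<^sup>2" if "a \<ge> 0" "b \<ge> 0" for a b :: real
    using sum_squares_bound[of a b] mult_nonneg_nonneg[OF that] by linarith
  then show "AE x in M. norm (cmod (f x) * cmod (g x)) \<le> norm ((cmod (f x))\<^sup>2 + (cmod (g x))\<^sup>2)"
    by simp
qed

lemma integrable_L2_inner: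
  assumes "f \<in> sq_integrable M" "g \<in> sq_integrable M"
  shows "integrable M (\<lambda>x. f x * cnj (g x))"
proof (rule Bochner_Integration.integrable_bound[OF integrable_prod_norm[OF assms]])
  note [measurable] = sq_integrableD(1)[OF assms(1)] sq_integrableD(1)[OF assms(2)]
  show "(\<lambda>x. f x * cnj (g x)) \<in> borel_measurable M" by simp
qed (simp add: norm_mult)

lemma L2_inner_add_left:
  "\<lbrakk>f \<in> sq_integrable M; g \<in> sq_integrable M; h \<in> sq_integrable M\<rbrakk>
    \<Longrightarrow> L2_inner M (\<lambda>x. f x + g x) h = L2_inner M f h + L2_inner M g h"
  by (simp add: L2_inner_def distrib_right integrable_L2_inner)

lemma L2_inner_diff_left:
  "\<lbrakk>f \<in> sq_integrable M; g \<in> sq_integrable M; h \<in> sq_integrable M\<rbrakk>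
    \<Longrightarrow> L2_inner M (\<lambda>x. f x - g x) h = L2_inner M f h - L2_inner M g h"
  by (simp add: L2_inner_def left_diff_distrib integrable_L2_inner)

lemma L2_inner_scale_left: "L2_inner M (\<lambda>x. c * f x) h = c * L2_inner M f h"
  by (simp add: L2_inner_def mult.assoc)

lemma L2_inner_cnj: "L2_inner M g f = cnj (L2_inner M f g)"
  unfolding L2_inner_def Bochner_Integration.integral_cnj[symmetric]
  by (simp only: complex_cnj_mult complex_cnj_cnj mult.commute)

lemma L2_inner_add_right:
  "\<lbrakk>f \<in> sq_integrable M; g \<in> sq_integrable M; h \<in> sq_integrable M\<rbrakk>
    \<Longrightarrow> L2_inner M h (\<lambda>x. f x + g x) = L2_inner M h f + L2_inner M h g"
  by (subst (1 2 3) L2_inner_cnj) (simp add: L2_inner_add_left)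

lemma L2_inner_diff_right:
  "\<lbrakk>f \<in> sq_integrable M; g \<in> sq_integrable M; h \<in> sq_integrable M\<rbrakk>
    \<Longrightarrow> L2_inner M h (\<lambda>x. f x - g x) = L2_inner M h f - L2_inner M h g"
  by (subst (1 2 3) L2_inner_cnj) (simp add: L2_inner_diff_left)

lemma L2_inner_AE_cong:
  assumes "f \<in> borel_measurable M" "f' \<in> borel_measurable M" "g \<in> borel_measurable M"
      "g' \<in> borel_measurable M"
    "AE x in M. f x = f' x" "AE x in M. g x = g' x"
  shows "L2_inner M f g = L2_inner M f' g'"
  unfolding L2_inner_def
proof (rule integral_cong_AE)
  note [measurable] = assms(1-4)
  show "(\<lambda>x. f x * cnj (g x)) \<in> borel_measurable M" "(\<lambda>x. f' x * cnj (g' x)) \<in> borel_measurable M"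
    by simp_all
  show "AE x in M. f x * cnj (g x) = f' x * cnj (g' x)"
    using assms(5,6) by eventually_elim simp
qed

lemma L2_norm_nonneg [simp]: "0 \<le> L2_norm M f"
  by (simp add: L2_norm_def)

lemma L2_norm_sq: "(L2_norm M f)\<^sup>2 = (\<integral>x. (cmod (f x))\<^sup>2 \<partial>M)"
  by (simp add: L2_norm_def)

lemma L2_inner_self: "L2_inner M f f = of_real ((L2_norm M f)\<^sup>2)"
  by (simp add: L2_inner_def L2_norm_sq complex_norm_square[symmetric] del: of_real_power)

lemma L2_norm_eqI: "L2_inner N g g = L2_inner M f f \<Longrightarrow> L2_norm N g = L2_norm M f"
  by (metis L2_inner_self L2_norm_nonneg of_real_eq_iff power2_eq_imp_eq)

lemma L2_norm_eq_0_iff: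
  assumes "f \<in> sq_integrable M"
  shows "L2_norm M f = 0 \<longleftrightarrow> (AE x in M. f x = 0)"
  using integral_nonneg_eq_0_iff_AE[of M "\<lambda>x. (cmod (f x))\<^sup>2"] sq_integrableD(2)[OF assms]
  by (simp add: L2_norm_def)

lemma L2_norm_scale: "L2_norm M (\<lambda>x. c * f x) = cmod c * L2_norm M f"
  by (simp add: L2_norm_def norm_mult power_mult_distrib real_sqrt_mult)

text \<open>
  The Cauchy-Schwarz inequality, from \<open>0 \<le> \<integral> (a \<bar>f\<bar> - b \<bar>g\<bar>)\<^sup>2\<close> with \<open>a\<close> the norm of \<open>g\<close> and \<open>b\<close> the norm of \<open>f\<close>.
\<close>

lemma L2_inner_bound:
  assumes f: "f \<in> sq_integrable M" and g: "g \<in> sq_integrable M"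
  shows "cmod (L2_inner M f g) \<le> L2_norm M f * L2_norm M g"
proof -
  define I where "I = (\<integral>x. cmod (f x) * cmod (g x) \<partial>M)"
  have le: "cmod (L2_inner M f g) \<le> I"
    unfolding L2_inner_def I_def using integral_norm_bound[of M "\<lambda>x. f x * cnj (g x)"] 
    by (simp add: norm_mult)
  have quad: "2 * (a * b) * I \<le> a\<^sup>2 * (L2_norm M f)\<^sup>2 + b\<^sup>2 * (L2_norm M g)\<^sup>2" for a b
  proof -
    have "0 \<le> (\<integral>x. (a * cmod (f x) - b * cmod (g x))\<^sup>2 \<partial>M)"
      by simp
    also have "\<dots> = (\<integral>x. a\<^sup>2 * (cmod (f x))\<^sup>2
        + b\<^sup>2 * (cmod (g x))\<^sup>2 - 2 * (a * b) * (cmod (f x) * cmod (g x)) \<partial>M)"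
      by (rule Bochner_Integration.integral_cong) (auto simp: power2_eq_square algebra_simps)
    also have "\<dots> = a\<^sup>2 * (L2_norm M f)\<^sup>2 + b\<^sup>2 * (L2_norm M g)\<^sup>2 - 2 * (a * b) * I"
      using sq_integrableD(2)[OF f] sq_integrableD(2)[OF g] integrable_prod_norm[OF f g]
      by (simp add: L2_norm_sq I_def)
    finally show ?thesis by simp
  qed
  show ?thesis
  proof (cases "L2_norm M f = 0 \<or> L2_norm M g = 0")
    case True
    have "AE x in M. cmod (f x) * cmod (g x) = 0"
    proof (cases "L2_norm M f = 0")
      case True
      then show ?thesis using L2_norm_eq_0_iff[OF f] by auto
    next
      case False
      then have "AE x in M. g x = 0" using True L2_norm_eq_0_iff[OF g] by auto
      then show ?thesis by auto
    qed
    then have "I = 0"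
      unfolding I_def by (rule integral_eq_zero_AE)
    then show ?thesis using le True by auto
  next
    case False
    define a b where "a = L2_norm M f" and "b = L2_norm M g"
    have ab: "a > 0" "b > 0"
      using False L2_norm_nonneg[of M f] L2_norm_nonneg[of M g] unfolding a_def b_def by linarith+
    have "2 * (b * a) * I \<le> 2 * (b * a) * (a * b)"
      using quad[of b a] unfolding a_def[symmetric] b_def[symmetric]
      by (simp add: power2_eq_square algebra_simps)
    then have "I \<le> a * b"
      using ab by (simp add: mult_le_cancel_left_pos)
    then show ?thesis using le by (simp add: a_def b_def)
  qed
qed

lemma L2_norm_triangle:
  assumes f: "f \<in> sq_integrable M" and g: "g \<in> sq_integrable M"
  shows "L2_norm M (\<lambda>x. f x + g x) \<le> L2_norm M f + L2_norm M g"
proof (rule power2_le_imp_le)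
  have "complex_of_real ((L2_norm M (\<lambda>x. f x + g x))\<^sup>2) = L2_inner M (\<lambda>x. f x + g x) (\<lambda>x. f x + g x)"
    by (rule L2_inner_self[symmetric])
  also have "\<dots> = L2_inner M f f + L2_inner M g g + (L2_inner M f g + cnj (L2_inner M f g))"
    using f g by (simp add: L2_inner_add_left L2_inner_add_right sq_integrable_add L2_inner_cnj[of M g
        f])
  also have "\<dots> = of_real ((L2_norm M f)\<^sup>2 + (L2_norm M g)\<^sup>2 + 2 * Re (L2_inner M f g))"
    by (simp add: L2_inner_self complex_add_cnj)
  finally have "(L2_norm M (\<lambda>x. f x + g x))\<^sup>2
      = (L2_norm M f)\<^sup>2 + (L2_norm M g)\<^sup>2 + 2 * Re (L2_inner M f g)"
    using of_real_eq_iff by blast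
  moreover have "Re (L2_inner M f g) \<le> L2_norm M f * L2_norm M g"
    using L2_inner_bound[OF f g] complex_Re_le_cmod order_trans by blast
  ultimately show "(L2_norm M (\<lambda>x. f x + g x))\<^sup>2 \<le> (L2_norm M f + L2_norm M g)\<^sup>2"
    by (simp add: power2_sum)
qed simp

lemma L2_norm_minus_commute: "L2_norm M (\<lambda>x. f x - g x) = L2_norm M (\<lambda>x. g x - f x)"
  by (simp add: L2_norm_def norm_minus_commute)

lemma L2_norm_triangle_diff:
  assumes "f \<in> sq_integrable M" "g \<in> sq_integrable M" "h \<in> sq_integrable M"
  shows "L2_norm M (\<lambda>x. f x - h x) \<le> L2_norm M (\<lambda>x. f x - g x) + L2_norm M (\<lambda>x. g x - h x)"
  using L2_norm_triangle[OF sq_integrable_diff[OF assms(1,2)] sq_integrable_diff[OF assms(2,3)]] by simp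

lemma L2_norm_triangle_sub:
  assumes "f \<in> sq_integrable M" "g \<in> sq_integrable M"
  shows "L2_norm M f \<le> L2_norm M g + L2_norm M (\<lambda>x. f x - g x)"
  using L2_norm_triangle[OF assms(2) sq_integrable_diff[OF assms]] by simp

subsection \<open>Completeness\<close>

text \<open>
  The theorem of Riesz and Fischer, for a sequence with geometrically small increments. The squared
  increments remain summable in \<open>L\<^sup>1\<close> after multiplication by \<open>4\<^sup>n\<close>, so almost everywhere the
  increments are eventually at most \<open>2\<^sup>-\<^sup>n\<close> and the sequence converges pointwise. Fatou's lemma bounds
  the distance to the limit.
\<close>

lemma L2_complete:
  assumes f: "\<And>n::nat. f n \<in> sq_integrable M"
    and cauchy: "\<And>n. L2_norm M (\<lambda>x. f (Suc n) x - f n x) \<le> C * (1/4) ^ n"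
  shows "\<exists>g\<in>sq_integrable M. (\<lambda>n. L2_norm M (\<lambda>x. g x - f n x)) \<longlonglongrightarrow> 0"
proof -
  note [measurable] = sq_integrableD(1)[OF f]
  define d where "d n x = f (Suc n) x - f n x" for n x
  have d: "d n \<in> sq_integrable M" for n
    unfolding d_def by (intro sq_integrable_diff f)
  have C: "C \<ge> 0"
    using order_trans[OF L2_norm_nonneg cauchy[of 0]] by simp
  have nn: "(\<integral>\<^sup>+x. ennreal ((cmod (h x))\<^sup>2) \<partial>M) = ennreal ((L2_norm M h)\<^sup>2)" 
    if "h \<in> sq_integrable M" for h
    using sq_integrableD(2)[OF that] by (simp add: nn_integral_eq_integral L2_norm_sq)
  have fin: "(\<integral>\<^sup>+x. (\<Sum>n. ennreal (4 ^ n * (cmod (d n x))\<^sup>2)) \<partial>M) < \<infinity>"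
  proof -
    have "(\<integral>\<^sup>+x. (\<Sum>n. ennreal (4 ^ n * (cmod (d n x))\<^sup>2)) \<partial>M) 
        = (\<Sum>n. \<integral>\<^sup>+x. ennreal (4 ^ n * (cmod (d n x))\<^sup>2) \<partial>M)"
      by (subst nn_integral_suminf) (auto simp: d_def)
    also have "\<dots> = (\<Sum>n. ennreal (4 ^ n * (L2_norm M (d n))\<^sup>2))"
      using sq_integrableD(1)[OF d] by (simp add: ennreal_mult nn_integral_cmult nn[OF d])
    also have "\<dots> \<le> (\<Sum>n. ennreal (C\<^sup>2 * (1/4) ^ n))"
    proof (intro suminf_le ennreal_leI)
      fix n
      have "(L2_norm M (d n))\<^sup>2 \<le> (C * (1/4) ^ n)\<^sup>2"
        using cauchy[of n] by (intro power_mono) (auto simp: d_def[abs_def])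
      then have "4 ^ n * (L2_norm M (d n))\<^sup>2 \<le> 4 ^ n * (C * (1/4) ^ n)\<^sup>2"
        by simp
      also have "\<dots> = C\<^sup>2 * (1/4) ^ n"
        by (simp add: power_mult_distrib power2_eq_square field_simps flip: power_mult_distrib)
      finally show "4 ^ n * (L2_norm M (d n))\<^sup>2 \<le> C\<^sup>2 * (1/4) ^ n" .
    qed auto
    also have "\<dots> = ennreal (\<Sum>n. C\<^sup>2 * (1/4) ^ n)"
      by (intro suminf_ennreal2 summable_mult summable_geometric) auto
    finally show ?thesis by (simp add: le_less_trans)
  qed
  have ae: "AE x in M. (\<Sum>n. ennreal (4 ^ n * (cmod (d n x))\<^sup>2)) \<noteq> \<infinity>"
    using fin by (intro nn_integral_PInf_AE) (auto simp: d_def)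
  have conv: "convergent (\<lambda>n. f n x)" if "(\<Sum>n. ennreal (4 ^ n * (cmod (d n x))\<^sup>2)) \<noteq> \<infinity>" for x
  proof -
    have "summable (\<lambda>n. 4 ^ n * (cmod (d n x))\<^sup>2)"
      using that by (intro summable_suminf_not_top) auto
    then have "(\<lambda>n. 4 ^ n * (cmod (d n x))\<^sup>2) \<longlonglongrightarrow> 0"
      by (rule summable_LIMSEQ_zero)
    then have "\<forall>\<^sub>F n in sequentially. 4 ^ n * (cmod (d n x))\<^sup>2 < 1"
      by (rule order_tendstoD) simp
    then have "\<forall>\<^sub>F n in sequentially. norm (d n x) \<le> (1/2) ^ n"
    proof eventually_elim
      case (elim n)
      have "((2::real) ^ n)\<^sup>2 = 4 ^ n"
        by (simp add: power2_eq_square flip: power_mult_distrib)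
      then have "(2 ^ n * cmod (d n x))\<^sup>2 < 1\<^sup>2"
        using elim by (simp add: power_mult_distrib)
      then have "2 ^ n * cmod (d n x) < 1"
        by (rule power2_less_imp_less) simp
      then show ?case by (simp add: field_simps)
    qed
    then have "summable (\<lambda>n. d n x)"
      by (rule summable_comparison_test_ev) (auto intro: summable_geometric)
    then have "convergent (\<lambda>n. \<Sum>i<n. d i x)"
      by (simp add: summable_iff_convergent)
    moreover have "(\<Sum>i<n. d i x) = f n x - f 0 x" for n
      unfolding d_def by (rule sum_lessThan_telescope)
    ultimately have "convergent (\<lambda>n. f n x - f 0 x)" by simp
    then show ?thesis by (simp add: convergent_diff_const_right_iff)
  qed
  define g where "g x = lim (\<lambda>n. f n x)" for x
  have [measurable]: "g \<in> borel_measurable M"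
    unfolding g_def by measurable
  have lim: "AE x in M. (\<lambda>n. f n x) \<longlonglongrightarrow> g x"
    using ae by eventually_elim (use conv in \<open>auto simp: g_def convergent_LIMSEQ_iff\<close>)
  have tail: "L2_norm M (\<lambda>x. f (n + k) x - f n x) \<le> 2 * C * (1/4) ^ n" for n k
  proof -
    have "L2_norm M (\<lambda>x. f (n + k) x - f n x) \<le> (\<Sum>i<k. C * (1/4) ^ (n + i))"
    proof (induction k)
      case (Suc k)
      have "L2_norm M (\<lambda>x. f (n + Suc k) x - f n x)
          \<le> L2_norm M (\<lambda>x. f (n + Suc k) x - f (n + k) x) + L2_norm M (\<lambda>x. f (n + k) x - f n x)"
        by (rule L2_norm_triangle_diff[OF f f f])
      also have "\<dots> \<le> C * (1/4) ^ (n + k) + (\<Sum>i<k. C * (1/4) ^ (n + i))"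
        using cauchy[of "n + k"] Suc by simp
      finally show ?case by simp
    qed (simp add: L2_norm_def)
    also have "\<dots> = C * (1/4) ^ n * (\<Sum>i<k. (1/4) ^ i)"
      by (simp add: power_add sum_distrib_left mult.assoc)
    also have "\<dots> \<le> C * (1/4) ^ n * 2"
    proof (rule mult_left_mono)
      have "(\<Sum>i<k. (1/4::real) ^ i) \<le> (\<Sum>i. (1/4) ^ i)"
        by (intro sum_le_suminf) (auto intro: summable_geometric)
      also have "\<dots> = 4/3" by (simp add: suminf_geometric)
      finally show "(\<Sum>i<k. (1/4::real) ^ i) \<le> 2" by simp
    qed (use C in simp)
    finally show ?thesis by simp
  qed
  have bound: "(\<integral>\<^sup>+x. ennreal ((cmod (g x - f n x))\<^sup>2) \<partial>M) \<le> ennreal ((2 * C * (1/4) ^ n)\<^sup>2)" for n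
  proof -
    have "(\<integral>\<^sup>+x. ennreal ((cmod (g x - f n x))\<^sup>2) \<partial>M)
        = (\<integral>\<^sup>+x. liminf (\<lambda>k. ennreal ((cmod (f (n + k) x - f n x))\<^sup>2)) \<partial>M)"
    proof (rule nn_integral_cong_AE, use lim in eventually_elim)
      case (elim x)
      have "(\<lambda>k. f (n + k) x) \<longlonglongrightarrow> g x"
        using LIMSEQ_ignore_initial_segment[OF elim, of n] by (simp add: add.commute)
      then have "(\<lambda>k. ennreal ((cmod (f (n + k) x - f n x))\<^sup>2)) \<longlonglongrightarrow> ennreal ((cmod (g x - f n x))\<^sup>2)"
        by (intro tendsto_ennrealI tendsto_intros)
      then show ?case
        by (rule lim_imp_Liminf[OF trivial_limit_sequentially, symmetric])
    qed
    also have "\<dots> \<le> liminf (\<lambda>k. \<integral>\<^sup>+x. ennreal ((cmod (f (n + k) x - f n x))\<^sup>2) \<partial>M)"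
      by (intro nn_integral_liminf) auto
    also have "\<dots> = liminf (\<lambda>k. ennreal ((L2_norm M (\<lambda>x. f (n + k) x - f n x))\<^sup>2))"
      by (simp add: nn sq_integrable_diff f)
    also have "\<dots> \<le> liminf (\<lambda>k::nat. ennreal ((2 * C * (1/4) ^ n)\<^sup>2))"
      using tail by (intro Liminf_mono always_eventually allI ennreal_leI power_mono) auto
    finally show ?thesis by (simp add: Liminf_const)
  qed
  have gd: "(\<lambda>x. g x - f n x) \<in> sq_integrable M" for n
    unfolding sq_integrable_def
    using bound[of n] by (auto simp: integrable_iff_bounded intro: le_less_trans)
  have g: "g \<in> sq_integrable M"
    using sq_integrable_add[OF gd[of 0] f[of 0]] by simp
  have le: "norm (L2_norm M (\<lambda>x. g x - f n x)) \<le> 2 * C * (1/4) ^ n" for n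
  proof -
    have "ennreal ((L2_norm M (\<lambda>x. g x - f n x))\<^sup>2) \<le> ennreal ((2 * C * (1/4) ^ n)\<^sup>2)"
      using bound[of n] unfolding nn[OF gd[of n]] .
    then have "(L2_norm M (\<lambda>x. g x - f n x))\<^sup>2 \<le> (2 * C * (1/4) ^ n)\<^sup>2"
      by (subst (asm) ennreal_le_iff) simp_all
    moreover have "0 \<le> 2 * C * (1/4) ^ n"
      using C by simp
    ultimately have "L2_norm M (\<lambda>x. g x - f n x) \<le> 2 * C * (1/4) ^ n"
      by (rule power2_le_imp_le)
    then show ?thesis by simp
  qed
  have "(\<lambda>n. 2 * C * (1/4) ^ n) \<longlonglongrightarrow> 0"
    by (intro tendsto_mult_right_zero LIMSEQ_power_zero) simp
  then have "(\<lambda>n. L2_norm M (\<lambda>x. g x - f n x)) \<longlonglongrightarrow> 0"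
    by (rule Lim_null_comparison[OF always_eventually[OF allI[OF le]]])
  with g show ?thesis by blast
qed

subsection \<open>Classes modulo null sets\<close>

lemma equiv_ae_rel: "equiv (sq_integrable M) (ae_rel M)"
proof (rule equivI)
  show "ae_rel M \<subseteq> sq_integrable M \<times> sq_integrable M"
    by (auto simp: ae_rel_def)
  show "refl_on (sq_integrable M) (ae_rel M)"
    by (auto simp: refl_on_def ae_rel_def)
  show "sym (ae_rel M)"
    by (auto simp: sym_def ae_rel_def elim: eventually_mono)
  show "trans (ae_rel M)"
  proof (rule transI)
    fix f g h assume "(f, g) \<in> ae_rel M" "(g, h) \<in> ae_rel M"
    then have "f \<in> sq_integrable M" "h \<in> sq_integrable M" "AE x in M. f x = g x" "AE x in M. g x = h x"
      by (auto simp: ae_rel_def)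
    then show "(f, h) \<in> ae_rel M"
      by (auto simp: ae_rel_def elim: eventually_elim2)
  qed
qed

lemma L2_class_in: "f \<in> sq_integrable M \<Longrightarrow> L2_class M f \<in> carrier (L2_space M)"
  by (simp add: L2_class_def L2_space_def quotientI)

lemma L2_class_eq_iff:
  assumes "f \<in> sq_integrable M" "g \<in> sq_integrable M"
  shows "L2_class M f = L2_class M g \<longleftrightarrow> (AE x in M. f x = g x)"
  using eq_equiv_class_iff[OF equiv_ae_rel assms] assms by (simp add: L2_class_def ae_rel_def)

lemma L2_rep_class:
  assumes f: "f \<in> sq_integrable M"
  shows "L2_rep (L2_class M f) \<in> sq_integrable M"
    and "AE x in M. L2_rep (L2_class M f) x = f x"
    and "L2_class M (L2_rep (L2_class M f)) = L2_class M f"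
proof -
  have "f \<in> L2_class M f"
    using f by (simp add: L2_class_def ae_rel_def)
  then have "L2_rep (L2_class M f) \<in> L2_class M f"
    unfolding L2_rep_def by (rule someI[where P = "\<lambda>g. g \<in> L2_class M f"])
  then have "(f, L2_rep (L2_class M f)) \<in> ae_rel M"
    by (simp add: L2_class_def)
  then show *: "L2_rep (L2_class M f) \<in> sq_integrable M" "AE x in M. L2_rep (L2_class M f) x = f x"
    by (auto simp: ae_rel_def elim: eventually_mono)
  then show "L2_class M (L2_rep (L2_class M f)) = L2_class M f"
    using f by (simp add: L2_class_eq_iff)
qed

lemma L2_carrierE:
  assumes "F \<in> carrier (L2_space M)"
  obtains f where "f \<in> sq_integrable M" "F = L2_class M f"
  using assms by (auto simp: L2_space_def L2_class_def elim!: quotientE)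

lemma L2_vadd_class:
  assumes "f \<in> sq_integrable M" "g \<in> sq_integrable M"
  shows "vadd (L2_space M) (L2_class M f) (L2_class M g) = L2_class M (\<lambda>x. f x + g x)"
proof -
  have "L2_class M (\<lambda>x. L2_rep (L2_class M f) x + L2_rep (L2_class M g) x) = L2_class M (\<lambda>x. f x + g x)"
    using L2_rep_class(1,2)[OF assms(1)] L2_rep_class(1,2)[OF assms(2)] assms
    by (subst L2_class_eq_iff) (auto intro!: sq_integrable_add elim: eventually_elim2)
  then show ?thesis by (simp add: L2_space_def)
qed

lemma L2_vscale_class:
  assumes "f \<in> sq_integrable M"
  shows "vscale (L2_space M) c (L2_class M f) = L2_class M (\<lambda>x. c * f x)"
proof -
  have "L2_class M (\<lambda>x. c * L2_rep (L2_class M f) x) = L2_class M (\<lambda>x. c * f x)"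
    using L2_rep_class(1,2)[OF assms(1)] assms
    by (subst L2_class_eq_iff) (auto intro!: sq_integrable_scale elim: eventually_mono)
  then show ?thesis by (simp add: L2_space_def)
qed

lemma L2_cinner_class:
  assumes "f \<in> sq_integrable M" "g \<in> sq_integrable M"
  shows "cinner (L2_space M) (L2_class M f) (L2_class M g) = L2_inner M f g"
proof -
  have "L2_inner M (L2_rep (L2_class M f)) (L2_rep (L2_class M g)) = L2_inner M f g"
    using L2_rep_class(1,2)[OF assms(1)] L2_rep_class(1,2)[OF assms(2)] assms
    by (intro L2_inner_AE_cong) (auto dest: sq_integrableD)
  then show ?thesis by (simp add: L2_space_def L2_inner_def)
qed

lemma closed_ops_L2: "closed_ops (L2_space M)"
  unfolding closed_ops_def
  by (auto elim!: L2_carrierE simp: L2_vadd_class L2_vscale_class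
      intro!: L2_class_in sq_integrable_add sq_integrable_scale)

lemma L2_op_class:
  assumes f: "f \<in> sq_integrable M"
    and into: "\<And>f'. f' \<in> sq_integrable M \<Longrightarrow> \<Phi> f' \<in> sq_integrable M"
    and cong: "\<And>f'. \<lbrakk>f' \<in> sq_integrable M; AE x in M. f' x = f x\<rbrakk> \<Longrightarrow> AE x in M. \<Phi> f' x = h x"
    and h: "h \<in> sq_integrable M"
  shows "L2_op M \<Phi> (L2_class M f) = L2_class M h"
proof -
  have "L2_class M (\<Phi> (L2_rep (L2_class M f))) = L2_class M h"
    using into[OF L2_rep_class(1)[OF f]] cong[OF L2_rep_class(1,2)[OF f]] h
    by (simp add: L2_class_eq_iff)
  then show ?thesis
    using f by (simp add: L2_op_def L2_class_in)
qed

lemma L2_op_extensional: "L2_op M \<Phi> \<in> extensional (carrier (L2_space M))"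
  by (simp add: L2_op_def)

subsection \<open>Unitary maps from relations\<close>

text \<open>
  Unitary maps between \<open>L\<^sup>2\<close> spaces are given below by relations between functions, which avoids the
  choice of representatives. Preservation of inner products already makes such a relation linear and
  single-valued modulo null sets: the defect of linearity is orthogonal to the range, which contains
  that defect itself.
\<close>

lemma L2_unitary_of_relation:
  assumes dom: "\<And>f g. R f g \<Longrightarrow> f \<in> sq_integrable M \<and> g \<in> sq_integrable N"
    and total: "\<And>f. f \<in> sq_integrable M \<Longrightarrow> \<exists>g. R f g"
    and surj: "\<And>g. g \<in> sq_integrable N \<Longrightarrow> \<exists>f. R f g"
    and inner: "\<And>f g f' g'. \<lbrakk>R f g; R f' g'\<rbrakk> \<Longrightarrow> L2_inner N g g' = L2_inner M f f'"
  shows "\<exists>U. unitary_map (L2_space M) (L2_space N) U \<and>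
             (\<forall>f g. R f g \<longrightarrow> U (L2_class M f) = L2_class N g)"
proof -
  \<comment> \<open>The defect \<open>d\<close> of linearity is orthogonal to the range of \<open>R\<close>, hence to itself. The coefficients
    \<open>(1, 0)\<close>, \<open>(1, 1)\<close> and \<open>(c, 0)\<close> give single-valuedness, additivity and homogeneity.\<close>
  have vanish: "AE x in N. g'' x = c * g x + c' * g' x"
    if R: "R f g" "R f' g'" "R f'' g''" and ae: "AE x in M. f'' x = c * f x + c' * f' x"
    for f g f' g' f'' g'' c c'
  proof -
    note sq = dom[OF R(1)] dom[OF R(2)] dom[OF R(3)]
    define d where "d x = g'' x - (c * g x + c' * g' x)" for x
    have d: "d \<in> sq_integrable N"
      unfolding d_def using sq by (intro sq_integrable_diff sq_integrable_add sq_integrable_scale) auto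
    have zero: "L2_inner N d h = 0" if h: "R k h" for k h
    proof -
      note sq' = dom[OF h]
      have "L2_inner N d h = L2_inner N g'' h - (c * L2_inner N g h + c' * L2_inner N g' h)"
        unfolding d_def using sq sq'
        by (simp add: L2_inner_diff_left L2_inner_add_left L2_inner_scale_left sq_integrable_add
            sq_integrable_scale)
      also have "\<dots> = L2_inner M f'' k - (c * L2_inner M f k + c' * L2_inner M f' k)"
        using R h inner by simp
      also have "L2_inner M f'' k = L2_inner M (\<lambda>x. c * f x + c' * f' x) k"
        using sq sq' ae
        by (intro L2_inner_AE_cong) (auto intro!: sq_integrableD(1)[OF sq_integrable_add]
            sq_integrable_scale dest: sq_integrableD(1))
      also have "\<dots> = c * L2_inner M f k + c' * L2_inner M f' k"
        using sq sq' by (simp add: L2_inner_add_left L2_inner_scale_left sq_integrable_scale)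
      finally show ?thesis by simp
    qed
    obtain e where "R e d" using surj[OF d] by blast
    then have "L2_inner N d d = 0" by (rule zero)
    then have "L2_norm N d = 0"
      using L2_inner_self[of N d] by simp
    then have "AE x in N. d x = 0"
      using L2_norm_eq_0_iff[OF d] by simp
    then show ?thesis
      by eventually_elim (simp add: d_def)
  qed
  define U where "U F = L2_class N (SOME g. R (L2_rep F) g)" for F
  have U: "U (L2_class M f) = L2_class N g" if R: "R f g" for f g
  proof -
    have f: "f \<in> sq_integrable M" and g: "g \<in> sq_integrable N"
      using dom[OF R] by auto
    define g' where "g' = (SOME g. R (L2_rep (L2_class M f)) g)"
    have g': "R (L2_rep (L2_class M f)) g'"
      unfolding g'_def using total[OF L2_rep_class(1)[OF f]] by (rule someI_ex)
    have "AE x in N. g' x = 1 * g x + 0 * g x"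
      using vanish[OF R R g', of 1 0] L2_rep_class(2)[OF f] by simp
    then have "L2_class N g' = L2_class N g"
      using dom[OF g'] g by (simp add: L2_class_eq_iff)
    then show ?thesis by (simp add: U_def g'_def)
  qed
  have tot: "\<exists>f g. R f g \<and> F = L2_class M f \<and> f \<in> sq_integrable M \<and> g \<in> sq_integrable N"
      if "F \<in> carrier (L2_space M)" for F
    using that total dom by (elim L2_carrierE) blast
  have "unitary_map (L2_space M) (L2_space N) U"
    unfolding unitary_map_def
  proof (intro conjI ballI allI)
    show "bij_betw U (carrier (L2_space M)) (carrier (L2_space N))"
      unfolding bij_betw_def
    proof
      show "inj_on U (carrier (L2_space M))"
      proof (rule inj_onI)
        fix F F' assume "F \<in> carrier (L2_space M)" "F' \<in> carrier (L2_space M)" and eq: "U F = U F'"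
        then obtain f g f' g' where R: "R f g" "R f' g'" and F: "F = L2_class M f" "F' = L2_class M f'"
          using tot by metis
        have ae: "AE x in N. g x = g' x"
          using eq F U[OF R(1)] U[OF R(2)] dom[OF R(1)] dom[OF R(2)] by (simp add: L2_class_eq_iff)
        have f: "f \<in> sq_integrable M" "f' \<in> sq_integrable M"
            and g: "g \<in> sq_integrable N" "g' \<in> sq_integrable N"
          using dom R by blast+
        have "L2_inner M (\<lambda>x. f x - f' x) (\<lambda>x. f x - f' x)
            = L2_inner M f f - L2_inner M f f' - (L2_inner M f' f - L2_inner M f' f')"
          using f by (simp add: L2_inner_diff_left L2_inner_diff_right sq_integrable_diff)
        also have "\<dots> = L2_inner N g g - L2_inner N g g' - (L2_inner N g' g - L2_inner N g' g')"
          using R inner by simp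
        also have "\<dots> = L2_inner N (\<lambda>x. g x - g' x) (\<lambda>x. g x - g' x)"
          using g by (simp add: L2_inner_diff_left L2_inner_diff_right sq_integrable_diff)
        finally have "L2_norm M (\<lambda>x. f x - f' x) = L2_norm N (\<lambda>x. g x - g' x)"
          by (rule L2_norm_eqI)
        also have "\<dots> = 0"
          using ae g by (subst L2_norm_eq_0_iff) (auto intro!: sq_integrable_diff)
        finally have "AE x in M. f x - f' x = 0"
          using f by (subst (asm) L2_norm_eq_0_iff) (auto intro!: sq_integrable_diff)
        then show "F = F'"
          using f F by (simp add: L2_class_eq_iff)
      qed
      have "U F \<in> carrier (L2_space N)" if "F \<in> carrier (L2_space M)" for F
        using tot[OF that] U dom by (metis L2_class_in)
      moreover have "G \<in> U ` carrier (L2_space M)" if G: "G \<in> carrier (L2_space N)" for G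
      proof -
        obtain g where g: "g \<in> sq_integrable N" "G = L2_class N g"
          using L2_carrierE[OF G] by blast
        obtain f where "R f g" using surj[OF g(1)] by blast
        then show ?thesis
          using U[of f g] dom[of f g] g L2_class_in by (metis imageI)
      qed
      ultimately show "U ` carrier (L2_space M) = carrier (L2_space N)" by blast
    qed
  next
    fix F F' assume "F \<in> carrier (L2_space M)" "F' \<in> carrier (L2_space M)"
    then obtain f g f' g' where R: "R f g" "R f' g'" and F: "F = L2_class M f" "F' = L2_class M f'"
      using tot by metis
    have f: "f \<in> sq_integrable M" "f' \<in> sq_integrable M"
        and g: "g \<in> sq_integrable N" "g' \<in> sq_integrable N"
      using dom R by blast+
    obtain h where h: "R (\<lambda>x. f x + f' x) h" using total[OF sq_integrable_add[OF f]] by blast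
    have "AE x in N. h x = g x + g' x"
      using vanish[OF R h, of 1 1] by simp
    then have "L2_class N h = L2_class N (\<lambda>x. g x + g' x)"
      using dom[OF h] g by (simp add: L2_class_eq_iff sq_integrable_add)
    then show "U (vadd (L2_space M) F F') = vadd (L2_space N) (U F) (U F')"
      using f g F by (simp add: L2_vadd_class U[OF R(1)] U[OF R(2)] U[OF h])
    show "cinner (L2_space N) (U F) (U F') = cinner (L2_space M) F F'"
      using f g F R by (simp add: L2_cinner_class U[OF R(1)] U[OF R(2)] inner)
  next
    fix c F assume "F \<in> carrier (L2_space M)"
    then obtain f g where R: "R f g" and F: "F = L2_class M f"
      using tot by metis
    have f: "f \<in> sq_integrable M" and g: "g \<in> sq_integrable N"
      using dom R by blast+
    obtain h where h: "R (\<lambda>x. c * f x) h" using total[OF sq_integrable_scale[OF f]] by blast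
    have "AE x in N. h x = c * g x"
      using vanish[OF R R h, of c 0] by simp
    then have "L2_class N h = L2_class N (\<lambda>x. c * g x)"
      using dom[OF h] g by (simp add: L2_class_eq_iff sq_integrable_scale)
    then show "U (vscale (L2_space M) c F) = vscale (L2_space N) c (U F)"
      using f g F by (simp add: L2_vscale_class U[OF R(1)] U[OF h])
  qed
  with U show ?thesis by blast
qed

subsection \<open>Weighted composition operators\<close>

text \<open>
  Under this condition the weighted composition operator \<open>f \<mapsto> w \<cdot> (f \<circ> \<phi>)\<close> is an isometry from \<open>L\<^sup>2(M)\<close> to
  \<open>L\<^sup>2(N)\<close>. Translations, dilations, modulations, the shift of the integer coordinate and the passage from
  \<open>\<real>\<^sup>n\<close> to \<open>E \<times> \<int>\<close> are all of this form.
\<close>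

definition weight_pushes :: "'b measure \<Rightarrow> ('b \<Rightarrow> complex) \<Rightarrow> ('b \<Rightarrow> 'a) \<Rightarrow> 'a measure \<Rightarrow> bool" where
  "weight_pushes N w \<phi> M \<longleftrightarrow> \<phi> \<in> N \<rightarrow>\<^sub>M M \<and> w \<in> borel_measurable N \<and>
     distr (density N (\<lambda>y. ennreal ((cmod (w y))\<^sup>2))) M \<phi> = M"

lemma weighted_comp_nn_integral:
  assumes "weight_pushes N w \<phi> M" and h: "h \<in> borel_measurable M"
  shows "(\<integral>\<^sup>+y. ennreal ((cmod (w y))\<^sup>2) * h (\<phi> y) \<partial>N) = (\<integral>\<^sup>+x. h x \<partial>M)"
proof -
  have [measurable]: "\<phi> \<in> N \<rightarrow>\<^sub>M M" "w \<in> borel_measurable N" "h \<in> borel_measurable M"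
    and eq: "distr (density N (\<lambda>y. ennreal ((cmod (w y))\<^sup>2))) M \<phi> = M"
    using assms by (auto simp: weight_pushes_def)
  have "(\<integral>\<^sup>+x. h x \<partial>M) = (\<integral>\<^sup>+x. h x \<partial>distr (density N (\<lambda>y. ennreal ((cmod (w y))\<^sup>2))) M \<phi>)"
    by (simp only: eq)
  also have "\<dots> = (\<integral>\<^sup>+y. h (\<phi> y) \<partial>density N (\<lambda>y. ennreal ((cmod (w y))\<^sup>2)))"
    by (rule nn_integral_distr) auto
  also have "\<dots> = (\<integral>\<^sup>+y. ennreal ((cmod (w y))\<^sup>2) * h (\<phi> y) \<partial>N)"
    by (rule nn_integral_density) auto
  finally show ?thesis by simp
qed

lemma weighted_comp_sq_integrable:
  assumes wp: "weight_pushes N w \<phi> M" and f: "f \<in> sq_integrable M"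
  shows "(\<lambda>y. w y * f (\<phi> y)) \<in> sq_integrable N"
proof -
  have [measurable]: "\<phi> \<in> N \<rightarrow>\<^sub>M M" "w \<in> borel_measurable N" "f \<in> borel_measurable M"
    using assms by (auto simp: weight_pushes_def dest: sq_integrableD)
  have "(\<integral>\<^sup>+y. ennreal (norm ((cmod (w y * f (\<phi> y)))\<^sup>2)) \<partial>N)
     = (\<integral>\<^sup>+y. ennreal ((cmod (w y))\<^sup>2) * ennreal ((cmod (f (\<phi> y)))\<^sup>2) \<partial>N)"
    by (simp add: norm_mult power_mult_distrib ennreal_mult)
  also have "\<dots> = (\<integral>\<^sup>+x. ennreal ((cmod (f x))\<^sup>2) \<partial>M)"
    by (rule weighted_comp_nn_integral[OF wp]) simp
  also have "\<dots> < \<infinity>"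
    using sq_integrableD(2)[OF f] by (simp add: integrable_iff_bounded)
  finally show ?thesis
    by (auto simp: sq_integrable_def integrable_iff_bounded)
qed

lemma weighted_comp_L2_inner:
  assumes wp: "weight_pushes N w \<phi> M" and f: "f \<in> sq_integrable M" and g: "g \<in> sq_integrable M"
  shows "L2_inner N (\<lambda>y. w y * f (\<phi> y)) (\<lambda>y. w y * g (\<phi> y)) = L2_inner M f g"
proof -
  have [measurable]: "\<phi> \<in> N \<rightarrow>\<^sub>M M" "w \<in> borel_measurable N" 
      "f \<in> borel_measurable M" "g \<in> borel_measurable M"
    and eq: "distr (density N (\<lambda>y. ennreal ((cmod (w y))\<^sup>2))) M \<phi> = M"
    using assms by (auto simp: weight_pushes_def dest: sq_integrableD)
  have "L2_inner M f g = (\<integral>x. f x * cnj (g x) \<partial>distr (density N (\<lambda>y. ennreal ((cmod (w y))\<^sup>2))) M \<phi>)"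
    by (simp only: eq L2_inner_def)
  also have "\<dots> = (\<integral>y. f (\<phi> y) * cnj (g (\<phi> y)) \<partial>density N (\<lambda>y. ennreal ((cmod (w y))\<^sup>2)))"
    by (rule integral_distr) auto
  also have "\<dots> = (\<integral>y. (cmod (w y))\<^sup>2 *\<^sub>R (f (\<phi> y) * cnj (g (\<phi> y))) \<partial>N)"
    by (rule integral_density) auto
  also have "\<dots> = L2_inner N (\<lambda>y. w y * f (\<phi> y)) (\<lambda>y. w y * g (\<phi> y))"
    unfolding L2_inner_def
    by (rule Bochner_Integration.integral_cong)
       (auto simp: scaleR_conv_of_real complex_norm_square algebra_simps simp del: of_real_power)
  finally show ?thesis by simp
qed

lemma weighted_comp_L2_norm:
  assumes "weight_pushes N w \<phi> M" "f \<in> sq_integrable M"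
  shows "L2_norm N (\<lambda>y. w y * f (\<phi> y)) = L2_norm M f"
  by (rule L2_norm_eqI) (rule weighted_comp_L2_inner[OF assms assms(2)])

text \<open>
  The \<open>\<phi>\<close>-preimage of a null set is null on the set where \<open>w\<close> does not vanish; applied to the difference
  of two functions, the isometry property says just that.
\<close>

lemma weighted_comp_AE_cong:
  assumes wp: "weight_pushes N w \<phi> M" and f: "f \<in> sq_integrable M" and g: "g \<in> sq_integrable M"
    and ae: "AE x in M. f x = g x"
  shows "AE y in N. w y * f (\<phi> y) = w y * g (\<phi> y)"
proof -
  have d: "(\<lambda>x. f x - g x) \<in> sq_integrable M"
    using f g by (rule sq_integrable_diff)
  have "L2_norm M (\<lambda>x. f x - g x) = 0"
    using ae by (simp add: L2_norm_eq_0_iff[OF d])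
  then have "L2_norm N (\<lambda>y. w y * (f (\<phi> y) - g (\<phi> y))) = 0"
    using weighted_comp_L2_norm[OF wp d] by simp
  then have "AE y in N. w y * (f (\<phi> y) - g (\<phi> y)) = 0"
    using L2_norm_eq_0_iff[OF weighted_comp_sq_integrable[OF wp d]] by simp
  then show ?thesis
    by eventually_elim (simp add: algebra_simps)
qed

lemma weight_pushesI:
  assumes "\<phi> \<in> N \<rightarrow>\<^sub>M M" "w \<in> borel_measurable N"
    and "\<And>X. X \<in> sets M \<Longrightarrow> (\<integral>\<^sup>+y. ennreal ((cmod (w y))\<^sup>2) * indicator X (\<phi> y) \<partial>N) = emeasure M X"
  shows "weight_pushes N w \<phi> M"
proof -
  note [measurable] = assms(1,2)
  have "distr (density N (\<lambda>y. ennreal ((cmod (w y))\<^sup>2))) M \<phi> = M"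
  proof (rule measure_eqI)
    fix X assume "X \<in> sets (distr (density N (\<lambda>y. ennreal ((cmod (w y))\<^sup>2))) M \<phi>)"
    then have X [measurable]: "X \<in> sets M" by simp
    have "emeasure (distr (density N (\<lambda>y. ennreal ((cmod (w y))\<^sup>2))) M \<phi>) X
        = (\<integral>\<^sup>+x. indicator X x \<partial>distr (density N (\<lambda>y. ennreal ((cmod (w y))\<^sup>2))) M \<phi>)"
      by simp
    also have "\<dots> = (\<integral>\<^sup>+y. indicator X (\<phi> y) \<partial>density N (\<lambda>y. ennreal ((cmod (w y))\<^sup>2)))"
      by (rule nn_integral_distr) auto
    also have "\<dots> = (\<integral>\<^sup>+y. ennreal ((cmod (w y))\<^sup>2) * indicator X (\<phi> y) \<partial>N)"
      by (rule nn_integral_density) auto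
    finally show "emeasure (distr (density N (\<lambda>y. ennreal ((cmod (w y))\<^sup>2))) M \<phi>) X = emeasure M X"
      using assms(3)[OF X] by simp
  qed simp
  then show ?thesis using assms by (simp add: weight_pushes_def)
qed

lemma weight_pushes_compose:
  assumes wp: "weight_pushes N w \<phi> M" and wp': "weight_pushes M w' \<phi>' L"
  shows "weight_pushes N (\<lambda>y. w y * w' (\<phi> y)) (\<lambda>y. \<phi>' (\<phi> y)) L"
proof (rule weight_pushesI)
  have m [measurable]: "\<phi> \<in> N \<rightarrow>\<^sub>M M" "w \<in> borel_measurable N" "\<phi>' \<in> M \<rightarrow>\<^sub>M L" "w' \<in> borel_measurable M"
    using wp wp' by (auto simp: weight_pushes_def)
  show "(\<lambda>y. \<phi>' (\<phi> y)) \<in> N \<rightarrow>\<^sub>M L" "(\<lambda>y. w y * w' (\<phi> y)) \<in> borel_measurable N"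
    by measurable
  fix X assume X [measurable]: "X \<in> sets L"
  have "(\<integral>\<^sup>+y. ennreal ((cmod (w y * w' (\<phi> y)))\<^sup>2) * indicator X (\<phi>' (\<phi> y)) \<partial>N)
      = (\<integral>\<^sup>+y. ennreal ((cmod (w y))\<^sup>2) * (ennreal ((cmod (w' (\<phi> y)))\<^sup>2) * indicator X (\<phi>' (\<phi> y))) \<partial>N)"
    by (simp add: norm_mult power_mult_distrib ennreal_mult mult.assoc)
  also have "\<dots> = (\<integral>\<^sup>+y. ennreal ((cmod (w' y))\<^sup>2) * indicator X (\<phi>' y) \<partial>M)"
    by (rule weighted_comp_nn_integral[OF wp]) measurable
  also have "\<dots> = (\<integral>\<^sup>+y. indicator X y \<partial>L)"
    by (rule weighted_comp_nn_integral[OF wp']) measurable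
  finally show "(\<integral>\<^sup>+y. ennreal ((cmod (w y * w' (\<phi> y)))\<^sup>2) * indicator X (\<phi>' (\<phi> y)) \<partial>N) = emeasure L X"
    by simp
qed

lemma weight_pushes_unimodular:
  assumes "w \<in> borel_measurable M" "\<And>x. cmod (w x) = 1"
  shows "weight_pushes M w (\<lambda>x. x) M"
  using assms distr_id2[of M M] by (simp add: weight_pushes_def density_1)

lemma L2_op_weighted_comp:
  assumes wp: "weight_pushes M w \<phi> M" and f: "f \<in> sq_integrable M"
  shows "L2_op M (\<lambda>f y. w y * f (\<phi> y)) (L2_class M f) = L2_class M (\<lambda>y. w y * f (\<phi> y))"
  using assms
  by (intro L2_op_class weighted_comp_sq_integrable weighted_comp_AE_cong) auto

section \<open>The Fourier transform\<close>

subsection \<open>Affine substitutions\<close>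

lemma lborel_translate: "distr lborel borel (\<lambda>x. x - a) = (lborel :: 'a::euclidean_space measure)"
proof -
  have "(+) (- a) = (\<lambda>x. x - a)" by (simp add: fun_eq_iff)
  then show ?thesis using lborel_distr_plus[of "- a"] by simp
qed

lemma
  fixes f :: "'a::euclidean_space \<Rightarrow> 'b::{banach, second_countable_topology}"
  assumes f: "integrable lborel f"
  shows lborel_integrable_translate: "integrable lborel (\<lambda>x. f (x - a))"
    and lborel_integral_translate: "(\<integral>x. f (x - a) \<partial>lborel) = (\<integral>x. f x \<partial>lborel)"
proof -
  have [measurable]: "f \<in> borel_measurable borel" using f by auto
  have "integrable (distr lborel borel (\<lambda>x. x - a)) f"
    using f by (simp add: lborel_translate)
  then show "integrable lborel (\<lambda>x. f (x - a))"
    by (subst (asm) integrable_distr_eq) auto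
  have "(\<integral>x. f x \<partial>lborel) = (\<integral>x. f x \<partial>distr lborel borel (\<lambda>x. x - a))"
    by (simp only: lborel_translate)
  then show "(\<integral>x. f (x - a) \<partial>lborel) = (\<integral>x. f x \<partial>lborel)"
    by (simp add: integral_distr)
qed

lemma lborel_reflect: "distr lborel borel (\<lambda>x. a - x) = (lborel :: 'a::euclidean_space measure)"
proof -
  have "(lborel :: 'a measure) = density (distr lborel borel (\<lambda>x. a
      + (-1) *\<^sub>R x)) (\<lambda>_. ennreal (\<bar>-1\<bar> ^ DIM('a)))"
    using lborel_affine[of "-1" a] by simp
  then show ?thesis by (simp add: density_1)
qed

lemma lborel_integral_reflect:
  fixes f :: "'a::euclidean_space \<Rightarrow> 'b::{banach, second_countable_topology}"
  assumes [measurable]: "f \<in> borel_measurable borel"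
  shows "(\<integral>x. f (a - x) \<partial>lborel) = (\<integral>x. f x \<partial>lborel)"
proof -
  have "(\<integral>x. f x \<partial>lborel) = (\<integral>x. f x \<partial>distr lborel borel (\<lambda>x. a - x))"
    by (simp only: lborel_reflect)
  then show ?thesis
    by (simp add: integral_distr)
qed

lemma
  fixes A :: "real^'n^'n" and f :: "real^'n \<Rightarrow> complex"
  assumes A: "invertible A" and f: "integrable lborel f"
  shows lborel_integrable_linear: "integrable lborel (\<lambda>x. f (A *v x))"
    and lborel_integral_linear: "of_real \<bar>det A\<bar> * (\<integral>x. f (A *v x) \<partial>lborel) = (\<integral>x. f x \<partial>lborel)"
proof -
  have d: "\<bar>det A\<bar> > 0"
    using A by (simp add: invertible_det_nz)
  have [measurable]: "f \<in> borel_measurable borel" using f by auto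
  have [measurable]: "(*v) A \<in> borel \<rightarrow>\<^sub>M borel"
    by (simp add: borel_measurable_continuous_onI matrix_vector_mult_linear_continuous_on)
  have "integrable (density (distr lborel borel ((*v) A)) (\<lambda>_. ennreal \<bar>det A\<bar>)) f"
    using f lborel_linear[OF A] by simp
  then have "integrable lborel (\<lambda>x. \<bar>det A\<bar> *\<^sub>R f (A *v x))"
    by (subst (asm) integrable_density) (auto simp: integrable_distr_eq simp del:
        integrable_scaleR_right)
  then have "integrable lborel (\<lambda>x. (1 / \<bar>det A\<bar>) *\<^sub>R (\<bar>det A\<bar> *\<^sub>R f (A *v x)))"
    by (rule integrable_scaleR_right)
  then show "integrable lborel (\<lambda>x. f (A *v x))"
    using d by simp
  have "(\<integral>x. f x \<partial>lborel) = (\<integral>x. f x \<partial>density (distr lborel borel ((*v) A)) (\<lambda>_. ennreal \<bar>det A\<bar>))"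
    using lborel_linear[OF A] by simp
  also have "\<dots> = (\<integral>x. \<bar>det A\<bar> *\<^sub>R f x \<partial>distr lborel borel ((*v) A))"
    by (rule integral_density) auto
  also have "\<dots> = (\<integral>x. \<bar>det A\<bar> *\<^sub>R f (A *v x) \<partial>lborel)"
    by (rule integral_distr) auto
  finally show "of_real \<bar>det A\<bar> * (\<integral>x. f (A *v x) \<partial>lborel) = (\<integral>x. f x \<partial>lborel)"
    by (simp add: scaleR_conv_of_real)
qed

subsection \<open>The Gaussian\<close>

text \<open>
  The density of the standard normal distribution, as a product over the coordinates so that its
  integrals factor.
\<close>

definition gauss :: "'a::euclidean_space \<Rightarrow> real" where
  "gauss t = (\<Prod>b\<in>Basis. std_normal_density (t \<bullet> b))"

text \<open>
  The factor \<open>(2 \<pi>)\<^sup>-\<^sup>n\<^sup>/\<^sup>2\<close>, for which the transform is unitary and the Gaussian is self-dual.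
\<close>

definition fourier_const :: "'a::euclidean_space itself \<Rightarrow> real" where
  "fourier_const _ = (1 / sqrt (2 * pi)) ^ DIM('a)"

lemma gauss_nonneg [simp]: "0 \<le> gauss t"
  by (simp add: gauss_def prod_nonneg)

lemma borel_measurable_gauss [measurable]: "gauss \<in> borel_measurable borel"
  unfolding gauss_def by measurable

lemma fourier_const_pos [simp]: "0 < fourier_const TYPE('a::euclidean_space)"
  by (simp add: fourier_const_def)

lemma fourier_const_abs [simp]:
  "fourier_const TYPE('a::euclidean_space) \<noteq> 0"
  "\<bar>fourier_const TYPE('a::euclidean_space)\<bar> = fourier_const TYPE('a)"
  "0 \<le> fourier_const TYPE('a::euclidean_space)"
  using fourier_const_pos[where 'a = 'a] by linarith+

lemma gauss_le: "gauss (t :: 'a::euclidean_space) \<le> fourier_const TYPE('a)"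
proof -
  have "gauss t \<le> (\<Prod>b\<in>(Basis::'a set). 1 / sqrt (2 * pi))"
    unfolding gauss_def by (rule prod_mono) (auto simp: std_normal_density_def field_simps)
  then show ?thesis by (simp add: fourier_const_def)
qed

lemma borel_measurable_cis [measurable]: "cis \<in> borel \<rightarrow>\<^sub>M borel"
  by (intro borel_measurable_continuous_onI continuous_intros)

lemma cis_std_normal:
  "integrable lborel (\<lambda>x. cis (t * x) * of_real (std_normal_density x))"
  "(\<integral>x. cis (t * x) * of_real (std_normal_density x) \<partial>lborel) = of_real (exp (- t\<^sup>2 / 2))"
proof -
  have 1: "integrable lborel std_normal_density"
    by (rule integrable_normal_density) simp
  show "integrable lborel (\<lambda>x. cis (t * x) * of_real (std_normal_density x))"
    by (rule Bochner_Integration.integrable_bound[OF 1]) (auto simp: norm_mult)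
  have "of_real (exp (- t\<^sup>2 / 2)) = char std_normal_distribution t"
    by (simp add: char_std_normal_distribution)
  also have "\<dots> = (\<integral>x. cis (t * x) \<partial>density lborel std_normal_density)"
    by (simp add: char_def cis_conv_exp)
  also have "\<dots> = (\<integral>x. std_normal_density x *\<^sub>R cis (t * x) \<partial>lborel)"
    by (rule integral_density) auto
  also have "\<dots> = (\<integral>x. cis (t * x) * of_real (std_normal_density x) \<partial>lborel)"
    by (simp add: scaleR_conv_of_real mult.commute)
  finally show "(\<integral>x. cis (t * x) * of_real (std_normal_density x) \<partial>lborel) = of_real (exp (- t\<^sup>2 / 2))"
    by simp
qed

text \<open>
  Both facts factor over the coordinates, where they express that the characteristic function of the
  standard normal distribution is \<open>exp (-t\<^sup>2/2)\<close>.
\<close>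

lemma gauss_integrable: "integrable lborel (gauss :: 'a::euclidean_space \<Rightarrow> real)"
  and gauss_fourier: "of_real (fourier_const TYPE('a)) *
     (\<integral>t. cis (s * (\<xi> \<bullet> t)) * of_real (gauss (t :: 'a)) \<partial>lborel) = of_real (gauss (s *\<^sub>R \<xi>))"
proof -
  interpret product_sigma_finite "\<lambda>_::'a. lborel :: real measure"
    by standard
  have *: "(\<Sum>b\<in>Basis. x b *\<^sub>R b) \<bullet> b = x b" if "b \<in> Basis" for x and b :: 'a
    using that by (simp add: inner_sum_left inner_Basis if_distrib sum.delta cong: if_cong)
  have meas: "(\<lambda>f. \<Sum>b\<in>Basis. f b *\<^sub>R b) \<in> (\<Pi>\<^sub>M b\<in>Basis. lborel) \<rightarrow>\<^sub>M (borel :: 'a measure)"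
    by measurable
  let ?h = "\<lambda>\<xi> (t::'a). cis (s * (\<xi> \<bullet> t)) * complex_of_real (gauss t)"
  have prod: "?h \<xi> (\<Sum>b\<in>Basis. x b *\<^sub>R b)
      = (\<Prod>b\<in>Basis. cis ((s * (\<xi> \<bullet> b)) * x b) * of_real (std_normal_density (x b)))" for x \<xi>
  proof -
    have "cis (sum f B) = (\<Prod>b\<in>B. cis (f b))" if "finite B" for f and B :: "'a set"
      using that by induction (auto simp: cis_mult[symmetric])
    then have "cis (\<Sum>b\<in>Basis. s * (\<xi> \<bullet> b) * x b) = (\<Prod>b\<in>Basis. cis ((s * (\<xi> \<bullet> b)) * x b))"
      by simp
    moreover have "s * (\<xi> \<bullet> (\<Sum>b\<in>Basis. x b *\<^sub>R b)) = (\<Sum>b\<in>Basis. s * (\<xi> \<bullet> b) * x b)"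
      by (simp add: inner_sum_right sum_distrib_left mult_ac)
    ultimately show ?thesis
      by (simp add: gauss_def * prod.distrib)
  qed
  have hb: "?h \<xi> \<in> borel_measurable borel" for \<xi>
    by measurable
  have int: "integrable (\<Pi>\<^sub>M b\<in>Basis. lborel) (\<lambda>x. ?h \<xi> (\<Sum>b\<in>Basis. x b *\<^sub>R b))" for \<xi>
    unfolding prod by (rule product_integrable_prod) (auto intro: cis_std_normal)
  have lb: "(lborel :: 'a measure) = distr (\<Pi>\<^sub>M b\<in>Basis. lborel) borel (\<lambda>f. \<Sum>b\<in>Basis. f b *\<^sub>R b)"
    by (rule lborel_eq)
  have "integrable lborel (?h 0)"
    unfolding lb using int[of 0] integrable_distr_eq[OF meas hb] by blast
  then show "integrable lborel (gauss :: 'a \<Rightarrow> real)"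
    by (simp add: complex_of_real_integrable_eq)
  have "(\<integral>t. ?h \<xi> t \<partial>lborel) = (\<integral>x. ?h \<xi> (\<Sum>b\<in>Basis. x b *\<^sub>R b) \<partial>(\<Pi>\<^sub>M b\<in>(Basis::'a set). lborel))"
    unfolding lb by (rule integral_distr[OF meas hb])
  also have "\<dots> = (\<Prod>b\<in>Basis. of_real (exp (- (s * (\<xi> \<bullet> b))\<^sup>2 / 2)))"
    unfolding prod by (subst product_integral_prod) (auto simp: cis_std_normal simp del: of_real_exp)
  finally show "of_real (fourier_const TYPE('a)) * (\<integral>t. ?h \<xi> t \<partial>lborel) = of_real (gauss (s *\<^sub>R \<xi>))"
    by (simp add: gauss_def fourier_const_def std_normal_density_def prod.distrib power_one_over
        prod_dividef flip: of_real_prod)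
qed

lemma gauss_minus [simp]: "gauss (- t) = gauss t"
  by (simp add: gauss_def std_normal_density_def)

lemma gauss_integral: "(\<integral>t. gauss t \<partial>lborel) = 1"
proof -
  let ?c = "fourier_const TYPE('a)"
  have "of_real ?c * (\<integral>t. of_real (gauss (t::'a)) \<partial>lborel) = complex_of_real (gauss (0::'a))"
    using gauss_fourier[of 0 "0::'a"] by simp
  also have "gauss (0::'a) = ?c"
    by (simp add: gauss_def std_normal_density_def fourier_const_def)
  finally have "complex_of_real ?c * of_real (\<integral>t. gauss (t::'a) \<partial>lborel) = of_real ?c"
    by simp
  then have "?c * (\<integral>t. gauss (t::'a) \<partial>lborel) = ?c"
    unfolding of_real_mult[symmetric] of_real_eq_iff .
  then show ?thesis
    using fourier_const_pos[where 'a='a] by simp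
qed

subsection \<open>Fubini\<close>

lemma integrable_kernel:
  fixes f :: "'a::euclidean_space \<Rightarrow> complex" and g :: "'b::euclidean_space \<Rightarrow> complex"
  assumes f: "integrable lborel f" and g: "integrable lborel g"
    and k: "(\<lambda>(x, y). k x y) \<in> borel_measurable (borel \<Otimes>\<^sub>M borel)" and k1: "\<And>x y. cmod (k x y) \<le> 1"
  shows "integrable (lborel \<Otimes>\<^sub>M lborel) (\<lambda>(x, y). k x y * (f x * g y))"
proof (rule lborel_pair.Fubini_integrable)
  have [measurable]: "f \<in> borel_measurable borel" "g \<in> borel_measurable borel"
    using f g by auto
  have k': "(\<lambda>x. k (fst x) (snd x)) \<in> borel_measurable (borel \<Otimes>\<^sub>M borel)"
    using k by (simp add: case_prod_beta)
  note [measurable] = k'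
  show meas: "(\<lambda>(x, y). k x y * (f x * g y)) \<in> borel_measurable (lborel \<Otimes>\<^sub>M lborel)"
    unfolding case_prod_beta by measurable
  have bd: "cmod (k x y * (f x * g y)) \<le> cmod (f x) * cmod (g y)" for x y
    using mult_right_mono[OF k1[of x y], of "cmod (f x) * cmod (g y)"] by (simp add: norm_mult)
  have kx: "(\<lambda>y. k x y * (f x * g y)) \<in> borel_measurable lborel" for x
    using measurable_Pair2[OF meas, of x] by simp
  have iy: "integrable lborel (\<lambda>y. k x y * (f x * g y))" for x
    by (rule Bochner_Integration.integrable_bound[of lborel "\<lambda>y. cmod (f x) * cmod (g y)"])
       (use g bd kx in \<open>auto simp: abs_mult\<close>)
  show "AE x in lborel. integrable lborel (\<lambda>y. case (x, y) of (x, y) \<Rightarrow> k x y * (f x * g y))"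
    using iy by simp
  show "integrable lborel (\<lambda>x. \<integral>y. norm (case (x, y) of (x, y) \<Rightarrow> k x y * (f x * g y)) \<partial>lborel)"
  proof (rule Bochner_Integration.integrable_bound[of lborel "\<lambda>x. cmod (f x)
      * (\<integral>y. cmod (g y) \<partial>lborel)"])
    show "integrable lborel (\<lambda>x. cmod (f x) * (\<integral>y. cmod (g y) \<partial>lborel))"
      using f by simp
    show "(\<lambda>x. \<integral>y. norm (case (x, y) of (x, y) \<Rightarrow> k x y * (f x
        * g y)) \<partial>lborel) \<in> borel_measurable lborel"
      by (rule lborel.borel_measurable_lebesgue_integral) (use meas in \<open>simp add: case_prod_beta\<close>)
    have "(\<integral>y. cmod (k x y * (f x * g y)) \<partial>lborel) \<le> (\<integral>y. cmod (f x) * cmod (g y) \<partial>lborel)" for x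
      by (rule integral_mono) (use bd iy g in auto)
    then show "AE x in lborel. norm (\<integral>y. norm (case (x, y) of (x, y) \<Rightarrow> k x y * (f x * g y)) \<partial>lborel)
        \<le> norm (cmod (f x) * (\<integral>y. cmod (g y) \<partial>lborel))"
      by (simp add: integral_nonneg_AE)
  qed
qed

lemma integrable_convolution_kernel:
  fixes h k :: "'a::euclidean_space \<Rightarrow> complex"
  assumes h: "integrable lborel h" and k: "integrable lborel k"
  shows "integrable (lborel \<Otimes>\<^sub>M lborel) (\<lambda>(v, t). k v * h (t - v))"
proof (rule lborel_pair.Fubini_integrable)
  have [measurable]: "h \<in> borel_measurable borel" "k \<in> borel_measurable borel"
    using h k by auto
  show "(\<lambda>(v, t). k v * h (t - v)) \<in> borel_measurable (lborel \<Otimes>\<^sub>M lborel)"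
    unfolding case_prod_beta by measurable
  have it: "integrable lborel (\<lambda>t. h (t - v))" for v
    by (rule lborel_integrable_translate[OF h])
  then show "AE v in lborel. integrable lborel (\<lambda>t. case (v, t) of (v, t) \<Rightarrow> k v * h (t - v))"
    by simp
  have "(\<integral>t. cmod (k v * h (t - v)) \<partial>lborel) = cmod (k v) * (\<integral>t. cmod (h t) \<partial>lborel)" for v
    using lborel_integral_translate[OF integrable_norm[OF h], of v] by (simp add: norm_mult)
  then show "integrable lborel (\<lambda>v. \<integral>t. norm (case (v, t) of (v, t) \<Rightarrow> k v * h (t - v)) \<partial>lborel)"
    using k by simp
qed

subsection \<open>Pairs of mutually transformed functions\<close>

text \<open>
  The sign \<open>s = -1\<close> gives the Fourier transform and \<open>s = 1\<close> its inverse.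
\<close>

definition fourier :: "real \<Rightarrow> ('a::euclidean_space \<Rightarrow> complex) \<Rightarrow> 'a \<Rightarrow> complex" where
  "fourier s f \<xi> = of_real (fourier_const TYPE('a)) * (\<integral>t. cis (s * (\<xi> \<bullet> t)) * f t \<partial>lborel)"

definition L12 :: "('a::euclidean_space \<Rightarrow> complex) \<Rightarrow> bool" where
  "L12 f \<longleftrightarrow> integrable lborel f \<and> f \<in> sq_integrable lborel"

text \<open>
  Pairs for which the transform and the inversion formula hold pointwise, with absolutely
  convergent integrals. Identities for such pairs are elementary, and they are also symmetric under
  the exchange of the two roles; the work lies in showing that there are enough of them.
\<close>

definition fourier_pair :: "('a::euclidean_space \<Rightarrow> complex) \<Rightarrow> ('a \<Rightarrow> complex) \<Rightarrow> bool" where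
  "fourier_pair f g \<longleftrightarrow> L12 f \<and> L12 g \<and> fourier (-1) f = g \<and> fourier 1 g = f"

lemma integrable_cis: 
  fixes f :: "'a::euclidean_space \<Rightarrow> complex"
  assumes f: "integrable lborel f"
  shows "integrable lborel (\<lambda>t. cis (s * (\<xi> \<bullet> t)) * f t)"
proof (rule Bochner_Integration.integrable_bound[OF f])
  have [measurable]: "f \<in> borel_measurable borel" using f by auto
  show "(\<lambda>t. cis (s * (\<xi> \<bullet> t)) * f t) \<in> borel_measurable lborel" by measurable
qed (simp add: norm_mult)

lemma fourier_add: 
  "\<lbrakk>integrable lborel f; integrable lborel g\<rbrakk>
      \<Longrightarrow> fourier s (\<lambda>t. f t + g t) = (\<lambda>\<xi>. fourier s f \<xi> + fourier s g \<xi>)"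
  by (simp add: fourier_def fun_eq_iff distrib_left integrable_cis)

lemma fourier_scale: "fourier s (\<lambda>t. c * f t) = (\<lambda>\<xi>. c * fourier s f \<xi>)"
proof
  fix \<xi>
  have "(\<integral>t. cis (s * (\<xi> \<bullet> t)) * (c * f t) \<partial>lborel) = (\<integral>t. c * (cis (s * (\<xi> \<bullet> t)) * f t) \<partial>lborel)"
    by (simp add: mult_ac)
  then show "fourier s (\<lambda>t. c * f t) \<xi> = c * fourier s f \<xi>"
    by (simp add: fourier_def)
qed

lemma fourier_cnj: "fourier s (\<lambda>t. cnj (f t)) = (\<lambda>\<xi>. cnj (fourier (- s) f \<xi>))"
proof
  fix \<xi>
  have "(\<integral>t. cis (s * (\<xi> \<bullet> t)) * cnj (f t) \<partial>lborel) = (\<integral>t. cnj (cis (- s * (\<xi> \<bullet> t)) * f t) \<partial>lborel)"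
    by (simp add: cis_cnj del: Bochner_Integration.integral_cnj)
  also have "\<dots> = cnj (\<integral>t. cis (- s * (\<xi> \<bullet> t)) * f t \<partial>lborel)"
    by (rule Bochner_Integration.integral_cnj)
  finally show "fourier s (\<lambda>t. cnj (f t)) \<xi> = cnj (fourier (- s) f \<xi>)"
    by (simp add: fourier_def)
qed

lemma L12_add: "L12 f \<Longrightarrow> L12 g \<Longrightarrow> L12 (\<lambda>t. f t + g t)"
  by (simp add: L12_def sq_integrable_add)

lemma L12_scale: "L12 f \<Longrightarrow> L12 (\<lambda>t. c * f t)"
  by (simp add: L12_def sq_integrable_scale)

lemma L12_cnj: "L12 f \<Longrightarrow> L12 (\<lambda>t. cnj (f t))"
  by (auto simp: L12_def sq_integrable_def)

lemma fourier_pairI: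
  "\<lbrakk>L12 f; L12 g; fourier (-1) f = g; fourier 1 g = f\<rbrakk> \<Longrightarrow> fourier_pair f g"
  by (simp add: fourier_pair_def)

lemma fourier_pairD:
  assumes "fourier_pair f g"
  shows "L12 f" "L12 g" "fourier (-1) f = g" "fourier 1 g = f"
    "integrable lborel f" "integrable lborel g"
    "f \<in> sq_integrable lborel" "g \<in> sq_integrable lborel"
  using assms by (simp_all add: fourier_pair_def L12_def)

lemma fourier_pair_add:
  assumes p: "fourier_pair f g" and p': "fourier_pair f' g'"
  shows "fourier_pair (\<lambda>t. f t + f' t) (\<lambda>\<xi>. g \<xi> + g' \<xi>)"
  using fourier_pairD[OF p] fourier_pairD[OF p']
  by (intro fourier_pairI L12_add) (simp_all only: fourier_add)

lemma fourier_pair_scale: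
  assumes p: "fourier_pair f g"
  shows "fourier_pair (\<lambda>t. c * f t) (\<lambda>\<xi>. c * g \<xi>)"
  using fourier_pairD[OF p] by (intro fourier_pairI L12_scale) (simp_all only: fourier_scale)

lemma fourier_pair_diff:
  "\<lbrakk>fourier_pair f g; fourier_pair f' g'\<rbrakk> \<Longrightarrow> fourier_pair (\<lambda>t. f t - f' t) (\<lambda>\<xi>. g \<xi> - g' \<xi>)"
  using fourier_pair_add[OF _ fourier_pair_scale[of f' g' "-1"]] by simp

text \<open>
  Conjugation changes the sign in the exponent, hence exchanges the two directions. This turns
  statements about first components into statements about second components.
\<close>

lemma fourier_pair_cnj:
  assumes p: "fourier_pair f g"
  shows "fourier_pair (\<lambda>t. cnj (g t)) (\<lambda>\<xi>. cnj (f \<xi>))"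
  using fourier_pairD[OF p] by (intro fourier_pairI L12_cnj) (simp_all only: fourier_cnj minus_minus)

text \<open>
  Insert the inversion formula for \<open>f\<close>, exchange the two integrals, and recognise the transform of \<open>f'\<close>.
\<close>

lemma fourier_pair_parseval:
  assumes p: "fourier_pair f g" and p': "fourier_pair f' g'"
  shows "L2_inner lborel g g' = L2_inner lborel f f'"
proof -
  let ?c = "complex_of_real (fourier_const TYPE('a))"
  have int: "integrable lborel g" "integrable lborel f'" and f: "f = fourier 1 g"
      and g': "g' = fourier (-1) f'"
    using fourier_pairD[OF p] fourier_pairD[OF p'] by simp_all
  have [measurable]: "g \<in> borel_measurable borel" "f' \<in> borel_measurable borel"
    using int by auto
  have I: "integrable (lborel \<Otimes>\<^sub>M lborel) (\<lambda>(\<xi>, t). cis (t \<bullet> \<xi>) * (g \<xi> * cnj (f' t)))"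
    by (rule integrable_kernel) (use int in \<open>auto simp: case_prod_beta\<close>)
  have "L2_inner lborel f f' = (\<integral>t. (\<integral>\<xi>. ?c * (cis (t \<bullet> \<xi>) * (g \<xi> * cnj (f' t))) \<partial>lborel) \<partial>lborel)"
  proof -
    have "f t * cnj (f' t) = (\<integral>\<xi>. ?c * (cis (t \<bullet> \<xi>) * (g \<xi> * cnj (f' t))) \<partial>lborel)" for t
    proof -
      have "(\<integral>\<xi>. cis (t \<bullet> \<xi>) * (g \<xi> * cnj (f' t)) \<partial>lborel)
          = (\<integral>\<xi>. cis (t \<bullet> \<xi>) * g \<xi> \<partial>lborel) * cnj (f' t)"
        by (simp flip: mult.assoc)
      then show ?thesis by (simp add: f fourier_def)
    qed
    then show ?thesis by (simp add: L2_inner_def)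
  qed
  also have "\<dots> = ?c * (\<integral>t. (\<integral>\<xi>. cis (t \<bullet> \<xi>) * (g \<xi> * cnj (f' t)) \<partial>lborel) \<partial>lborel)"
    by simp
  also have "\<dots> = ?c * (\<integral>\<xi>. (\<integral>t. cis (t \<bullet> \<xi>) * (g \<xi> * cnj (f' t)) \<partial>lborel) \<partial>lborel)"
    using lborel_pair.Fubini_integral[OF I] by simp
  also have "\<dots> = (\<integral>\<xi>. ?c * (\<integral>t. cis (t \<bullet> \<xi>) * (g \<xi> * cnj (f' t)) \<partial>lborel) \<partial>lborel)"
    by simp
  also have "\<dots> = L2_inner lborel g g'"
  proof -
    have "?c * (\<integral>t. cis (t \<bullet> \<xi>) * (g \<xi> * cnj (f' t)) \<partial>lborel) = g \<xi> * cnj (g' \<xi>)" for \<xi>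
    proof -
      have "(\<integral>t. cis (t \<bullet> \<xi>) * (g \<xi> * cnj (f' t)) \<partial>lborel)
          = (\<integral>t. g \<xi> * (cis (1 * (\<xi> \<bullet> t)) * cnj (f' t)) \<partial>lborel)"
        by (simp add: mult_ac inner_commute)
      also have "\<dots> = g \<xi> * (\<integral>t. cis (1 * (\<xi> \<bullet> t)) * cnj (f' t) \<partial>lborel)"
        by (rule integral_mult_right_zero)
      finally have "?c * (\<integral>t. cis (t \<bullet> \<xi>) * (g \<xi> * cnj (f' t)) \<partial>lborel)
          = g \<xi> * fourier 1 (\<lambda>t. cnj (f' t)) \<xi>"
        by (simp add: fourier_def)
      then show ?thesis
        using fourier_cnj[of 1 f'] by (simp add: g')
    qed
    then show ?thesis by (simp add: L2_inner_def)
  qed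
  finally show ?thesis by simp
qed

lemma fourier_pair_L2_norm: "fourier_pair f g \<Longrightarrow> L2_norm lborel g = L2_norm lborel f"
  by (rule L2_norm_eqI) (rule fourier_pair_parseval)

subsection \<open>Symmetries\<close>

lemma L12_weight:
  assumes "L12 f" and w: "weight_pushes lborel w \<phi> lborel" and "integrable lborel (\<lambda>t. w t * f (\<phi> t))"
  shows "L12 (\<lambda>t. w t * f (\<phi> t))"
  using assms weighted_comp_sq_integrable[OF w] by (simp add: L12_def)

lemma weight_pushes_translate: "weight_pushes lborel (\<lambda>t. 1) (\<lambda>t. t - \<beta>) (lborel :: 'a::euclidean_space measure)"
proof -
  have "distr lborel lborel (\<lambda>t. t - \<beta>) = distr lborel borel (\<lambda>t::'a. t - \<beta>)"
    by (rule distr_cong) auto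
  then show ?thesis
    by (simp add: weight_pushes_def density_1 lborel_translate)
qed

lemma weight_pushes_linear_lborel:
  fixes A :: "real^'n^'n"
  assumes A: "invertible A"
  shows "weight_pushes lborel (\<lambda>t. of_real (sqrt \<bar>det A\<bar>)) ((*v) A) lborel"
proof -
  have [measurable]: "(*v) A \<in> borel \<rightarrow>\<^sub>M borel"
    by (simp add: borel_measurable_continuous_onI matrix_vector_mult_linear_continuous_on)
  have [simp]: "(*v) A -` X \<in> sets borel" if "X \<in> sets borel" for X
    using measurable_sets_borel[of "(*v) A" borel X] that by simp
  have "distr (density lborel (\<lambda>t. ennreal \<bar>det A\<bar>)) lborel ((*v) A)
      = density (distr lborel borel ((*v) A)) (\<lambda>_. ennreal \<bar>det A\<bar>)"
    by (rule measure_eqI) (auto simp: emeasure_distr emeasure_density nn_integral_distr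
        nn_integral_cmult nn_integral_density)
  then show ?thesis
    using lborel_linear[OF A] by (simp add: weight_pushes_def)
qed

lemma fourier_pair_translate:
  fixes f :: "'a::euclidean_space \<Rightarrow> complex"
  assumes p: "fourier_pair f g"
  shows "fourier_pair (\<lambda>t. f (t - \<beta>)) (\<lambda>\<xi>. cis (- (\<xi> \<bullet> \<beta>)) * g \<xi>)"
proof -
  have f: "L12 f" and g: "L12 g" and gf: "g = fourier (-1) f" and fg: "f = fourier 1 g"
    using fourier_pairD[OF p] by simp_all
  have int: "integrable lborel f" "integrable lborel g"
    using f g by (auto simp: L12_def)
  have "L12 (\<lambda>t. 1 * f (t - \<beta>))"
    by (rule L12_weight[OF f weight_pushes_translate])
        (use lborel_integrable_translate[OF int(1)] in simp)
  moreover have "L12 (\<lambda>\<xi>. cis (- (\<xi> \<bullet> \<beta>)) * g \<xi>)"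
    by (rule L12_weight[OF g weight_pushes_unimodular])
       (use integrable_cis[OF int(2), of "-1" \<beta>] in \<open>auto simp: inner_commute\<close>)
  moreover have "fourier (-1) (\<lambda>t. f (t - \<beta>)) \<xi> = cis (- (\<xi> \<bullet> \<beta>)) * g \<xi>" for \<xi>
  proof -
    have "(\<integral>t. cis (- (\<xi> \<bullet> t)) * f (t - \<beta>) \<partial>lborel)
        = (\<integral>t. cis (- (\<xi> \<bullet> \<beta>)) * (cis (- (\<xi> \<bullet> (t - \<beta>))) * f (t - \<beta>)) \<partial>lborel)"
      by (simp add: cis_mult inner_diff_right flip: mult.assoc)
    also have "\<dots> = cis (- (\<xi> \<bullet> \<beta>)) * (\<integral>t. cis (- (\<xi> \<bullet> t)) * f t \<partial>lborel)"
      using lborel_integral_translate[OF integrable_cis[OF int(1), of "-1" \<xi>], of \<beta>] by simp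
    finally show ?thesis
      by (simp add: gf fourier_def)
  qed
  moreover have "fourier 1 (\<lambda>\<xi>. cis (- (\<xi> \<bullet> \<beta>)) * g \<xi>) t = f (t - \<beta>)" for t
  proof -
    have "(\<integral>\<xi>. cis (t \<bullet> \<xi>) * (cis (- (\<xi> \<bullet> \<beta>)) * g \<xi>) \<partial>lborel) = (\<integral>\<xi>. cis ((t - \<beta>) \<bullet> \<xi>) * g \<xi> \<partial>lborel)"
      by (simp add: cis_mult inner_diff_left inner_commute[of _ \<beta>] flip: mult.assoc)
    then show ?thesis by (simp add: fg fourier_def)
  qed
  ultimately show ?thesis
    by (intro fourier_pairI) auto
qed

lemma dot_transpose: "(transpose A *v x) \<bullet> y = x \<bullet> (A *v (y :: real^'n))"
  by (simp add: dot_lmul_matrix)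

lemma fourier_pair_linear:
  fixes A A' :: "real^'n^'n"
  assumes p: "fourier_pair f g" and AA': "A ** A' = mat 1"
  shows "fourier_pair (\<lambda>t. of_real (sqrt \<bar>det A\<bar>) * f (A *v t))
           (\<lambda>\<xi>. of_real (sqrt \<bar>det A'\<bar>) * g (transpose A' *v \<xi>))"
proof -
  have f: "L12 f" and g: "L12 g" and gf: "g = fourier (-1) f" and fg: "f = fourier 1 g"
    using fourier_pairD[OF p] by simp_all
  have int: "integrable lborel f" "integrable lborel g"
    using f g by (auto simp: L12_def)
  have A'A: "A' ** A = mat 1"
    using AA' matrix_left_right_inverse by blast
  have "det A * det A' = 1"
    using AA' by (metis det_mul det_I)
  then have dd: "\<bar>det A\<bar> * \<bar>det A'\<bar> = 1"
    by (metis abs_mult abs_one)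
  then have inv: "invertible A" "invertible (transpose A')"
    by (auto simp: invertible_det_nz)
  define d d' where "d = sqrt \<bar>det A\<bar>" and "d' = sqrt \<bar>det A'\<bar>"
  have d: "d * d' = 1" "d * d = \<bar>det A\<bar>" "d' * d' = \<bar>det A'\<bar>"
    using dd by (simp_all add: d_def d'_def flip: real_sqrt_mult)
  have d0: "d \<noteq> 0" "d' \<noteq> 0" using d(1) by auto
  have "L12 (\<lambda>t. of_real d * f (A *v t))"
    using L12_weight[OF f weight_pushes_linear_lborel[OF inv(1)]]
        lborel_integrable_linear[OF inv(1) int(1)]
    by (simp add: d_def)
  moreover have "L12 (\<lambda>\<xi>. of_real d' * g (transpose A' *v \<xi>))"
    using L12_weight[OF g weight_pushes_linear_lborel[OF inv(2)]]
        lborel_integrable_linear[OF inv(2) int(2)]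
    by (simp add: d'_def)
  moreover have "fourier (-1) (\<lambda>t. of_real d * f (A *v t)) \<xi> = of_real d' * g (transpose A' *v \<xi>)" for \<xi>
  proof -
    let ?h = "\<lambda>t. cis (- 1 * ((transpose A' *v \<xi>) \<bullet> t)) * f t"
    have "(\<integral>t. cis (- 1 * (\<xi> \<bullet> t)) * f (A *v t) \<partial>lborel) = (\<integral>t. ?h (A *v t) \<partial>lborel)"
      by (simp add: dot_transpose matrix_vector_mul_assoc A'A del: transpose_matrix_vector)
    also have "\<dots> = of_real \<bar>det A'\<bar> * (\<integral>t. ?h t \<partial>lborel)"
    proof -
      have "of_real \<bar>det A'\<bar> * (of_real \<bar>det A\<bar> * (\<integral>t. ?h (A *v t) \<partial>lborel))
          = of_real \<bar>det A'\<bar> * (\<integral>t. ?h t \<partial>lborel)"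
        by (subst lborel_integral_linear[OF inv(1) integrable_cis[OF int(1)]]) (rule refl)
      moreover have "complex_of_real \<bar>det A'\<bar> * of_real \<bar>det A\<bar> = 1"
        using dd by (metis mult.commute of_real_1 of_real_mult)
      ultimately show ?thesis
        by (simp only: mult.assoc[symmetric] mult_1_left)
    qed
    finally have "fourier (-1) (\<lambda>t. f (A *v t)) \<xi> = of_real \<bar>det A'\<bar> * g (transpose A' *v \<xi>)"
      by (simp add: gf fourier_def mult_ac)
    then have "fourier (-1) (\<lambda>t. of_real d * f (A *v t)) \<xi>
        = of_real (d * (d' * d')) * g (transpose A' *v \<xi>)"
      by (simp add: fourier_scale d(3))
    also have "d * (d' * d') = d'"
      using d(1) by (simp flip: mult.assoc)
    finally show ?thesis .
  qed
  moreover have "fourier 1 (\<lambda>\<xi>. of_real d' * g (transpose A' *v \<xi>)) t = of_real d * f (A *v t)" for t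
  proof -
    let ?h = "\<lambda>\<xi>. cis (1 * ((A *v t) \<bullet> \<xi>)) * g \<xi>"
    have "(\<integral>\<xi>. cis (1 * (t \<bullet> \<xi>)) * g (transpose A' *v \<xi>) \<partial>lborel)
        = (\<integral>\<xi>. ?h (transpose A' *v \<xi>) \<partial>lborel)"
      by (simp add: inner_commute[of _ "transpose A' *v _"] dot_transpose matrix_vector_mul_assoc A'A
          inner_commute[of t] del: transpose_matrix_vector)
    also have "\<dots> = of_real \<bar>det A\<bar> * (\<integral>\<xi>. ?h \<xi> \<partial>lborel)"
    proof -
      have "of_real \<bar>det A\<bar> * (of_real \<bar>det A'\<bar> * (\<integral>\<xi>. ?h (transpose A' *v \<xi>) \<partial>lborel))
          = of_real \<bar>det A\<bar> * (\<integral>t. ?h t \<partial>lborel)"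
        using lborel_integral_linear[OF inv(2) integrable_cis[OF int(2)], of 1 "A *v t"] by simp
      moreover have "complex_of_real \<bar>det A\<bar> * of_real \<bar>det A'\<bar> = 1"
        using dd by (metis of_real_1 of_real_mult)
      ultimately show ?thesis
        by (simp only: mult.assoc[symmetric] mult_1_left)
    qed
    finally have "fourier 1 (\<lambda>\<xi>. g (transpose A' *v \<xi>)) t = of_real \<bar>det A\<bar> * f (A *v t)"
      by (simp add: fg fourier_def mult_ac)
    then have "fourier 1 (\<lambda>\<xi>. of_real d' * g (transpose A' *v \<xi>)) t
        = of_real (d' * (d * d)) * f (A *v t)"
      by (simp add: fourier_scale d(2))
    also have "d' * (d * d) = d"
      using d(1) by (simp add: mult_ac)
    finally show ?thesis .
  qed
  ultimately show ?thesis
    unfolding d_def d'_def by (intro fourier_pairI) auto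
qed

subsection \<open>Gaussian means\<close>

lemma borel_measurable_fourier [measurable]:
  assumes [measurable]: "f \<in> borel_measurable borel"
  shows "fourier s f \<in> borel_measurable borel"
proof -
  have "(\<lambda>\<xi>. \<integral>t. cis (s * (\<xi> \<bullet> t)) * f t \<partial>lborel) \<in> borel_measurable borel"
    by (rule lborel.borel_measurable_lebesgue_integral) (simp add: case_prod_beta)
  then show ?thesis
    unfolding fourier_def[abs_def] by measurable
qed

lemma fourier_bound:
  fixes f :: "'a::euclidean_space \<Rightarrow> complex"
  shows "cmod (fourier s f \<xi>) \<le> fourier_const TYPE('a) * (\<integral>t. cmod (f t) \<partial>lborel)"
proof -
  have "cmod (\<integral>t. cis (s * (\<xi> \<bullet> t)) * f t \<partial>lborel) \<le> (\<integral>t. cmod (f t) \<partial>lborel)"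
    using integral_norm_bound[of lborel "\<lambda>t. cis (s * (\<xi> \<bullet> t)) * f t"] by (simp add: norm_mult)
  then show ?thesis
    by (simp add: fourier_def norm_mult mult_left_mono)
qed

lemma integral_convolution:
  fixes h k :: "'a::euclidean_space \<Rightarrow> complex"
  assumes h: "integrable lborel h" and k: "integrable lborel k"
  shows "integrable lborel (\<lambda>t. \<integral>v. k v * h (t - v) \<partial>lborel)"
    and "(\<integral>t. (\<integral>v. k v * h (t - v) \<partial>lborel) \<partial>lborel) = (\<integral>v. k v \<partial>lborel) * (\<integral>u. h u \<partial>lborel)"
proof -
  note I = integrable_convolution_kernel[OF h k]
  show "integrable lborel (\<lambda>t. \<integral>v. k v * h (t - v) \<partial>lborel)"
    using lborel_pair.integrable_snd[OF I] .
  have "(\<integral>t. (\<integral>v. k v * h (t - v) \<partial>lborel) \<partial>lborel) = (\<integral>v. (\<integral>t. k v * h (t - v) \<partial>lborel) \<partial>lborel)"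
    by (rule lborel_pair.Fubini_integral[OF I])
  then show "(\<integral>t. (\<integral>v. k v * h (t - v) \<partial>lborel) \<partial>lborel) = (\<integral>v. k v \<partial>lborel) * (\<integral>u. h u \<partial>lborel)"
    using lborel_integral_translate[OF h] by simp
qed

text \<open>
  The convolution of the indicator function of \<open>S\<close> with the Gaussian of width \<open>r\<close>.
\<close>

definition gauss_mean :: "real \<Rightarrow> 'a::euclidean_space set \<Rightarrow> 'a \<Rightarrow> real" where
  "gauss_mean r S t = (\<integral>v. gauss v * indicator S (t - r *\<^sub>R v) \<partial>lborel)"

lemma gauss_mean_integrand:
  assumes S: "S \<in> sets borel"
  shows "(\<lambda>v. gauss v * indicator S (t - r *\<^sub>R v)) \<in> borel_measurable lborel"
    and "integrable lborel (\<lambda>v. gauss v * indicator S (t - r *\<^sub>R v))"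
proof -
  have "(\<lambda>v. t - r *\<^sub>R v) \<in> borel \<rightarrow>\<^sub>M borel" by simp
  from measurable_compose[OF this borel_measurable_indicator[OF S]]
  have [measurable]: "(\<lambda>v. indicator S (t - r *\<^sub>R v) :: real) \<in> borel_measurable borel" .
  show m: "(\<lambda>v. gauss v * indicator S (t - r *\<^sub>R v)) \<in> borel_measurable lborel"
    by simp
  show "integrable lborel (\<lambda>v. gauss v * indicator S (t - r *\<^sub>R v))"
    by (rule Bochner_Integration.integrable_bound[OF gauss_integrable m])
       (auto simp: indicator_def)
qed

lemma gauss_mean_range:
  assumes S: "S \<in> sets borel"
  shows "0 \<le> gauss_mean r S t" "gauss_mean r S t \<le> 1"
proof -
  show "0 \<le> gauss_mean r S t"
    unfolding gauss_mean_def by (rule integral_nonneg_AE) (auto simp: indicator_def)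
  have "gauss_mean r S t \<le> (\<integral>v. gauss (v::'a) \<partial>lborel)"
    unfolding gauss_mean_def
    by (rule integral_mono[OF gauss_mean_integrand(2)[OF S] gauss_integrable])
        (auto simp: indicator_def)
  then show "gauss_mean r S t \<le> 1"
    by (simp add: gauss_integral)
qed

text \<open>
  The transform of the convolution is the transform of the indicator function, which is bounded, times a
  Gaussian. So it is integrable, and inserting the definition of the former and applying Fubini's
  theorem reduces the inversion formula to the self-duality of the Gaussian.
\<close>

lemma fourier_pair_gauss_mean_unscaled:
  fixes S :: "'a::euclidean_space set"
  assumes S: "S \<in> sets borel" and fin: "integrable lborel (\<lambda>u. complex_of_real (indicator S u))"
  shows "\<exists>g. fourier_pair (\<lambda>t. complex_of_real (gauss_mean 1 S t)) g"
    and "(\<integral>t. complex_of_real (gauss_mean 1 S t) \<partial>lborel)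
        = (\<integral>u. complex_of_real (indicator S u) \<partial>lborel)"
proof -
  let ?c = "complex_of_real (fourier_const TYPE('a))"
  define h k where "h u = complex_of_real (indicator S u)" and "k v = complex_of_real (gauss v)"
      for u v :: 'a
  have c0: "?c \<noteq> 0"
    by simp
  have h: "integrable lborel h" using fin by (simp add: h_def[abs_def])
  have k: "integrable lborel k" 
    using gauss_integrable[where 'a='a] by (simp add: k_def[abs_def] complex_of_real_integrable_eq)
  have [measurable]: "h \<in> borel_measurable borel" "k \<in> borel_measurable borel"
    using h k by auto
  define f where "f t = complex_of_real (gauss_mean 1 S t)" for t
  have f: "f t = (\<integral>v. k v * h (t - v) \<partial>lborel)" for t
    by (simp add: f_def gauss_mean_def h_def k_def flip: of_real_mult)
  define g where "g \<xi> = k \<xi> * (fourier (-1) h \<xi> / ?c)" for \<xi>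
  have fi: "integrable lborel f"
    using integral_convolution(1)[OF h k] by (simp add: f[abs_def])
  show "(\<integral>t. complex_of_real (gauss_mean 1 S t) \<partial>lborel)
      = (\<integral>u. complex_of_real (indicator S u) \<partial>lborel)"
  proof -
    have "(\<integral>v. k v \<partial>lborel) = of_real (\<integral>v. gauss (v::'a) \<partial>lborel)"
      unfolding k_def by (rule integral_complex_of_real)
    then have "(\<integral>v. k v \<partial>lborel) = 1"
      by (simp add: gauss_integral)
    then have "(\<integral>t. f t \<partial>lborel) = (\<integral>u. h u \<partial>lborel)"
      using integral_convolution(2)[OF h k] by (simp only: f mult_1_left)
    then show ?thesis
      unfolding f_def h_def .
  qed
  have "f \<in> sq_integrable lborel"
  proof (rule sq_integrableI_bound)
    show "f \<in> borel_measurable lborel" using fi by simp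
    show "integrable lborel (gauss_mean 1 S)"
      using fi by (simp add: f_def[abs_def] complex_of_real_integrable_eq)
    show "AE t in lborel. (cmod (f t))\<^sup>2 \<le> gauss_mean 1 S t"
      using gauss_mean_range[OF S] by (auto simp: f_def power2_eq_square intro!: mult_left_le)
  qed
  then have Lf: "L12 f" using fi by (simp add: L12_def)
  define V where "V = (\<integral>t. cmod (h t) \<partial>lborel)"
  have V0: "V \<ge> 0" by (simp add: V_def integral_nonneg_AE)
  have gb: "cmod (g \<xi>) \<le> V * gauss \<xi>" for \<xi>
  proof -
    have "cmod (fourier (-1) h \<xi> / ?c) \<le> V"
      using fourier_bound[of "-1" h \<xi>] fourier_const_pos[where 'a='a]
      by (simp add: V_def norm_divide field_simps)
    then show ?thesis
      using mult_right_mono[of "cmod (fourier (-1) h \<xi> / ?c)" V "gauss \<xi>"]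
      by (simp only: g_def k_def norm_mult norm_of_real abs_of_nonneg gauss_nonneg mult.commute)
  qed
  have gm: "g \<in> borel_measurable lborel"
    unfolding g_def[abs_def] by measurable
  have Lg: "L12 g"
    unfolding L12_def
  proof
    show "integrable lborel g"
      by (rule Bochner_Integration.integrable_bound[of _ "\<lambda>\<xi>. V * gauss \<xi>"])
         (use gb gauss_integrable[where 'a='a] gm V0 in \<open>auto simp: abs_mult\<close>)
    show "g \<in> sq_integrable lborel"
    proof (rule sq_integrableI_bound[OF gm])
      show "integrable lborel (\<lambda>\<xi>::'a. V\<^sup>2 * fourier_const TYPE('a) * gauss \<xi>)"
        using gauss_integrable[where 'a='a] by simp
      have "(cmod (g \<xi>))\<^sup>2 \<le> V\<^sup>2 * fourier_const TYPE('a) * gauss \<xi>" for \<xi>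
      proof -
        have "(cmod (g \<xi>))\<^sup>2 \<le> (V * gauss \<xi>)\<^sup>2"
          using gb by (intro power_mono) auto
        also have "\<dots> = V\<^sup>2 * (gauss \<xi> * gauss \<xi>)"
          by (simp add: power2_eq_square mult_ac)
        also have "\<dots> \<le> V\<^sup>2 * (fourier_const TYPE('a) * gauss \<xi>)"
          using gauss_le[of \<xi>] by (intro mult_left_mono mult_right_mono) auto
        finally show ?thesis by (simp add: mult_ac)
      qed
      then show "AE \<xi> in lborel. (cmod (g \<xi>))\<^sup>2 \<le> V\<^sup>2 * fourier_const TYPE('a) * gauss \<xi>"
        by simp
    qed
  qed
  have gauss_k: "?c * (\<integral>t. cis (s * (\<xi> \<bullet> t)) * k t \<partial>lborel) = k (s *\<^sub>R \<xi>)" for s \<xi>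
    using gauss_fourier[of s \<xi>] by (simp add: k_def)
  have "fourier (-1) f \<xi> = g \<xi>" for \<xi>
  proof -
    let ?e = "\<lambda>t. cis (-1 * (\<xi> \<bullet> t))"
    have "?e t * f t = (\<integral>v. (?e v * k v) * (?e (t - v) * h (t - v)) \<partial>lborel)" for t
    proof -
      have "(\<integral>v. (?e v * k v) * (?e (t - v) * h (t - v)) \<partial>lborel)
          = (\<integral>v. ?e t * (k v * h (t - v)) \<partial>lborel)"
      proof (rule Bochner_Integration.integral_cong[OF refl])
        fix v
        have "?e v * ?e (t - v) = ?e t"
          by (simp add: cis_mult inner_diff_right)
        then show "(?e v * k v) * (?e (t - v) * h (t - v)) = ?e t * (k v * h (t - v))"
          by (metis (no_types, lifting) mult.assoc mult.left_commute)
      qed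
      then show ?thesis by (simp add: f)
    qed
    then have "fourier (-1) f \<xi> = ?c * ((\<integral>v. ?e v * k v \<partial>lborel) * (\<integral>u. ?e u * h u \<partial>lborel))"
      using integral_convolution(2)[OF integrable_cis[OF h] integrable_cis[OF k], of "-1" \<xi> "-1" \<xi>]
      by (simp add: fourier_def)
    also have "\<dots> = k (- 1 *\<^sub>R \<xi>) * (\<integral>u. ?e u * h u \<partial>lborel)"
      using gauss_k[of "-1" \<xi>] by (simp flip: mult.assoc)
    also have "\<dots> = g \<xi>"
      using c0 by (simp add: g_def fourier_def k_def)
    finally show ?thesis .
  qed
  moreover have "fourier 1 g t = f t" for t
  proof -
    have I: "integrable (lborel \<Otimes>\<^sub>M lborel) (\<lambda>(\<xi>, u). cis ((t - u) \<bullet> \<xi>) * (k \<xi> * h u))"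
      by (rule integrable_kernel[OF k h]) (auto simp: case_prod_beta)
    have "cis (1 * (t \<bullet> \<xi>)) * g \<xi> = (\<integral>u. cis ((t - u) \<bullet> \<xi>) * (k \<xi> * h u) \<partial>lborel)" for \<xi>
    proof -
      have "(\<integral>u. cis ((t - u) \<bullet> \<xi>) * (k \<xi> * h u) \<partial>lborel)
          = (\<integral>u. (cis (t \<bullet> \<xi>) * k \<xi>) * (cis (-1 * (\<xi> \<bullet> u)) * h u) \<partial>lborel)"
      proof (rule Bochner_Integration.integral_cong[OF refl])
        fix u
        have "cis (t \<bullet> \<xi>) * cis (-1 * (\<xi> \<bullet> u)) = cis ((t - u) \<bullet> \<xi>)"
          by (simp add: cis_mult inner_diff_right inner_commute[of _ \<xi>])
        then show "cis ((t - u) \<bullet> \<xi>) * (k \<xi> * h u) = (cis (t \<bullet> \<xi>) * k \<xi>) * (cis (-1 * (\<xi> \<bullet> u)) * h u)"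
          by (metis (no_types, lifting) mult.assoc mult.left_commute)
      qed
      then show ?thesis
        using c0 by (simp add: g_def fourier_def)
    qed
    then have "fourier 1 g t = ?c * (\<integral>\<xi>. (\<integral>u. cis ((t - u) \<bullet> \<xi>) * (k \<xi> * h u) \<partial>lborel) \<partial>lborel)"
      by (simp add: fourier_def)
    also have "\<dots> = ?c * (\<integral>u. (\<integral>\<xi>. cis ((t - u) \<bullet> \<xi>) * (k \<xi> * h u) \<partial>lborel) \<partial>lborel)"
      using lborel_pair.Fubini_integral[OF I] by simp
    also have "\<dots> = (\<integral>u. ?c * (\<integral>\<xi>. (cis (1 * ((t - u) \<bullet> \<xi>)) * k \<xi>) * h u \<partial>lborel) \<partial>lborel)"
      by (simp add: mult.assoc)
    also have "\<dots> = (\<integral>u. k (t - u) * h u \<partial>lborel)"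
    proof (rule Bochner_Integration.integral_cong[OF refl])
      fix u
      have "(\<integral>\<xi>. (cis (1 * ((t - u) \<bullet> \<xi>)) * k \<xi>) * h u \<partial>lborel)
          = (\<integral>\<xi>. cis (1 * ((t - u) \<bullet> \<xi>)) * k \<xi> \<partial>lborel) * h u"
        by (rule integral_mult_left_zero)
      then show "?c * (\<integral>\<xi>. (cis (1 * ((t - u) \<bullet> \<xi>)) * k \<xi>) * h u \<partial>lborel) = k (t - u) * h u"
        using gauss_k[of 1 "t - u"] by (simp only: mult.assoc[symmetric] scaleR_one)
    qed
    also have "\<dots> = (\<integral>v. (\<lambda>u. k (t - u) * h u) (t - v) \<partial>lborel)"
      by (rule lborel_integral_reflect[symmetric]) simp
    also have "\<dots> = f t"
      by (simp add: f)
    finally show ?thesis .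
  qed
  ultimately have "fourier_pair f g"
    using Lf Lg by (intro fourier_pairI) auto
  then show "\<exists>g. fourier_pair (\<lambda>t. complex_of_real (gauss_mean 1 S t)) g"
    unfolding f_def[abs_def] by blast
qed

lemma scaleR_mat_1:
  fixes x :: "real^'n"
  shows "(r *\<^sub>R mat 1) *v x = r *\<^sub>R x"
  by (simp add: scaleR_matrix_vector_assoc[symmetric])

text \<open>
  The mean of width \<open>r\<close> over \<open>S\<close> at \<open>t\<close> is the mean of width \<open>1\<close> over \<open>S/r\<close> at \<open>t/r\<close>.
\<close>

lemma fourier_pair_gauss_mean:
  fixes S :: "(real^'n) set"
  assumes S: "S \<in> sets borel" and fin: "integrable lborel (\<lambda>u. complex_of_real (indicator S u))"
      and r: "r > 0"
  shows "\<exists>g. fourier_pair (\<lambda>t. complex_of_real (gauss_mean r S t)) g"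
    and "(\<integral>t. complex_of_real (gauss_mean r S t) \<partial>lborel)
        = (\<integral>u. complex_of_real (indicator S u) \<partial>lborel)"
proof -
  let ?A = "(1/r) *\<^sub>R mat 1 :: real^'n^'n" and ?A' = "r *\<^sub>R mat 1 :: real^'n^'n"
  have AA': "?A ** ?A' = mat 1"
    unfolding matrix_eq using r by (simp add: scaleR_mat_1 matrix_vector_mul_assoc[symmetric])
  have A'A: "?A' ** ?A = mat 1"
    using AA' matrix_left_right_inverse by blast
  have inv: "invertible ?A" "invertible ?A'"
    using AA' A'A unfolding invertible_def by blast+
  have "det ?A * det ?A' = 1"
    using AA' by (metis det_mul det_I)
  then have dd: "\<bar>det ?A\<bar> * \<bar>det ?A'\<bar> = 1"
    by (metis abs_mult abs_one)
  then have d0: "\<bar>det ?A\<bar> \<noteq> 0" "\<bar>det ?A'\<bar> \<noteq> 0" by auto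
  \<comment> \<open>The set \<open>S/r\<close>.\<close>
  define T where "T = (\<lambda>u. r *\<^sub>R u) -` S"
  have T: "T \<in> sets borel"
    unfolding T_def using measurable_sets_borel[of "\<lambda>u. r *\<^sub>R u" borel S] S by simp
  have ind: "complex_of_real (indicator T u) = (\<lambda>u. complex_of_real (indicator S u)) (?A' *v u)" for u
    by (simp add: T_def indicator_def scaleR_mat_1)
  have Tfin: "integrable lborel (\<lambda>u. complex_of_real (indicator T u))"
    unfolding ind by (rule lborel_integrable_linear[OF inv(2) fin])
  have mean: "gauss_mean 1 T (?A *v t) = gauss_mean r S t" for t
  proof -
    have "indicator T (?A *v t - 1 *\<^sub>R v) = (indicator S (t - r *\<^sub>R v) :: real)" for v
      using r by (simp add: T_def indicator_def scaleR_mat_1 scaleR_right_diff_distrib)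
    then show ?thesis by (simp add: gauss_mean_def)
  qed
  obtain g where g: "fourier_pair (\<lambda>t. complex_of_real (gauss_mean 1 T t)) g"
    using fourier_pair_gauss_mean_unscaled(1)[OF T Tfin] by blast
  have "fourier_pair (\<lambda>t. of_real (1 / sqrt \<bar>det ?A\<bar>) * (of_real (sqrt \<bar>det ?A\<bar>)
      * complex_of_real (gauss_mean r S t)))
          (\<lambda>\<xi>. of_real (1 / sqrt \<bar>det ?A\<bar>) * (of_real (sqrt \<bar>det ?A'\<bar>) * g (transpose ?A' *v \<xi>)))"
    using fourier_pair_scale[OF fourier_pair_linear[OF g AA']] by (simp only: mean)
  moreover have "of_real (1 / sqrt \<bar>det ?A\<bar>) * (of_real (sqrt \<bar>det ?A\<bar>) * z) = z" for z :: complex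
    using d0(1) by (simp flip: mult.assoc of_real_mult)
  ultimately show "\<exists>g. fourier_pair (\<lambda>t. complex_of_real (gauss_mean r S t)) g"
    by auto
  have i1: "integrable lborel (\<lambda>t. complex_of_real (gauss_mean 1 T t))"
    using fourier_pairD(5)[OF g] .
  have "(\<integral>t. complex_of_real (gauss_mean r S t) \<partial>lborel)
      = of_real (\<bar>det ?A'\<bar> * \<bar>det ?A\<bar>) * (\<integral>t. complex_of_real (gauss_mean r S t) \<partial>lborel)"
    using dd by (simp add: mult.commute)
  also have "\<dots> = of_real \<bar>det ?A'\<bar> * (of_real \<bar>det ?A\<bar>
      * (\<integral>t. complex_of_real (gauss_mean 1 T (?A *v t)) \<partial>lborel))"
    by (simp only: mean of_real_mult mult.assoc)
  also have "\<dots> = of_real \<bar>det ?A'\<bar> * (\<integral>t. complex_of_real (gauss_mean 1 T t) \<partial>lborel)"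
    by (simp only: lborel_integral_linear[OF inv(1) i1])
  also have "\<dots> = of_real \<bar>det ?A'\<bar> * (\<integral>u. complex_of_real (indicator S (?A' *v u)) \<partial>lborel)"
    by (simp only: fourier_pair_gauss_mean_unscaled(2)[OF T Tfin] ind)
  also have "\<dots> = (\<integral>u. complex_of_real (indicator S u) \<partial>lborel)"
    by (rule lborel_integral_linear[OF inv(2) fin])
  finally show "(\<integral>t. complex_of_real (gauss_mean r S t) \<partial>lborel)
      = (\<integral>u. complex_of_real (indicator S u) \<partial>lborel)" .
qed

subsection \<open>Density\<close>

lemma
  assumes f: "f \<in> borel_measurable borel"
  shows L2_norm_lebesgue: "L2_norm lebesgue f = L2_norm lborel f"
    and sq_integrable_lebesgue: "f \<in> sq_integrable lborel \<Longrightarrow> f \<in> sq_integrable lebesgue"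
proof -
  have [measurable]: "f \<in> borel_measurable borel" by fact
  have m: "(\<lambda>x. (cmod (f x))\<^sup>2) \<in> borel_measurable lborel"
    by measurable
  show "L2_norm lebesgue f = L2_norm lborel f"
    by (simp add: L2_norm_def integral_completion[OF m])
  have "f \<in> borel_measurable lebesgue"
    using f by (simp add: measurable_completion)
  then show "f \<in> sq_integrable lborel \<Longrightarrow> f \<in> sq_integrable lebesgue"
    using integrable_completion[OF m] by (simp add: sq_integrable_def)
qed

lemma L2_inner_lebesgue:
  assumes [measurable]: "f \<in> borel_measurable borel" "g \<in> borel_measurable borel"
  shows "L2_inner lebesgue f g = L2_inner lborel f g"
  unfolding L2_inner_def by (rule integral_completion) measurable

lemma fourier_pair_borel:
  assumes p: "fourier_pair f g"
  shows "f \<in> borel_measurable borel" "g \<in> borel_measurable borel"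
    "f \<in> sq_integrable lebesgue" "g \<in> sq_integrable lebesgue"
proof -
  show b: "f \<in> borel_measurable borel" "g \<in> borel_measurable borel"
    using fourier_pairD(5,6)[OF p] by auto
  show "f \<in> sq_integrable lebesgue" "g \<in> sq_integrable lebesgue"
    using b fourier_pairD(7,8)[OF p] by (auto intro: sq_integrable_lebesgue)
qed

definition approximable :: "('a::euclidean_space \<Rightarrow> complex) \<Rightarrow> bool" where
  "approximable f \<longleftrightarrow> f \<in> sq_integrable lebesgue \<and>
     (\<forall>e>0. \<exists>a b. fourier_pair a b \<and> L2_norm lebesgue (\<lambda>x. f x - a x) < e)"

lemma approximable_limit:
  assumes f: "f \<in> sq_integrable lebesgue"
    and lim: "\<And>e. e > 0 \<Longrightarrow> \<exists>h. approximable h \<and> L2_norm lebesgue (\<lambda>x. f x - h x) < e"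
  shows "approximable f"
  unfolding approximable_def
proof (intro conjI allI impI)
  fix e :: real assume e: "e > 0"
  obtain h where h: "approximable h" "L2_norm lebesgue (\<lambda>x. f x - h x) < e/2"
    using lim[of "e/2"] e by auto
  obtain a b where ab: "fourier_pair a b" "L2_norm lebesgue (\<lambda>x. h x - a x) < e/2"
    using h(1) e unfolding approximable_def by (meson half_gt_zero)
  have "L2_norm lebesgue (\<lambda>x. f x - a x)
      \<le> L2_norm lebesgue (\<lambda>x. f x - h x) + L2_norm lebesgue (\<lambda>x. h x - a x)"
    using h(1) ab(1) f by (intro L2_norm_triangle_diff) (auto simp: approximable_def fourier_pair_borel)
  then have "L2_norm lebesgue (\<lambda>x. f x - a x) < e"
    using h(2) ab(2) by linarith
  then show "\<exists>a b. fourier_pair a b \<and> L2_norm lebesgue (\<lambda>x. f x - a x) < e"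
    using ab(1) by blast
qed (rule f)

lemma approximable_add:
  assumes f: "approximable f" and g: "approximable g"
  shows "approximable (\<lambda>x. f x + g x)"
  unfolding approximable_def
proof (intro conjI allI impI)
  show "(\<lambda>x. f x + g x) \<in> sq_integrable lebesgue"
    using f g by (simp add: approximable_def sq_integrable_add)
  fix e :: real assume e: "e > 0"
  obtain a b where ab: "fourier_pair a b" "L2_norm lebesgue (\<lambda>x. f x - a x) < e/2"
    using f e unfolding approximable_def by (meson half_gt_zero)
  obtain a' b' where ab': "fourier_pair a' b'" "L2_norm lebesgue (\<lambda>x. g x - a' x) < e/2"
    using g e unfolding approximable_def by (meson half_gt_zero)
  have "L2_norm lebesgue (\<lambda>x. (f x - a x) + (g x - a' x))
      \<le> L2_norm lebesgue (\<lambda>x. f x - a x) + L2_norm lebesgue (\<lambda>x. g x - a' x)"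
    using f g ab(1) ab'(1) by (intro L2_norm_triangle sq_integrable_diff)
        (auto simp: approximable_def fourier_pair_borel)
  then have "L2_norm lebesgue (\<lambda>x. (f x + g x) - (a x + a' x)) < e"
    using ab(2) ab'(2) by (simp add: algebra_simps)
  then show "\<exists>a b. fourier_pair a b \<and> L2_norm lebesgue (\<lambda>x. (f x + g x) - a x) < e"
    using fourier_pair_add[OF ab(1) ab'(1)] by blast
qed

lemma approximable_scale:
  assumes f: "approximable f"
  shows "approximable (\<lambda>x. c * f x)"
  unfolding approximable_def
proof (intro conjI allI impI)
  show "(\<lambda>x. c * f x) \<in> sq_integrable lebesgue"
    using f by (simp add: approximable_def sq_integrable_scale)
  fix e :: real assume e: "e > 0"
  have e': "e / (cmod c + 1) > 0"
    using e by (simp add: add_nonneg_pos)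
  obtain a b where ab: "fourier_pair a b" "L2_norm lebesgue (\<lambda>x. f x - a x) < e / (cmod c + 1)"
    using f e' unfolding approximable_def by meson
  have "L2_norm lebesgue (\<lambda>x. c * (f x - a x)) = cmod c * L2_norm lebesgue (\<lambda>x. f x - a x)"
    by (rule L2_norm_scale)
  also have "\<dots> \<le> cmod c * (e / (cmod c + 1))"
    using ab(2) by (intro mult_left_mono) auto
  also have "\<dots> < e"
    using e by (simp add: pos_divide_less_eq add_nonneg_pos distrib_left)
  finally have "L2_norm lebesgue (\<lambda>x. c * f x - c * a x) < e"
    by (simp add: right_diff_distrib)
  then show "\<exists>a b. fourier_pair a b \<and> L2_norm lebesgue (\<lambda>x. c * f x - a x) < e"
    using fourier_pair_scale[OF ab(1)] by blast
qed

lemma sq_integrable_indicator: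
  assumes "S \<in> fmeasurable M"
  shows "(\<lambda>x. complex_of_real (indicator S x)) \<in> sq_integrable M"
proof -
  have "integrable M (\<lambda>x. indicator S x :: real)"
    using assms by (simp add: fmeasurable_def integrable_indicator_iff)
  moreover have "(\<lambda>x. (cmod (complex_of_real (indicator S x)))\<^sup>2) = (\<lambda>x. indicator S x)"
    by (auto simp: indicator_def)
  ultimately show ?thesis
    using assms by (auto simp: sq_integrable_def fmeasurable_def)
qed

text \<open>
  Let \<open>F\<close> be the Gaussian mean of width \<open>r\<close> over \<open>S\<close>. From \<open>0 \<le> F \<le> 1\<close> one has
  \<open>(1\<^sub>S - F)\<^sup>2 \<le> F + 1\<^sub>S - 2 F 1\<^sub>S\<close>, and \<open>F\<close> and \<open>1\<^sub>S\<close> have the same integral. So the squared distance of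
  \<open>F\<close> to \<open>1\<^sub>S\<close> is at most \<open>2 (\<bar>S\<bar> - \<integral>\<^sub>S F)\<close>, which tends to \<open>0\<close> with \<open>r\<close> because \<open>F\<close> tends to \<open>1\<close> at
  every point of the open set \<open>S\<close>.
\<close>

lemma approximable_open:
  fixes S :: "(real^'n) set"
  assumes S: "open S" and fin: "emeasure lborel S < \<infinity>"
  shows "approximable (\<lambda>x. complex_of_real (indicator S x))"
  unfolding approximable_def
proof (intro conjI allI impI)
  have Sb: "S \<in> sets borel" using S by simp
  have iS: "integrable lborel (\<lambda>u. indicator S u :: real)"
    using fin Sb by (simp add: integrable_indicator_iff)
  then have iSc: "integrable lborel (\<lambda>u. complex_of_real (indicator S u))"
    by (simp only: complex_of_real_integrable_eq)
  show "(\<lambda>x. complex_of_real (indicator S x)) \<in> sq_integrable lebesgue"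
    using fin Sb by (intro sq_integrable_indicator) (auto simp: fmeasurable_def)
  fix e :: real assume e: "e > 0"
  define V :: real where "V = (\<integral>u. indicator S u \<partial>(lborel :: (real^'n) measure))"
  define r where "r k = 1 / real (Suc k)" for k
  have r: "r k > 0" for k by (simp add: r_def)
  have r0: "r \<longlonglongrightarrow> 0"
    unfolding r_def by (rule LIMSEQ_inverse_real_of_nat[unfolded inverse_eq_divide])
  define F where "F k t = gauss_mean (r k) S t" for k t
  have F01: "0 \<le> F k t" "F k t \<le> 1" for k t
    unfolding F_def by (rule gauss_mean_range[OF Sb])+
  have Fi: "integrable lborel (F k)" and Fp: "\<exists>g. fourier_pair (\<lambda>t. complex_of_real (F k t)) g"
    and FV: "(\<integral>t. F k t \<partial>lborel) = V" for k
  proof -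
    show p: "\<exists>g. fourier_pair (\<lambda>t. complex_of_real (F k t)) g"
      unfolding F_def by (rule fourier_pair_gauss_mean(1)[OF Sb iSc r])
    then have "integrable lborel (\<lambda>t. complex_of_real (F k t))"
      using fourier_pairD(5) by blast
    then show "integrable lborel (F k)"
      by (simp only: complex_of_real_integrable_eq)
    show "(\<integral>t. F k t \<partial>lborel) = V"
      using fourier_pair_gauss_mean(2)[OF Sb iSc r, of k]
      unfolding F_def V_def integral_complex_of_real of_real_eq_iff .
  qed
  have Flim: "(\<lambda>k. F k t) \<longlonglongrightarrow> 1" if t: "t \<in> S" for t
  proof -
    have "(\<lambda>k. \<integral>v. gauss v * indicator S (t - r k *\<^sub>R v) \<partial>lborel) \<longlonglongrightarrow> (\<integral>v. gauss (v::real^'n) \<partial>lborel)"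
    proof (rule integral_dominated_convergence[where w = gauss])
      show "AE v in lborel. (\<lambda>k. gauss v * indicator S (t - r k *\<^sub>R v)) \<longlonglongrightarrow> gauss v"
      proof (rule AE_I2)
        fix v :: "real^'n"
        have "(\<lambda>k. t - r k *\<^sub>R v) \<longlonglongrightarrow> t - 0 *\<^sub>R v"
          by (intro tendsto_intros r0)
        then have "\<forall>\<^sub>F k in sequentially. t - r k *\<^sub>R v \<in> S"
          using topological_tendstoD[OF _ S] t by fastforce
        then have "\<forall>\<^sub>F k in sequentially. gauss v * indicator S (t - r k *\<^sub>R v) = gauss v"
          by eventually_elim simp
        then show "(\<lambda>k. gauss v * indicator S (t - r k *\<^sub>R v)) \<longlonglongrightarrow> gauss v"
          by (rule tendsto_eventually)
      qed
      show "AE v in lborel. norm (gauss v * indicator S (t - r k *\<^sub>R v)) \<le> gauss v" for k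
        by (rule AE_I2) (simp add: indicator_def)
    qed (use gauss_integrable[where 'a="real^'n"] gauss_mean_integrand(1)[OF Sb] in auto)
    then show ?thesis
      by (simp add: F_def gauss_mean_def gauss_integral)
  qed
  have mF: "F k \<in> borel_measurable borel" for k
    using borel_measurable_integrable[OF Fi] by simp
  note [measurable] = mF
  have [measurable]: "(\<lambda>t. indicator S t :: real) \<in> borel_measurable borel"
    by (rule borel_measurable_indicator[OF Sb])
  have iFS: "integrable lborel (\<lambda>t. F k t * indicator S t)" for k
  proof (rule Bochner_Integration.integrable_bound[OF iS])
    show "(\<lambda>t. F k t * indicator S t) \<in> borel_measurable lborel" by simp
  qed (use F01 in \<open>auto simp: indicator_def\<close>)
  have "(\<lambda>k. \<integral>t. F k t * indicator S t \<partial>lborel) \<longlonglongrightarrow> V"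
    unfolding V_def
  proof (rule integral_dominated_convergence[where w = "indicator S"])
    show "AE t in lborel. (\<lambda>k. F k t * indicator S t) \<longlonglongrightarrow> indicator S t"
    proof (rule AE_I2)
      fix t show "(\<lambda>k. F k t * indicator S t) \<longlonglongrightarrow> (indicator S t :: real)"
        using Flim[of t] by (cases "t \<in> S") auto
    qed
    show "AE t in lborel. norm (F k t * indicator S t) \<le> indicator S t" for k
      using F01 by (intro AE_I2) (simp add: indicator_def)
  qed (use iS in auto)
  then have "(\<lambda>k. 2 * (V - (\<integral>t. F k t * indicator S t \<partial>lborel))) \<longlonglongrightarrow> 2 * (V - V)"
    by (intro tendsto_intros)
  then have "\<forall>\<^sub>F k in sequentially. 2 * (V - (\<integral>t. F k t * indicator S t \<partial>lborel)) < e\<^sup>2"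
    by (rule order_tendstoD) (use e in simp)
  then obtain k where k: "2 * (V - (\<integral>t. F k t * indicator S t \<partial>lborel)) < e\<^sup>2"
    by (auto simp: eventually_sequentially)
  have "(L2_norm lborel (\<lambda>t. complex_of_real (indicator S t) - complex_of_real (F k t)))\<^sup>2
      = (\<integral>t. (indicator S t - F k t)\<^sup>2 \<partial>lborel)"
    by (simp only: L2_norm_sq of_real_diff[symmetric] norm_of_real power2_abs)
  also have "\<dots> \<le> (\<integral>t. F k t + indicator S t - 2 * (F k t * indicator S t) \<partial>lborel)"
  proof (rule integral_mono)
    have bd: "(indicator S t - F k t)\<^sup>2 \<le> F k t + indicator S t - 2 * (F k t * indicator S t)" for t
      using mult_left_le[OF F01(2,1)[of k t]]
      by (auto simp: indicator_def power2_eq_square algebra_simps)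
    then show "(indicator S t - F k t)\<^sup>2 \<le> F k t + indicator S t - 2 * (F k t * indicator S t)" for t .
    show i: "integrable lborel (\<lambda>t. F k t + indicator S t - 2 * (F k t * indicator S t))"
      using Fi iS iFS by auto
    show "integrable lborel (\<lambda>t. (indicator S t - F k t)\<^sup>2)"
      by (rule Bochner_Integration.integrable_bound[OF i])
          (use bd in \<open>auto intro: order_trans[OF _ abs_ge_self]\<close>)
  qed
  also have "\<dots> = V + V - 2 * (\<integral>t. F k t * indicator S t \<partial>lborel)"
    using Fi iS iFS FV by (simp add: V_def)
  also have "\<dots> < e\<^sup>2"
    using k by simp
  finally have "L2_norm lborel (\<lambda>t. complex_of_real (indicator S t) - complex_of_real (F k t)) < e"
    using e power2_less_imp_less less_imp_le by blast
  then have "L2_norm lebesgue (\<lambda>t. complex_of_real (indicator S t) - complex_of_real (F k t)) < e"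
    by (subst L2_norm_lebesgue) auto
  then show "\<exists>a b. fourier_pair a b \<and> L2_norm lebesgue (\<lambda>x. complex_of_real (indicator S x) - a x) < e"
    using Fp[of k] by blast
qed

lemma approximable_indicator:
  fixes S :: "(real^'n) set"
  assumes S: "S \<in> lmeasurable"
  shows "approximable (\<lambda>x. complex_of_real (indicator S x))"
proof (rule approximable_limit)
  show "(\<lambda>x. complex_of_real (indicator S x)) \<in> sq_integrable lebesgue"
    by (rule sq_integrable_indicator[OF S])
  fix e :: real assume e: "e > 0"
  obtain T where T: "open T" "S \<subseteq> T" "T - S \<in> lmeasurable" "emeasure lebesgue (T - S) < ennreal (e\<^sup>2)"
    using sets_lebesgue_outer_open[of S "e\<^sup>2"] S e by (auto simp: fmeasurable_def)
  have "T = S \<union> (T - S)" using T(2) by blast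
  then have "T \<in> lmeasurable" using S T(3) by (metis fmeasurable.Un)
  then have "emeasure lborel T < \<infinity>"
    using T(1) by (auto simp: fmeasurable_def)
  then have ap: "approximable (\<lambda>x. complex_of_real (indicator T x))"
    by (rule approximable_open[OF T(1)])
  have "(L2_norm lebesgue (\<lambda>x. complex_of_real (indicator S x) - complex_of_real (indicator T x)))\<^sup>2
      = (\<integral>x. indicator (T - S) x \<partial>lebesgue)"
    unfolding L2_norm_sq using T(2) by (intro Bochner_Integration.integral_cong)
        (auto simp: indicator_def)
  also have "\<dots> = measure lebesgue (T - S)"
    using T(3) by (simp add: fmeasurable_def)
  also have "\<dots> < e\<^sup>2"
    using T(3,4) by (subst (asm) emeasure_eq_measure2) (auto simp: ennreal_less_iff)
  finally have "L2_norm lebesgue (\<lambda>x. complex_of_real (indicator S x) - complex_of_real (indicator T x))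
      < e"
    using e power2_less_imp_less less_imp_le by blast
  then show "\<exists>h. approximable h \<and> L2_norm lebesgue (\<lambda>x. complex_of_real (indicator S x) - h x) < e"
    using ap by blast
qed

text \<open>
  Measurable sets of finite measure are approximated by open ones, square integrable simple functions are
  combinations of the former, and they are dense.
\<close>

lemma approximable_sq_integrable:
  fixes f :: "real^'n \<Rightarrow> complex"
  assumes f: "f \<in> sq_integrable lebesgue"
  shows "approximable f"
proof -
  have zero: "approximable (\<lambda>x::real^'n. 0)"
    using approximable_scale[OF approximable_indicator[of "{}"], of 0] by simp
  have simple: "approximable s" if s: "simple_function lebesgue s" "s \<in> sq_integrable lebesgue"
    for s :: "real^'n \<Rightarrow> complex"
  proof -
    have fin: "finite (range s)"
      using s(1) by (simp add: simple_function_def)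
    have lm: "s -` {y} \<in> lmeasurable" if y: "y \<noteq> 0" for y
    proof -
      have sets: "s -` {y} \<in> sets lebesgue"
        using simple_functionD(2)[OF s(1), of "{y}"] by simp
      have "integrable lebesgue (\<lambda>x. (cmod (s x))\<^sup>2 / (cmod y)\<^sup>2)"
        using sq_integrableD(2)[OF s(2)] by simp
      then have "integrable lebesgue (\<lambda>x. indicator (s -` {y}) x :: real)"
        by (rule Bochner_Integration.integrable_bound[OF _ borel_measurable_indicator[OF sets]])
           (use y in \<open>auto simp: indicator_def\<close>)
      then show ?thesis
        using sets by (simp add: fmeasurable_def integrable_indicator_iff)
    qed
    have "approximable (\<lambda>x. \<Sum>y\<in>Y. y * complex_of_real (indicator (s -` {y}) x))" 
      if "finite Y" "0 \<notin> Y" for Y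
      using that
    proof induction
      case (insert y Y)
      then have "approximable (\<lambda>x. y * complex_of_real (indicator (s -` {y}) x) + 
          (\<Sum>y\<in>Y. y * complex_of_real (indicator (s -` {y}) x)))"
        by (intro approximable_add approximable_scale approximable_indicator lm) auto
      then show ?case using insert by simp
    qed (simp add: zero)
    then have "approximable (\<lambda>x. \<Sum>y\<in>range s - {0}. y * complex_of_real (indicator (s -` {y}) x))"
      using fin by simp
    moreover have "(\<Sum>y\<in>range s - {0}. y * complex_of_real (indicator (s -` {y}) x)) = s x" for x
    proof -
      have "(\<Sum>y\<in>range s - {0}. y * complex_of_real (indicator (s -` {y}) x))
          = (\<Sum>y\<in>range s - {0}. if y = s x then y else 0)"
        by (intro sum.cong) (auto simp: indicator_def)
      also have "\<dots> = s x"
        using fin by (simp add: sum.delta')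
      finally show ?thesis .
    qed
    ultimately show ?thesis by simp
  qed
  note [measurable] = sq_integrableD(1)[OF f]
  obtain F where F: "\<And>i. simple_function lebesgue (F i)"
    "\<And>x. (\<lambda>i. F i x) \<longlonglongrightarrow> f x" "\<And>i x. cmod (F i x) \<le> 2 * cmod (f x)"
    using borel_measurable_implies_sequence_metric[OF sq_integrableD(1)[OF f], of 0] by auto
  have [measurable]: "F i \<in> borel_measurable lebesgue" for i
    by (rule borel_measurable_simple_function[OF F(1)])
  have Fsq: "F i \<in> sq_integrable lebesgue" for i
  proof (rule sq_integrableI_bound)
    show "integrable lebesgue (\<lambda>x. 4 * (cmod (f x))\<^sup>2)"
      using sq_integrableD(2)[OF f] by simp
    have "(cmod (F i x))\<^sup>2 \<le> 4 * (cmod (f x))\<^sup>2" for x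
      using power_mono[OF F(3)[of i x], of 2] by (simp add: power_mult_distrib)
    then show "AE x in lebesgue. (cmod (F i x))\<^sup>2 \<le> 4 * (cmod (f x))\<^sup>2" by simp
  qed simp
  have "(\<lambda>i. \<integral>x. (cmod (f x - F i x))\<^sup>2 \<partial>lebesgue) \<longlonglongrightarrow> (\<integral>x. 0 \<partial>(lebesgue :: (real^'n) measure))"
  proof (rule integral_dominated_convergence[where w = "\<lambda>x. 9 * (cmod (f x))\<^sup>2"])
    show "integrable lebesgue (\<lambda>x. 9 * (cmod (f x))\<^sup>2)"
      using sq_integrableD(2)[OF f] by simp
    show "AE x in lebesgue. (\<lambda>i. (cmod (f x - F i x))\<^sup>2) \<longlonglongrightarrow> 0"
    proof (rule AE_I2)
      fix x
      have "(\<lambda>i. (cmod (f x - F i x))\<^sup>2) \<longlonglongrightarrow> (cmod (f x - f x))\<^sup>2"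
        by (intro tendsto_intros F(2))
      then show "(\<lambda>i. (cmod (f x - F i x))\<^sup>2) \<longlonglongrightarrow> 0" by simp
    qed
    have "cmod (f x - F i x) \<le> 3 * cmod (f x)" for i x
      using norm_triangle_ineq4[of "f x" "F i x"] F(3)[of i x] by linarith
    then have "(cmod (f x - F i x))\<^sup>2 \<le> (3 * cmod (f x))\<^sup>2" for i x
      by (intro power_mono) auto
    then show "AE x in lebesgue. norm ((cmod (f x - F i x))\<^sup>2) \<le> 9 * (cmod (f x))\<^sup>2" for i
      by (simp add: power_mult_distrib)
  qed auto
  then have lim: "(\<lambda>i. L2_norm lebesgue (\<lambda>x. f x - F i x)) \<longlonglongrightarrow> 0"
    unfolding L2_norm_def using tendsto_real_sqrt by fastforce
  show ?thesis
  proof (rule approximable_limit[OF f])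
    fix e :: real assume "e > 0"
    then have "\<forall>\<^sub>F i in sequentially. L2_norm lebesgue (\<lambda>x. f x - F i x) < e"
      by (rule order_tendstoD[OF lim])
    then obtain i where "L2_norm lebesgue (\<lambda>x. f x - F i x) < e"
      by (auto simp: eventually_sequentially)
    then show "\<exists>h. approximable h \<and> L2_norm lebesgue (\<lambda>x. f x - h x) < e"
      using simple[OF F(1) Fsq] by blast
  qed
qed

subsection \<open>The Plancherel relation\<close>

text \<open>
  The closure in \<open>L\<^sup>2 \<times> L\<^sup>2\<close> of the set of Fourier pairs, which is the graph of the unitary Fourier
  transform.
\<close>

definition plancherel :: "('a::euclidean_space \<Rightarrow> complex) \<Rightarrow> ('a \<Rightarrow> complex) \<Rightarrow> bool" where
  "plancherel f g \<longleftrightarrow> f \<in> sq_integrable lebesgue \<and> g \<in> sq_integrable lebesgue \<and>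
     (\<forall>e>0. \<exists>a b. fourier_pair a b \<and>
        L2_norm lebesgue (\<lambda>x. f x - a x) < e \<and> L2_norm lebesgue (\<lambda>x. g x - b x) < e)"

lemma L2_inner_close:
  assumes f: "f \<in> sq_integrable M" "f' \<in> sq_integrable M"
      and a: "a \<in> sq_integrable M" "a' \<in> sq_integrable M"
    and e: "0 \<le> e" "e \<le> 1"
    and close: "L2_norm M (\<lambda>x. f x - a x) \<le> e" "L2_norm M (\<lambda>x. f' x - a' x) \<le> e"
  shows "cmod (L2_inner M f f' - L2_inner M a a') \<le> e * (L2_norm M f + L2_norm M f' + 1)"
proof -
  let ?d = "\<lambda>x. f x - a x" and ?d' = "\<lambda>x. f' x - a' x"
  have d: "?d \<in> sq_integrable M" "?d' \<in> sq_integrable M"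
    using f a by (auto intro: sq_integrable_diff)
  have "L2_inner M f f' - L2_inner M a a' = L2_inner M ?d f' + L2_inner M a ?d'"
    using f a by (simp add: L2_inner_diff_left L2_inner_diff_right)
  then have "cmod (L2_inner M f f' - L2_inner M a a')
      \<le> cmod (L2_inner M ?d f') + cmod (L2_inner M a ?d')"
    by (simp add: norm_triangle_ineq)
  also have "\<dots> \<le> L2_norm M ?d * L2_norm M f' + L2_norm M a * L2_norm M ?d'"
    using f a d by (intro add_mono L2_inner_bound)
  also have "\<dots> \<le> e * L2_norm M f' + (L2_norm M f + e) * e"
  proof (intro add_mono mult_mono)
    show "L2_norm M a \<le> L2_norm M f + e"
      using L2_norm_triangle_sub[OF a(1) f(1)] close(1) L2_norm_minus_commute[of M a f] by linarith
  qed (use close e in auto)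
  also have "\<dots> \<le> e * (L2_norm M f + L2_norm M f' + 1)"
    using mult_left_mono[OF e(2) e(1)] by (simp add: algebra_simps)
  finally show ?thesis .
qed

lemma plancherel_L2_inner:
  assumes p: "plancherel f g" and p': "plancherel f' g'"
  shows "L2_inner lebesgue g g' = L2_inner lebesgue f f'"
proof -
  have sq: "f \<in> sq_integrable lebesgue" "g \<in> sq_integrable lebesgue"
      "f' \<in> sq_integrable lebesgue" "g' \<in> sq_integrable lebesgue"
    using p p' by (auto simp: plancherel_def)
  define K where "K = (L2_norm lebesgue f + L2_norm lebesgue f' + 1) + (L2_norm lebesgue g
      + L2_norm lebesgue g' + 1)"
  have K: "K > 0"
    unfolding K_def by (simp add: add_nonneg_pos add_pos_nonneg)
  have bound: "cmod (L2_inner lebesgue g g' - L2_inner lebesgue f f') \<le> e * K" if e: "0 < e" "e \<le> 1"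
      for e
  proof -
    obtain a b where ab: "fourier_pair a b" "L2_norm lebesgue (\<lambda>x. f x - a x) < e"
        "L2_norm lebesgue (\<lambda>x. g x - b x) < e"
      using p e unfolding plancherel_def by blast
    obtain a' b' where ab': "fourier_pair a' b'" "L2_norm lebesgue (\<lambda>x. f' x - a' x) < e"
        "L2_norm lebesgue (\<lambda>x. g' x - b' x) < e"
      using p' e unfolding plancherel_def by blast
    note B = fourier_pair_borel[OF ab(1)] and B' = fourier_pair_borel[OF ab'(1)]
    have "L2_inner lebesgue b b' = L2_inner lebesgue a a'"
      using fourier_pair_parseval[OF ab(1) ab'(1)] B B' by (simp add: L2_inner_lebesgue)
    then have "L2_inner lebesgue g g' - L2_inner lebesgue f f'
        = (L2_inner lebesgue g g' - L2_inner lebesgue b b') -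
            (L2_inner lebesgue f f' - L2_inner lebesgue a a')"
      by simp
    then have "cmod (L2_inner lebesgue g g' - L2_inner lebesgue f f')
        \<le> cmod (L2_inner lebesgue g g' - L2_inner lebesgue b b') + cmod
            (L2_inner lebesgue f f' - L2_inner lebesgue a a')"
      by (simp only: norm_triangle_ineq4)
    also have "\<dots> \<le> e * (L2_norm lebesgue g + L2_norm lebesgue g' + 1) + e * (L2_norm lebesgue f
        + L2_norm lebesgue f' + 1)"
      using sq B B' ab ab' e by (intro add_mono L2_inner_close) auto
    also have "\<dots> = e * K"
      by (simp add: K_def algebra_simps)
    finally show ?thesis .
  qed
  show ?thesis
  proof (rule ccontr)
    assume "L2_inner lebesgue g g' \<noteq> L2_inner lebesgue f f'"
    then have d: "cmod (L2_inner lebesgue g g' - L2_inner lebesgue f f') > 0" (is "?d > 0") by simp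
    define e where "e = min 1 (?d / (2 * K))"
    have e: "0 < e" "e \<le> 1" "e \<le> ?d / (2 * K)"
      using d K by (auto simp: e_def)
    have "?d \<le> e * K" by (rule bound[OF e(1,2)])
    also have "\<dots> \<le> ?d / (2 * K) * K"
      using e(3) K by (intro mult_right_mono) auto
    also have "\<dots> = ?d / 2" using K by simp
    finally show False using d by simp
  qed
qed

lemma L2_norm_cnj: "L2_norm M (\<lambda>x. cnj (f x)) = L2_norm M f"
  by (simp add: L2_norm_def)

lemma plancherel_cnj:
  assumes p: "plancherel f g"
  shows "plancherel (\<lambda>t. cnj (g t)) (\<lambda>\<xi>. cnj (f \<xi>))"
  unfolding plancherel_def
proof (intro conjI allI impI)
  show "(\<lambda>t. cnj (g t)) \<in> sq_integrable lebesgue" "(\<lambda>t. cnj (f t)) \<in> sq_integrable lebesgue"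
    using p by (auto simp: plancherel_def sq_integrable_def)
  fix e :: real assume "e > 0"
  then obtain a b where ab: "fourier_pair a b" "L2_norm lebesgue (\<lambda>x. f x - a x) < e"
      "L2_norm lebesgue (\<lambda>x. g x - b x) < e"
    using p unfolding plancherel_def by blast
  have "L2_norm lebesgue (\<lambda>x. cnj (g x) - cnj (b x)) < e"
      "L2_norm lebesgue (\<lambda>x. cnj (f x) - cnj (a x)) < e"
    using ab(2,3) L2_norm_cnj[of lebesgue "\<lambda>x. f x - a x"] L2_norm_cnj[of lebesgue "\<lambda>x. g x - b x"]
        by simp_all
  then show "\<exists>a b. fourier_pair a b \<and> L2_norm lebesgue (\<lambda>x. cnj (g x) - a x) < e
      \<and> L2_norm lebesgue (\<lambda>x. cnj (f x) - b x) < e"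
    using fourier_pair_cnj[OF ab(1)] by blast
qed

text \<open>
  Approximate \<open>f\<close> by first components. By Parseval's identity the second components form a Cauchy
  sequence as well.
\<close>

lemma plancherel_total:
  fixes f :: "real^'n \<Rightarrow> complex"
  assumes f: "f \<in> sq_integrable lebesgue"
  shows "\<exists>g. plancherel f g"
proof -
  \<comment> \<open>The geometric rate is the one for which completeness is available.\<close>
  have "\<exists>a b. fourier_pair a b \<and> L2_norm lebesgue (\<lambda>x. f x - a x) < (1/4) ^ n" for n :: nat
    using approximable_sq_integrable[OF f] by (simp add: approximable_def)
  then obtain a b where ab: "\<And>n. fourier_pair (a n) (b n)"
      and close: "\<And>n. L2_norm lebesgue (\<lambda>x. f x - a n x) < (1/4) ^ n"
    by metis
  note B = fourier_pair_borel[OF ab]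
  have "L2_norm lebesgue (\<lambda>x. b (Suc n) x - b n x) \<le> 2 * (1/4) ^ n" for n
  proof -
    have p: "fourier_pair (\<lambda>x. a (Suc n) x - a n x) (\<lambda>x. b (Suc n) x - b n x)"
      by (rule fourier_pair_diff[OF ab ab])
    have "L2_norm lebesgue (\<lambda>x. b (Suc n) x - b n x) = L2_norm lebesgue (\<lambda>x. a (Suc n) x - a n x)"
      using fourier_pair_L2_norm[OF p] fourier_pair_borel(1,2)[OF p] by (simp add: L2_norm_lebesgue)
    also have "\<dots> \<le> L2_norm lebesgue (\<lambda>x. a (Suc n) x - f x) + L2_norm lebesgue (\<lambda>x. f x - a n x)"
      using B f by (intro L2_norm_triangle_diff)
    also have "\<dots> \<le> (1/4) ^ Suc n + (1/4) ^ n"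
      using close[of "Suc n"] close[of n] L2_norm_minus_commute[of lebesgue f "a (Suc n)"] by simp
    also have "\<dots> \<le> 2 * (1/4) ^ n" by simp
    finally show ?thesis .
  qed
  then obtain g where g: "g \<in> sq_integrable lebesgue" "(\<lambda>n. L2_norm lebesgue (\<lambda>x. g x - b n x)) \<longlonglongrightarrow> 0"
    using L2_complete[of b lebesgue 2] B(4) by blast
  have "plancherel f g"
    unfolding plancherel_def
  proof (intro conjI allI impI f g(1))
    fix e :: real assume e: "e > 0"
    have "\<forall>\<^sub>F n in sequentially. L2_norm lebesgue (\<lambda>x. g x - b n x) < e"
      by (rule order_tendstoD(2)[OF g(2) e])
    moreover have "(\<lambda>n. (1/4::real) ^ n) \<longlonglongrightarrow> 0"
      by (rule LIMSEQ_power_zero) simp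
    then have "\<forall>\<^sub>F n in sequentially. (1/4::real) ^ n < e"
      by (rule order_tendstoD) (rule e)
    ultimately have "\<forall>\<^sub>F n in sequentially. L2_norm lebesgue (\<lambda>x. g x - b n x) < e
        \<and> (1/4::real) ^ n < e"
      by (rule eventually_conj)
    then obtain n where "L2_norm lebesgue (\<lambda>x. g x - b n x) < e" "(1/4::real) ^ n < e"
      by (auto simp: eventually_sequentially)
    then show "\<exists>a b. fourier_pair a b \<and> L2_norm lebesgue (\<lambda>x. f x - a x) < e
        \<and> L2_norm lebesgue (\<lambda>x. g x - b x) < e"
      using ab[of n] close[of n] less_trans by blast
  qed
  then show ?thesis by blast
qed

lemma plancherel_surj:
  fixes g :: "real^'n \<Rightarrow> complex"
  assumes g: "g \<in> sq_integrable lebesgue"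
  shows "\<exists>f. plancherel f g"
proof -
  have "(\<lambda>x. cnj (g x)) \<in> sq_integrable lebesgue"
    using g by (auto simp: sq_integrable_def)
  then obtain h where "plancherel (\<lambda>x. cnj (g x)) h"
    using plancherel_total by blast
  from plancherel_cnj[OF this] show ?thesis by auto
qed

text \<open>
  Isometries preserve closures, so it is enough to know a covariance property for Fourier pairs.
\<close>

lemma plancherel_weighted_comp:
  assumes p: "plancherel f g"
    and w: "weight_pushes lebesgue w \<phi> lebesgue" and w': "weight_pushes lebesgue w' \<phi>' lebesgue"
    and pair: "\<And>a b. fourier_pair a b \<Longrightarrow> fourier_pair (\<lambda>t. w t * a (\<phi> t)) (\<lambda>\<xi>. w' \<xi> * b (\<phi>' \<xi>))"
  shows "plancherel (\<lambda>t. w t * f (\<phi> t)) (\<lambda>\<xi>. w' \<xi> * g (\<phi>' \<xi>))"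
  unfolding plancherel_def
proof (intro conjI allI impI)
  have f: "f \<in> sq_integrable lebesgue" and g: "g \<in> sq_integrable lebesgue"
    using p by (auto simp: plancherel_def)
  show "(\<lambda>t. w t * f (\<phi> t)) \<in> sq_integrable lebesgue"
    by (rule weighted_comp_sq_integrable[OF w f])
  show "(\<lambda>\<xi>. w' \<xi> * g (\<phi>' \<xi>)) \<in> sq_integrable lebesgue"
    by (rule weighted_comp_sq_integrable[OF w' g])
  fix e :: real assume "e > 0"
  then obtain a b where ab: "fourier_pair a b" "L2_norm lebesgue (\<lambda>x. f x - a x) < e"
      "L2_norm lebesgue (\<lambda>x. g x - b x) < e"
    using p unfolding plancherel_def by blast
  have "L2_norm lebesgue (\<lambda>t. w t * (f (\<phi> t) - a (\<phi> t))) < e"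
    using weighted_comp_L2_norm[OF w sq_integrable_diff[OF f fourier_pair_borel(3)[OF ab(1)]]] ab(2)
        by simp
  moreover have "L2_norm lebesgue (\<lambda>\<xi>. w' \<xi> * (g (\<phi>' \<xi>) - b (\<phi>' \<xi>))) < e"
    using weighted_comp_L2_norm[OF w' sq_integrable_diff[OF g fourier_pair_borel(4)[OF ab(1)]]] ab(3)
        by simp
  ultimately show "\<exists>a b. fourier_pair a b \<and> L2_norm lebesgue (\<lambda>t. w t * f (\<phi> t) - a t) < e
      \<and> L2_norm lebesgue (\<lambda>\<xi>. w' \<xi> * g (\<phi>' \<xi>) - b \<xi>) < e"
    using pair[OF ab(1)] unfolding right_diff_distrib by blast
qed

lemma weight_pushes_lebesgue_translate:
  "weight_pushes lebesgue (\<lambda>t. 1) (\<lambda>t. t - \<beta>) (lebesgue :: 'a::euclidean_space measure)"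
proof -
  have T: "(\<lambda>x. - \<beta> + (\<Sum>j\<in>Basis. (1 * (x \<bullet> j)) *\<^sub>R j)) = (\<lambda>x::'a. x - \<beta>)"
    by (simp add: euclidean_representation)
  have "(lebesgue :: 'a measure) = density (distr lebesgue lebesgue (\<lambda>x. x - \<beta>)) (\<lambda>_. ennreal (\<Prod>j\<in>(Basis::'a set). \<bar>1\<bar>))"
    using lebesgue_affine_euclidean[of "\<lambda>_. 1" "- \<beta>"] unfolding T by simp
  moreover have "(\<lambda>x. x - \<beta>) \<in> lebesgue \<rightarrow>\<^sub>M lebesgue"
    using lebesgue_affine_measurable[of "\<lambda>_. 1" "- \<beta>"] unfolding T by simp
  ultimately show ?thesis
    by (simp add: weight_pushes_def density_1)
qed

lemma weight_pushes_lebesgue_linear: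
  fixes A :: "real^'n^'n"
  assumes A: "invertible A"
  shows "weight_pushes lebesgue (\<lambda>t. of_real (sqrt \<bar>det A\<bar>)) ((*v) A) lebesgue"
proof -
  note [measurable] = lebesgue_linear_measurable[OF A]
  have "distr (density lebesgue (\<lambda>t. ennreal \<bar>det A\<bar>)) lebesgue ((*v) A)
      = density (distr lebesgue lebesgue ((*v) A)) (\<lambda>_. ennreal \<bar>det A\<bar>)"
  proof (rule measure_eqI)
    fix X assume "X \<in> sets (distr (density lebesgue (\<lambda>t. ennreal \<bar>det A\<bar>)) lebesgue ((*v) A))"
    then have X: "X \<in> sets lebesgue" by simp
    have X': "(*v) A -` X \<in> sets lebesgue"
      using measurable_sets[OF lebesgue_linear_measurable[OF A] X] by simp
    show "emeasure (distr (density lebesgue (\<lambda>t. ennreal \<bar>det A\<bar>)) lebesgue ((*v) A)) X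
      = emeasure (density (distr lebesgue lebesgue ((*v) A)) (\<lambda>_. ennreal \<bar>det A\<bar>)) X"
      using X X' by (simp add: emeasure_distr emeasure_density nn_integral_cmult del:
          emeasure_completion)
  qed simp
  then show ?thesis
    using lebesgue_linear[OF A] by (simp add: weight_pushes_def)
qed

lemma plancherel_translate:
  "plancherel f g \<Longrightarrow> plancherel (\<lambda>t. f (t - \<beta>)) (\<lambda>\<xi>. cis (- (\<xi> \<bullet> \<beta>)) * g \<xi>)"
  using plancherel_weighted_comp[OF _ weight_pushes_lebesgue_translate weight_pushes_unimodular,
      of f g "\<lambda>\<xi>. cis (- (\<xi> \<bullet> \<beta>))" \<beta>] fourier_pair_translate[of _ _ \<beta>]
  by (simp add: measurable_completion)

lemma plancherel_linear:
  fixes A A' :: "real^'n^'n"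
  assumes p: "plancherel f g" and AA': "A ** A' = mat 1"
  shows "plancherel (\<lambda>t. of_real (sqrt \<bar>det A\<bar>) * f (A *v t))
           (\<lambda>\<xi>. of_real (sqrt \<bar>det A'\<bar>) * g (transpose A' *v \<xi>))"
proof -
  have "A' ** A = mat 1"
    using AA' matrix_left_right_inverse by blast
  then have "invertible A" "invertible (transpose A')"
    using AA' by (auto simp: invertible_det_nz invertible_def) (metis invertible_def invertible_det_nz)+
  then show ?thesis
    using plancherel_weighted_comp[OF p weight_pushes_lebesgue_linear[of A]
        weight_pushes_lebesgue_linear[of "transpose A'"]]
      fourier_pair_linear[OF _ AA'] by (simp del: transpose_matrix_vector)
qed

section \<open>Powers of a dilation matrix\<close>

lemma mat_pow_0 [simp]: "mat_pow A 0 = mat 1"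
  by (simp add: mat_pow_def)

lemma mat_pow_Suc: "mat_pow A (Suc j) = A ** mat_pow A j"
  by (simp add: mat_pow_def)

lemma matrix_inv_mult:
  fixes A :: "real^'n^'n"
  assumes "invertible A"
  shows "A ** matrix_inv A = mat 1" "matrix_inv A ** A = mat 1"
  using someI_ex[OF assms[unfolded invertible_def]] unfolding matrix_inv_def by auto

lemma mat_powi_0 [simp]: "mat_powi A 0 = mat 1"
  by (simp add: mat_powi_def)

lemma mat_powi_1 [simp]: "mat_powi A 1 = A"
  by (simp add: mat_powi_def mat_pow_Suc)

lemma mat_powi_Suc:
  assumes A: "invertible A"
  shows "mat_powi A (k + 1) = A ** mat_powi A k"
proof (cases "k \<ge> 0")
  case True
  then have "nat (k + 1) = Suc (nat k)" by simp
  then show ?thesis using True by (simp add: mat_powi_def mat_pow_Suc)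
next
  case False
  then obtain n where n: "nat (- k) = Suc n" "nat (- (k + 1)) = n"
    using that[of "nat (- k - 1)"] by linarith
  have "A ** mat_powi A k = mat_pow (matrix_inv A) n"
    using False n(1) by (simp add: mat_powi_def mat_pow_Suc matrix_mul_assoc matrix_inv_mult[OF A])
  also have "\<dots> = mat_powi A (k + 1)"
  proof (cases "k + 1 = 0")
    case True
    then show ?thesis using n(2) by simp
  next
    case False2: False
    then show ?thesis using False n(2) by (simp add: mat_powi_def)
  qed
  finally show ?thesis by simp
qed

text \<open>
  Integer powers are determined by their recursion; this yields their behaviour under addition of
  exponents and under transposition.
\<close>

lemma mat_powi_unique:
  assumes A: "invertible A" and 0: "f 0 = M" and Suc: "\<And>k. f (k + 1) = A ** f k"
  shows "f k = mat_powi A k ** M"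
proof (induction k rule: int_induct[where k = 0])
  case base
  then show ?case by (simp add: 0)
next
  case (step1 i)
  then show ?case by (simp add: Suc mat_powi_Suc[OF A] matrix_mul_assoc)
next
  case (step2 i)
  have "A ** f (i - 1) = A ** (mat_powi A (i - 1) ** M)"
    using Suc[of "i - 1"] mat_powi_Suc[OF A, of "i - 1"] step2 by (simp add: matrix_mul_assoc)
  then have "matrix_inv A ** (A ** f (i - 1)) = matrix_inv A ** (A ** (mat_powi A (i - 1) ** M))"
    by simp
  then show ?case
    by (simp add: matrix_mul_assoc matrix_inv_mult[OF A])
qed

lemma mat_powi_add:
  assumes A: "invertible A"
  shows "mat_powi A (j + k) = mat_powi A j ** mat_powi A k"
proof (rule mat_powi_unique[OF A, where f = "\<lambda>j. mat_powi A (j + k)"])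
  show "mat_powi A (j + 1 + k) = A ** mat_powi A (j + k)" for j
    using mat_powi_Suc[OF A, of "j + k"] by (simp add: algebra_simps)
qed simp

lemma mat_powi_inverse:
  assumes "invertible A"
  shows "mat_powi A k ** mat_powi A (- k) = mat 1"
  using mat_powi_add[OF assms, of k "- k"] by simp

lemma invertible_mat_powi: "invertible A \<Longrightarrow> invertible (mat_powi A k)"
  using mat_powi_inverse[of A k] mat_powi_inverse[of A "- k"] by (auto simp: invertible_def)

lemma transpose_mat_powi:
  assumes A: "invertible A"
  shows "transpose (mat_powi A k) = mat_powi (transpose A) k"
proof -
  have At: "invertible (transpose A)"
    using A by (simp add: invertible_det_nz)
  have "transpose (mat_powi A k) = mat_powi (transpose A) k ** mat 1"
  proof (rule mat_powi_unique[OF At, where f = "\<lambda>k. transpose (mat_powi A k)"])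
    show "transpose (mat_powi A (k + 1)) = transpose A ** transpose (mat_powi A k)" for k
      by (simp add: mat_powi_add[OF A, of k 1] matrix_transpose_mul)
  qed simp
  then show ?thesis by simp
qed

lemma mat_powi_mult_vec:
  "invertible A \<Longrightarrow> mat_powi A j *v (mat_powi A k *v v) = mat_powi A (j + k) *v v"
  by (simp add: mat_powi_add matrix_vector_mul_assoc)

lemma det_map_matrix_of_int:
  "det (map_matrix of_int A :: 'a::comm_ring_1^'n^'n) = of_int (det (A :: int^'n^'n))"
  by (simp add: det_def map_matrix_def)

lemma dilation_det: "dilation_matrix A \<Longrightarrow> det A \<noteq> 0"
  by (simp add: dilation_matrix_def invertible_det_nz det_map_matrix_of_int)

lemma dilation_invertible: "dilation_matrix A \<Longrightarrow> invertible (real_mat A)"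
  by (simp add: invertible_det_nz real_mat_def det_map_matrix_of_int dilation_det)

subsection \<open>Decay of inverse powers\<close>

text \<open>
  The vector \<open>p(M) y\<close>, evaluated by Horner's scheme.
\<close>

definition poly_apply :: "complex^'n^'n \<Rightarrow> complex poly \<Rightarrow> complex^'n \<Rightarrow> complex^'n" where
  "poly_apply M p y = fold_coeffs (\<lambda>a v. a *s y + M *v v) p 0"

lemma poly_apply_0 [simp]: "poly_apply M 0 y = 0"
  by (simp add: poly_apply_def)

lemma poly_apply_pCons: "poly_apply M (pCons a p) y = a *s y + M *v poly_apply M p y"
proof (cases "a = 0 \<and> p = 0")
  case False
  then have "p \<noteq> 0 \<or> a \<noteq> 0" by auto
  then show ?thesis
    by (auto simp: poly_apply_def fold_coeffs_pCons_not_0_0_eq fold_coeffs_pCons_coeff_not_0_eq)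
qed (simp add: poly_apply_def matrix_vector_mult_0_right)

lemma poly_apply_add: "poly_apply M (p + q) y = poly_apply M p y + poly_apply M q y"
  by (induction p q rule: poly_induct2)
     (simp_all add: poly_apply_pCons vec.add matrix_vector_right_distrib vector_sadd_rdistrib
         algebra_simps)

lemma poly_apply_smult: "poly_apply M (smult c p) y = c *s poly_apply M p y"
  by (induction p) (simp_all add: poly_apply_pCons vector_add_ldistrib vector_scalar_commute)

lemma poly_apply_linear_factor:
  "poly_apply M ([:- z, 1:] * q) y = M *v poly_apply M q y - z *s poly_apply M q y"
proof -
  have "[:- z, 1:] * q = smult (- z) q + pCons 0 q"
    by simp
  then show ?thesis
    by (simp only: poly_apply_add poly_apply_smult poly_apply_pCons) (simp add: vector_smult_lneg)
qed

lemma poly_apply_commute: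
  "poly_apply M q (M *v y - z *s y) = M *v poly_apply M q y - z *s poly_apply M q y"
proof (induction q)
  case (pCons a q)
  have "a *s (M *v y - z *s y) = M *v (a *s y) - z *s (a *s y)"
    by (simp add: vector_ssub_ldistrib vector_scalar_commute vector_smult_assoc mult.commute)
  then show ?case
    by (simp add: poly_apply_pCons pCons vector_add_ldistrib vector_scalar_commute
        matrix_vector_right_distrib matrix_vector_mult_diff_distrib)
qed simp

text \<open>
  Past the point where \<open>\<bar>u\<bar> < c\<close>, the bound \<open>\<bar>z\<bar>\<^sup>m \<bar>y\<bar> + c / (1 - \<bar>z\<bar>)\<close> reproduces itself under the recurrence.
\<close>

lemma tendsto_zero_recurrence:
  fixes y u :: "nat \<Rightarrow> complex"
  assumes rec: "\<And>l. y (Suc l) = z * y l + u l" and z: "cmod z < 1" and u: "u \<longlonglongrightarrow> 0"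
  shows "y \<longlonglongrightarrow> 0"
proof (rule LIMSEQ_I)
  fix e :: real assume e: "e > 0"
  define r where "r = cmod z"
  have r: "0 \<le> r" "r < 1" using z by (auto simp: r_def)
  \<comment> \<open>With this bound on \<open>u\<close>, the limiting bound \<open>c / (1 - r)\<close> is \<open>e / 2\<close>.\<close>
  define c where "c = e * (1 - r) / 2"
  have c: "c > 0" using e r by (simp add: c_def)
  obtain L where L: "\<And>l. l \<ge> L \<Longrightarrow> cmod (u l) < c"
    using LIMSEQ_D[OF u c] by auto
  have bd: "cmod (y (L + m)) \<le> r ^ m * cmod (y L) + e / 2" for m
  proof (induction m)
    case 0
    then show ?case using e by simp
  next
    case (Suc m)
    have "cmod (y (L + Suc m)) \<le> r * cmod (y (L + m)) + cmod (u (L + m))"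
      using norm_triangle_ineq[of "z * y (L + m)" "u (L + m)"] by (simp add: rec r_def norm_mult)
    also have "\<dots> \<le> r * (r ^ m * cmod (y L) + e / 2) + c"
      using Suc L[of "L + m"] r by (intro add_mono mult_left_mono) auto
    also have "\<dots> = r ^ Suc m * cmod (y L) + e / 2"
      by (simp add: c_def field_simps)
    finally show ?case .
  qed
  have "(\<lambda>m. r ^ m * cmod (y L)) \<longlonglongrightarrow> 0 * cmod (y L)"
    using r by (intro tendsto_intros LIMSEQ_power_zero) auto
  then obtain K where K: "\<And>m. m \<ge> K \<Longrightarrow> \<bar>r ^ m * cmod (y L)\<bar> < e / 2"
    using LIMSEQ_D[of "\<lambda>m. r ^ m * cmod (y L)" 0 "e / 2"] e by auto
  show "\<exists>no. \<forall>n\<ge>no. norm (y n - 0) < e"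
  proof (intro exI allI impI)
    fix n assume "n \<ge> L + K"
    then obtain m where m: "n = L + m" "m \<ge> K"
      using le_Suc_ex[of "L + K" n] by (auto simp: add.assoc)
    have "r ^ m * cmod (y L) < e / 2"
      using K[OF m(2)] abs_less_iff by blast
    then show "norm (y n - 0) < e"
      using bd[of m] by (simp add: m(1))
  qed
qed

text \<open>
  Induction on the degree of the annihilating polynomial \<open>p = (X - z) q\<close>. If \<open>q(M) y = 0\<close>, then \<open>q\<close> has smaller
  degree. Otherwise \<open>q(M) y\<close> is an eigenvector for \<open>z\<close>, so \<open>\<bar>z\<bar> < 1\<close>. The vector \<open>y' = M y - z y\<close> is annihilated by
  \<open>q\<close>, so its iterates tend to \<open>0\<close>, and \<open>M\<^sup>l\<^sup>+\<^sup>1 y = z M\<^sup>l y + M\<^sup>l y'\<close>.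
\<close>

lemma powers_tendsto_zero_of_annihilator:
  fixes M :: "complex^'n^'n"
  assumes ev: "\<And>z v. \<lbrakk>v \<noteq> 0; M *v v = z *s v\<rbrakk> \<Longrightarrow> cmod z < 1"
    and "p \<noteq> 0" and "poly_apply M p y = 0"
  shows "(\<lambda>l. ((*v) M ^^ l) y) \<longlonglongrightarrow> 0"
  using assms(2,3)
proof (induction "degree p" arbitrary: p y rule: less_induct)
  case (less p y)
  show ?case
  proof (cases "degree p = 0")
    case True
    then obtain a where p: "p = [:a:]" using degree_eq_zeroE by blast
    then have "a \<noteq> 0" using less.prems by simp
    then have "y = 0"
      using less.prems(2) p by (simp add: poly_apply_pCons matrix_vector_mult_0_right)
    then have "((*v) M ^^ l) y = 0" for l
      by (induction l) (simp_all add: matrix_vector_mult_0_right)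
    then show ?thesis by simp
  next
    case False
    then have "\<not> (\<exists>a l. a \<noteq> 0 \<and> l = 0 \<and> p = pCons a l)"
      by auto
    then obtain z where "poly p z = 0"
      using fundamental_theorem_of_algebra_alt by blast
    then obtain q where p: "p = [:- z, 1:] * q"
      by (metis dvdE poly_eq_0_iff_dvd)
    then have q: "q \<noteq> 0" using less.prems(1) by auto
    then have deg: "degree q < degree p"
      unfolding p by (subst degree_mult_eq) auto
    have kill: "M *v poly_apply M q y - z *s poly_apply M q y = 0"
      using less.prems(2) unfolding p poly_apply_linear_factor .
    show ?thesis
    proof (cases "poly_apply M q y = 0")
      case True
      then show ?thesis using less.hyps[OF deg q] by blast
    next
      case False
      then have z: "cmod z < 1"
        using ev[OF False, of z] kill by simp
      define y' where "y' = M *v y - z *s y"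
      have "poly_apply M q y' = 0"
        unfolding y'_def poly_apply_commute by (rule kill)
      then have lim: "(\<lambda>l. ((*v) M ^^ l) y') \<longlonglongrightarrow> 0"
        using less.hyps[OF deg q] by blast
      have rec: "((*v) M ^^ Suc l) y = z *s ((*v) M ^^ l) y + ((*v) M ^^ l) y'" for l
      proof (induction l)
        case 0
        then show ?case by (simp add: y'_def)
      next
        case (Suc l)
        have "((*v) M ^^ Suc (Suc l)) y = M *v (z *s ((*v) M ^^ l) y + ((*v) M ^^ l) y')"
          using Suc by simp
        then show ?case by (simp add: matrix_vector_right_distrib vector_scalar_commute)
      qed
      show ?thesis
      proof (rule vec_tendstoI)
        fix i
        have u: "(\<lambda>l. ((*v) M ^^ l) y' $ i) \<longlonglongrightarrow> 0"
          using tendsto_vec_nth[OF lim, of i] by simp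
        have "(\<lambda>l. ((*v) M ^^ l) y $ i) \<longlonglongrightarrow> 0"
        proof (rule tendsto_zero_recurrence[OF _ z u])
          show "((*v) M ^^ Suc l) y $ i = z * ((*v) M ^^ l) y $ i + ((*v) M ^^ l) y' $ i" for l
            unfolding rec by simp
        qed
        then show "(\<lambda>l. ((*v) M ^^ l) y $ i) \<longlonglongrightarrow> 0 $ i" by simp
      qed
    qed
  qed
qed

text \<open>
  The first \<open>d + 1\<close> iterates of \<open>y\<close> are linearly dependent, where \<open>d\<close> is the real dimension, or two of
  them coincide.
\<close>

lemma annihilator_exists:
  fixes M :: "complex^'n^'n"
  shows "\<exists>p. p \<noteq> 0 \<and> poly_apply M p y = 0"
proof -
  let ?v = "\<lambda>i. ((*v) M ^^ i) y"
  have mon: "poly_apply M (monom c i) y = c *s ?v i" for c i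
  proof (induction i)
    case (Suc i)
    then show ?case by (simp add: monom_Suc poly_apply_pCons vector_scalar_commute)
  qed (simp add: monom_0 poly_apply_pCons matrix_vector_mult_0_right)
  show ?thesis
  proof (cases "inj_on ?v {..DIM(complex^'n)}")
    case False
    then obtain i j where ij: "i \<noteq> j" "?v i = ?v j"
      unfolding inj_on_def by blast
    have "poly_apply M (monom 1 i + monom (-1) j) y = 0"
      using ij(2) by (simp add: poly_apply_add mon)
    moreover have "coeff (monom 1 i + monom (-1) j :: complex poly) i = 1"
      using ij(1) by simp
    then have "monom 1 i + monom (-1) j \<noteq> (0 :: complex poly)"
      by (metis coeff_0 zero_neq_one)
    ultimately show ?thesis by blast
  next
    case True
    then have "card (?v ` {..DIM(complex^'n)}) > DIM(complex^'n)"
      by (simp add: card_image)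
    then have "dependent (?v ` {..DIM(complex^'n)})"
      using dependent_biggerset by blast
    then obtain c where c: "(\<Sum>v\<in>?v ` {..DIM(complex^'n)}. c v *\<^sub>R v) = 0"
        "\<exists>v\<in>?v ` {..DIM(complex^'n)}. c v \<noteq> 0"
      using dependent_finite[of "?v ` {..DIM(complex^'n)}"] by auto
    define p where "p = (\<Sum>i\<le>DIM(complex^'n). monom (complex_of_real (c (?v i))) i)"
    have poly_apply_sum: "poly_apply M (sum f I) y = (\<Sum>i\<in>I. poly_apply M (f i) y)" if "finite I"
        for f and I :: "nat set"
      using that by induction (simp_all add: poly_apply_add)
    have "poly_apply M p y = (\<Sum>i\<le>DIM(complex^'n). c (?v i) *\<^sub>R ?v i)"
      unfolding p_def poly_apply_sum[OF finite_atMost] mon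
      by (intro sum.cong) (auto simp: vec_eq_iff scaleR_conv_of_real[where 'a = complex])
    also have "\<dots> = 0"
      using c(1) sum.reindex[OF True, of "\<lambda>v. c v *\<^sub>R v"] by simp
    finally have "poly_apply M p y = 0" .
    moreover obtain i where i: "i \<le> DIM(complex^'n)" "c (?v i) \<noteq> 0"
      using c(2) by auto
    have "coeff p i = complex_of_real (c (?v i))"
      using i(1) by (simp add: p_def coeff_sum sum.delta)
    then have "p \<noteq> 0" using i(2) by auto
    ultimately show ?thesis by blast
  qed
qed

text \<open>
  The eigenvalues of \<open>A\<^sup>-\<^sup>1\<close> are the inverses of those of \<open>A\<close>, hence of modulus less than \<open>1\<close>. Eigenvectors may
  be complex, so the iteration takes place in \<open>\<complex>\<^sup>n\<close>.
\<close>

lemma dilation_inverse_powers_tendsto: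
  fixes A :: "int^'n^'n"
  assumes A: "dilation_matrix A"
  shows "(\<lambda>l. mat_powi (real_mat A) (- int l) *v v) \<longlonglongrightarrow> 0"
proof -
  let ?R = "real_mat A"
  define Ac :: "complex^'n^'n" where "Ac = map_matrix of_int A"
  define C where "C = matrix_inv ?R"
  have inv: "?R ** C = mat 1" "C ** ?R = mat 1"
    unfolding C_def by (rule matrix_inv_mult[OF dilation_invertible[OF A]])+
  have "invertible Ac"
    using dilation_det[OF A] by (simp add: Ac_def invertible_det_nz det_map_matrix_of_int)
  then obtain Cc where Cc: "Ac ** Cc = mat 1" "Cc ** Ac = mat 1"
    unfolding invertible_def by blast
  have ev: "cmod z < 1" if v: "v \<noteq> 0" "Cc *v v = z *s v" for z v
  proof -
    have "v = Ac *v (Cc *v v)"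
      by (simp add: matrix_vector_mul_assoc Cc)
    then have v': "v = z *s (Ac *v v)"
      using v(2) by (simp add: vector_scalar_commute)
    then have z: "z \<noteq> 0" using v(1) by auto
    have "inverse z *s v = inverse z *s (z *s (Ac *v v))"
      using v' by simp
    then have "Ac *v v = inverse z *s v"
      using z by (simp add: vector_smult_assoc)
    then have "1 < cmod (inverse z)"
      using A v(1) unfolding dilation_matrix_def Ac_def by blast
    then show ?thesis
      using z by (simp add: norm_inverse one_less_inverse_iff)
  qed
  define cv where "cv v = (\<chi> i. complex_of_real (v $ i))" for v :: "real^'n"
  have "Ac *v cv v = cv (?R *v v)" for v
    by (simp add: Ac_def cv_def real_mat_def matrix_vector_mult_def map_matrix_def vec_eq_iff)
  then have "Ac *v cv (C *v v) = cv v" for v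
    by (simp add: matrix_vector_mul_assoc inv)
  then have step: "cv (C *v v) = Cc *v cv v" for v
    by (metis Cc(2) matrix_vector_mul_assoc matrix_vector_mul_lid)
  have pw: "mat_powi ?R (- int l) = mat_pow C l" for l
    by (cases "l = 0") (simp_all add: mat_powi_def C_def)
  have cpw: "cv (mat_powi ?R (- int l) *v v) = ((*v) Cc ^^ l) (cv v)" for l
    unfolding pw
    by (induction l) (simp_all add: mat_pow_Suc matrix_vector_mul_assoc[symmetric] step)
  obtain p where p: "p \<noteq> 0" "poly_apply Cc p (cv v) = 0"
    using annihilator_exists by blast
  have lim: "(\<lambda>l. cv (mat_powi ?R (- int l) *v v)) \<longlonglongrightarrow> 0"
    unfolding cpw by (rule powers_tendsto_zero_of_annihilator[OF ev p])
  show ?thesis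
  proof (rule vec_tendstoI)
    fix i
    have "(\<lambda>l. Re (cv (mat_powi ?R (- int l) *v v) $ i)) \<longlonglongrightarrow> Re ((0 :: complex^'n) $ i)"
      by (intro tendsto_Re tendsto_vec_nth lim)
    then show "(\<lambda>l. (mat_powi ?R (- int l) *v v) $ i) \<longlonglongrightarrow> 0 $ i"
      by (simp add: cv_def)
  qed
qed

section \<open>The semidirect product and its characters\<close>

lemma int_lattice_add: "v \<in> int_lattice \<Longrightarrow> w \<in> int_lattice \<Longrightarrow> v + w \<in> int_lattice"
  by (simp add: int_lattice_def)

lemma int_lattice_minus: "v \<in> int_lattice \<Longrightarrow> - v \<in> int_lattice"
  by (simp add: int_lattice_def)

lemma int_lattice_mult: "v \<in> int_lattice \<Longrightarrow> real_mat A *v v \<in> int_lattice"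
  by (auto simp: int_lattice_def real_mat_def matrix_vector_mult_def map_matrix_def intro!: Ints_sum
      Ints_mult)

lemma int_lattice_pow: "v \<in> int_lattice \<Longrightarrow> mat_powi (real_mat A) (int j) *v v \<in> int_lattice"
proof (induction j)
  case (Suc j)
  have "mat_powi (real_mat A) (int (Suc j)) *v v = real_mat A *v (mat_powi (real_mat A) (int j) *v v)"
    by (simp add: mat_powi_def nat_add_distrib mat_pow_Suc matrix_vector_mul_assoc[symmetric])
  then show ?case using Suc by (simp add: int_lattice_mult)
qed simp

lemma QA_I: "v \<in> int_lattice \<Longrightarrow> mat_powi (real_mat A) (- int j) *v v \<in> QA A"
  unfolding QA_def by blast

lemma QA_powi:
  assumes A: "dilation_matrix A" and b: "\<beta> \<in> QA A"
  shows "mat_powi (real_mat A) k *v \<beta> \<in> QA A"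
proof -
  note inv = dilation_invertible[OF A]
  obtain j v where v: "v \<in> int_lattice" "\<beta> = mat_powi (real_mat A) (- int j) *v v"
    using b unfolding QA_def by blast
  have "mat_powi (real_mat A) k *v \<beta>
      = mat_powi (real_mat A) (- int (nat \<bar>k\<bar> + j)) *v (mat_powi (real_mat A) (int (nat (k + \<bar>k\<bar>))) *v
          v)"
    by (simp add: v(2) mat_powi_mult_vec[OF inv]) (simp add: abs_if)
  then show ?thesis
    using QA_I[OF int_lattice_pow[OF v(1)]] by metis
qed

lemma QA_add:
  assumes A: "dilation_matrix A" and b: "\<beta> \<in> QA A" and c: "\<gamma> \<in> QA A"
  shows "\<beta> + \<gamma> \<in> QA A"
proof -
  note inv = dilation_invertible[OF A]
  obtain j v where v: "v \<in> int_lattice" "\<beta> = mat_powi (real_mat A) (- int j) *v v"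
    using b unfolding QA_def by blast
  obtain i w where w: "w \<in> int_lattice" "\<gamma> = mat_powi (real_mat A) (- int i) *v w"
    using c unfolding QA_def by blast
  have "\<beta> + \<gamma> = mat_powi (real_mat A) (- int (i + j)) *v
      (mat_powi (real_mat A) (int i) *v v + mat_powi (real_mat A) (int j) *v w)"
    by (simp add: v(2) w(2) matrix_vector_right_distrib mat_powi_mult_vec[OF inv])
  then show ?thesis
    using QA_I[OF int_lattice_add[OF int_lattice_pow[OF v(1)] int_lattice_pow[OF w(1)]]] by metis
qed

lemma QA_minus:
  assumes b: "\<beta> \<in> QA A"
  shows "- \<beta> \<in> QA A"
proof -
  obtain j v where v: "v \<in> int_lattice" "\<beta> = mat_powi (real_mat A) (- int j) *v v"
    using b unfolding QA_def by blast
  have "- \<beta> = mat_powi (real_mat A) (- int j) *v (- v)"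
    by (simp add: v(2) vec.neg)
  then show ?thesis using QA_I[OF int_lattice_minus[OF v(1)]] by simp
qed

lemma QA_zero: "0 \<in> QA A"
  using QA_I[of 0 A 0] by (simp add: int_lattice_def)

lemma QA_axis: "mat_powi (real_mat A) (- int l) *v axis i 1 \<in> QA A"
  by (rule QA_I) (simp add: int_lattice_def axis_def)

lemma theta_simps:
  assumes A: "dilation_matrix A"
  shows "theta A 0 \<beta> = \<beta>" "theta A m (\<beta> + \<gamma>) = theta A m \<beta> + theta A m \<gamma>"
    "theta A m (- \<beta>) = - theta A m \<beta>"
    "theta A m (theta A m' \<beta>) = theta A (m + m') \<beta>"
  using mat_powi_mult_vec[OF dilation_invertible[OF A], of "- m" "- m'"]
  by (simp_all add: theta_def matrix_vector_right_distrib vec.neg)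

lemma theta_QA: "dilation_matrix A \<Longrightarrow> \<beta> \<in> QA A \<Longrightarrow> theta A m \<beta> \<in> QA A"
  by (simp add: theta_def QA_powi)

lemma QA_group_simps [simp]:
  "carrier (QA_group A) = QA A \<times> UNIV"
  "(\<beta>, m) \<otimes>\<^bsub>QA_group A\<^esub> (\<gamma>, m') = (\<beta> + theta A m \<gamma>, m + m')"
  "\<one>\<^bsub>QA_group A\<^esub> = (0, 0)"
  by (simp_all add: QA_group_def)

lemma group_QA_group:
  assumes A: "dilation_matrix A"
  shows "group (QA_group A)"
proof (rule groupI)
  fix g assume "g \<in> carrier (QA_group A)"
  then obtain \<beta> m where g: "g = (\<beta>, m)" "\<beta> \<in> QA A" by auto
  have "(- theta A (- m) \<beta>, - m) \<in> carrier (QA_group A)"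
    using g by (simp add: QA_minus theta_QA[OF A])
  moreover have "(- theta A (- m) \<beta>, - m) \<otimes>\<^bsub>QA_group A\<^esub> g = \<one>\<^bsub>QA_group A\<^esub>"
    by (simp add: g)
  ultimately show "\<exists>h\<in>carrier (QA_group A). h \<otimes>\<^bsub>QA_group A\<^esub> g = \<one>\<^bsub>QA_group A\<^esub>" by blast
qed (auto simp: QA_add[OF A] theta_QA[OF A] theta_simps[OF A] QA_zero add.assoc)

lemma QA_group_int_pow:
  assumes A: "dilation_matrix A"
  shows "(0, 1) [^]\<^bsub>QA_group A\<^esub> (m::int) = (0, m)"
proof -
  interpret group "QA_group A" by (rule group_QA_group[OF A])
  have c: "(0, 1) \<in> carrier (QA_group A)" by (simp add: QA_zero)
  have th0: "theta A m 0 = 0" for m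
    by (simp add: theta_def)
  show ?thesis
  proof (induction m rule: int_induct[where k = 0])
    case base
    then show ?case by simp
  next
    case (step1 i)
    then show ?case
      using int_pow_mult[OF c, of i 1] by (simp add: int_pow_1[OF c] th0)
  next
    case (step2 i)
    have "inv\<^bsub>QA_group A\<^esub> (0, 1) = (0, - 1)"
      by (rule inv_equality) (simp_all add: th0 QA_zero)
    then have "(0, 1) [^]\<^bsub>QA_group A\<^esub> (- 1 :: int) = (0, - 1)"
      using int_pow_neg[OF c, of 1] by (simp add: int_pow_1[OF c])
    then show ?case
      using step2 int_pow_mult[OF c, of i "- 1"] by (simp add: th0)
  qed
qed

lemma subgroup_QA_normal:
  assumes A: "dilation_matrix A"
  shows "subgroup (QA_normal A) (QA_group A)"
proof -
  interpret group "QA_group A" by (rule group_QA_group[OF A])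
  show ?thesis
  proof (rule subgroupI)
    show "QA_normal A \<noteq> {}" using QA_zero by (auto simp: QA_normal_def)
    fix g assume "g \<in> QA_normal A"
    then obtain \<beta> where g: "g = (\<beta>, 0)" "\<beta> \<in> QA A" by (auto simp: QA_normal_def)
    have "inv\<^bsub>QA_group A\<^esub> g = (- \<beta>, 0)"
      by (rule inv_equality) (simp_all add: g QA_minus theta_simps[OF A])
    then show "inv\<^bsub>QA_group A\<^esub> g \<in> QA_normal A" using g by (simp add: QA_normal_def QA_minus)
  qed (auto simp: QA_normal_def QA_add[OF A] theta_simps[OF A])
qed

lemma normal_QA_normal:
  assumes A: "dilation_matrix A"
  shows "normal (QA_normal A) (QA_group A)"
proof -
  interpret group "QA_group A" by (rule group_QA_group[OF A])
  show ?thesis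
  proof (rule normal_invI[OF subgroup_QA_normal[OF A]])
    fix x h assume x: "x \<in> carrier (QA_group A)" and h: "h \<in> QA_normal A"
    obtain \<beta> m where x': "x = (\<beta>, m)" by (cases x)
    obtain \<gamma> where h': "h = (\<gamma>, 0)" using h by (auto simp: QA_normal_def)
    obtain \<delta> l where i: "inv\<^bsub>QA_group A\<^esub> x = (\<delta>, l)" by (cases "inv\<^bsub>QA_group A\<^esub> x")
    have "(\<beta>, m) \<otimes>\<^bsub>QA_group A\<^esub> (\<delta>, l) = \<one>\<^bsub>QA_group A\<^esub>"
      using r_inv[OF x] unfolding i unfolding x' .
    then have l: "m + l = 0" by simp
    have "h \<in> carrier (QA_group A)" using h by (auto simp: QA_normal_def)
    then have "x \<otimes>\<^bsub>QA_group A\<^esub> h \<otimes>\<^bsub>QA_group A\<^esub> inv\<^bsub>QA_group A\<^esub> x \<in> carrier (QA_group A)"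
      using x by (intro m_closed inv_closed)
    moreover have "snd (x \<otimes>\<^bsub>QA_group A\<^esub> h \<otimes>\<^bsub>QA_group A\<^esub> inv\<^bsub>QA_group A\<^esub> x) = 0"
      using l unfolding i unfolding x' h' by simp
    ultimately show "x \<otimes>\<^bsub>QA_group A\<^esub> h \<otimes>\<^bsub>QA_group A\<^esub> inv\<^bsub>QA_group A\<^esub> x \<in> QA_normal A"
      by (simp add: QA_normal_def mem_Times_iff)
  qed
qed

lemma comm_group_QA_normal:
  assumes A: "dilation_matrix A"
  shows "comm_group ((QA_group A)\<lparr>carrier := QA_normal A\<rparr>)"
proof (rule group.group_comm_groupI)
  show "group ((QA_group A)\<lparr>carrier := QA_normal A\<rparr>)"
    by (rule subgroup.subgroup_is_group[OF subgroup_QA_normal[OF A] group_QA_group[OF A]])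
qed (auto simp: QA_normal_def theta_simps[OF A] add.commute)

text \<open>
  The numbers \<open>y \<bullet> A\<^sup>-\<^sup>l e\<^sub>i\<close> lie in \<open>2 \<pi> \<int>\<close> and tend to \<open>0\<close>, so they vanish for large \<open>l\<close>. For one such \<open>l\<close> the
  vectors \<open>A\<^sup>-\<^sup>l e\<^sub>i\<close> form a basis.
\<close>

lemma characters_separate:
  fixes A :: "int^'n^'n"
  assumes A: "dilation_matrix A" and triv: "\<And>\<beta>. \<beta> \<in> QA A \<Longrightarrow> cis (y \<bullet> \<beta>) = 1"
  shows "y = 0"
proof -
  let ?e = "\<lambda>l i. mat_powi (real_mat A) (- int l) *v axis i 1"
  have ev: "\<forall>\<^sub>F l in sequentially. y \<bullet> ?e l i = 0" for i
  proof -
    have "(\<lambda>l. y \<bullet> ?e l i) \<longlonglongrightarrow> y \<bullet> 0"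
      by (intro tendsto_intros dilation_inverse_powers_tendsto[OF A])
    then have "\<forall>\<^sub>F l in sequentially. \<bar>y \<bullet> ?e l i\<bar> < pi"
      using tendstoD[of "\<lambda>l. y \<bullet> ?e l i" 0 sequentially pi] by simp
    then show ?thesis
    proof eventually_elim
      case (elim l)
      have "cis (y \<bullet> ?e l i) = 1"
        by (rule triv[OF QA_axis])
      then have c: "cos (y \<bullet> ?e l i) = 1"
        by (metis cis.simps(1) one_complex.simps(1))
      then obtain n :: int where n: "y \<bullet> ?e l i = of_int n * 2 * pi"
        using cos_one_2pi_int by blast
      then have "\<bar>of_int n * 2 :: real\<bar> < 1"
        using elim by (simp add: abs_mult)
      then have "n = 0" by linarith
      then show ?case using n by simp
    qed
  qed
  then have "\<forall>\<^sub>F l in sequentially. \<forall>i. y \<bullet> ?e l i = 0"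
    by (simp add: eventually_all_finite)
  then obtain l where l: "\<And>i. y \<bullet> ?e l i = 0"
    by (auto simp: eventually_sequentially)
  let ?M = "mat_powi (real_mat A) (- int l)"
  have "transpose ?M *v y = 0"
  proof (simp only: vec_eq_iff, intro allI)
    fix i
    have "(transpose ?M *v y) $ i = (transpose ?M *v y) \<bullet> axis i 1"
      by (simp add: inner_axis)
    also have "\<dots> = 0"
      by (simp only: dot_transpose l)
    finally show "(transpose ?M *v y) $ i = 0 $ i" by simp
  qed
  moreover have "invertible (transpose ?M)"
    using invertible_mat_powi[OF dilation_invertible[OF A], of "- int l"]
        by (simp add: invertible_det_nz)
  ultimately show "y = 0"
    by (metis invertible_def matrix_vector_mul_assoc matrix_vector_mul_lid matrix_vector_mult_0_right)
qed

section \<open>The representations on sequences\<close>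

lemma summable_on_iff_integrable:
  fixes f :: "'a \<Rightarrow> real"
  assumes "\<And>x. f x \<ge> 0"
  shows "f summable_on A \<longleftrightarrow> integrable (count_space A) f"
  using summable_on_iff_abs_summable_on_real[of f A] abs_summable_equivalent[of f A] assms
  by (simp add: Infinite_Set_Sum.abs_summable_on_def)

text \<open>
  With respect to the counting measure \<open>l\<^sup>2(\<int>)\<close> is an instance of the \<open>L\<^sup>2\<close> spaces above, up to the passage
  to classes: null sets are empty.
\<close>

lemma l2_carrier: "carrier l2_int = sq_integrable (count_space UNIV)"
  by (auto simp: l2_int_def sq_integrable_def summable_on_iff_integrable)

lemma l2_ops [simp]:
  "vadd l2_int g h = (\<lambda>k. g k + h k)" "vscale l2_int c g = (\<lambda>k. c * g k)" "vzero l2_int = (\<lambda>k. 0)"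
  by (simp_all add: l2_int_def)

lemma l2_cinner:
  assumes "g \<in> carrier l2_int" "h \<in> carrier l2_int"
  shows "cinner l2_int g h = L2_inner (count_space UNIV) g h"
proof -
  have "integrable (count_space UNIV) (\<lambda>k. g k * cnj (h k))"
    using assms by (intro integrable_L2_inner) (simp_all add: l2_carrier)
  then have "Infinite_Set_Sum.abs_summable_on (\<lambda>k. g k * cnj (h k)) UNIV"
    by (simp add: Infinite_Set_Sum.abs_summable_on_def)
  from infsetsum_infsum[OF this] show ?thesis
    by (simp add: l2_int_def L2_inner_def infsetsum_def)
qed

lemma l2_vnorm:
  assumes "g \<in> carrier l2_int"
  shows "vnorm l2_int g = L2_norm (count_space UNIV) g"
proof -
  have "vnorm l2_int g = sqrt ((L2_norm (count_space UNIV) g)\<^sup>2)"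
    by (simp only: vnorm_def l2_cinner[OF assms assms] L2_inner_self Re_complex_of_real)
  then show ?thesis by simp
qed

lemma closed_ops_l2: "closed_ops l2_int"
  by (simp add: closed_ops_def l2_carrier sq_integrable_add sq_integrable_scale)

lemma weight_pushes_shift:
  assumes "\<And>k. cmod (w k) = 1"
  shows "weight_pushes (count_space UNIV) w (\<lambda>k. k - m) (count_space (UNIV :: int set))"
proof -
  have "bij_betw (\<lambda>k. k - m) UNIV (UNIV :: int set)"
    by (rule bij_betw_byWitness[where f' = "\<lambda>k. k + m"]) auto
  then show ?thesis
    using assms by (simp add: weight_pushes_def density_1 distr_bij_count_space)
qed

text \<open>
  The character of \<open>\<rat>\<^sub>A\<close> by which it acts on the coordinate \<open>k\<close>.
\<close>

definition phase :: "int^'n^'n \<Rightarrow> real^'n \<Rightarrow> real^'n \<Rightarrow> int \<Rightarrow> complex" where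
  "phase A x \<beta> k = cis (- (x \<bullet> (mat_powi (real_mat A) k *v \<beta>)))"

lemma phase_norm [simp]: "cmod (phase A x \<beta> k) = 1"
  by (simp add: phase_def)

lemma W_tilde_eq:
  "g \<in> carrier l2_int \<Longrightarrow> W_tilde A x (\<beta>, m) g = (\<lambda>k. phase A x \<beta> k * g (k - m))"
  by (simp add: W_tilde_def phase_def cis_conv_exp)

lemma W_tilde_in:
  "g \<in> carrier l2_int \<Longrightarrow> W_tilde A x (\<beta>, m) g \<in> carrier l2_int"
  using weighted_comp_sq_integrable[OF weight_pushes_shift[of "phase A x \<beta>" m], of g]
  by (simp add: W_tilde_eq l2_carrier)

lemma phase_add: "phase A x (\<beta> + \<gamma>) k = phase A x \<beta> k * phase A x \<gamma> k"
  by (simp add: phase_def cis_mult matrix_vector_right_distrib inner_add_right)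

lemma phase_theta:
  assumes "dilation_matrix A"
  shows "phase A x (theta A m \<beta>) k = phase A x \<beta> (k - m)"
  by (simp add: phase_def theta_def mat_powi_mult_vec[OF dilation_invertible[OF assms]])

lemma phase_zero [simp]: "phase A x 0 k = 1"
  by (simp add: phase_def)

lemma unitary_rep_W_tilde:
  fixes A :: "int^'n^'n"
  assumes A: "dilation_matrix A"
  shows "unitary_rep (QA_group A) l2_int (W_tilde A x)"
proof (rule unitary_repI)
  show "group (QA_group A)" by (rule group_QA_group[OF A])
next
  fix g :: "(real^'n) \<times> int" show "W_tilde A x g \<in> extensional (carrier l2_int)"
    by (cases g) (simp add: W_tilde_def)
next
  fix g :: "(real^'n) \<times> int" and v assume v: "v \<in> carrier l2_int"
  then show "W_tilde A x g v \<in> carrier l2_int"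
    by (cases g) (simp add: W_tilde_in)
  show "W_tilde A x g (vscale l2_int c v) = vscale l2_int c (W_tilde A x g v)" for c
    using closed_ops_l2 v by (cases g) (auto simp: W_tilde_eq closed_ops_def)
next
  fix g :: "(real^'n) \<times> int" and u v assume uv: "u \<in> carrier l2_int" "v \<in> carrier l2_int"
  obtain \<beta> m where g: "g = (\<beta>, m)" by (cases g)
  show "W_tilde A x g (vadd l2_int u v) = vadd l2_int (W_tilde A x g u) (W_tilde A x g v)"
    using closed_ops_l2 uv by (auto simp: g W_tilde_eq closed_ops_def algebra_simps)
  show "cinner l2_int (W_tilde A x g u) (W_tilde A x g v) = cinner l2_int u v"
    using weighted_comp_L2_inner[OF weight_pushes_shift[of "phase A x \<beta>" m], of u v] uv
    by (simp add: g l2_cinner W_tilde_in) (simp add: W_tilde_eq l2_carrier)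
next
  fix v assume "v \<in> carrier l2_int"
  then show "W_tilde A x \<one>\<^bsub>QA_group A\<^esub> v = v"
    by (simp add: W_tilde_eq)
next
  fix g h :: "(real^'n) \<times> int" and v assume v: "v \<in> carrier l2_int"
  obtain \<beta> m \<gamma> l where g: "g = (\<beta>, m)" "h = (\<gamma>, l)" by (cases g, cases h)
  show "W_tilde A x (g \<otimes>\<^bsub>QA_group A\<^esub> h) v = W_tilde A x g (W_tilde A x h v)"
    using v W_tilde_in[OF v, of A x \<gamma> l]
    by (simp add: g W_tilde_eq phase_add phase_theta[OF A] algebra_simps)
qed

subsection \<open>Induced representations\<close>

text \<open>
  The sign anticipates that right translation by \<open>(0, m)\<close> raises the integer component of the
  argument by \<open>m\<close>, whereas \<open>W_tilde A x (0, m)\<close> lowers the index of the sequence by \<open>m\<close>.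
\<close>

lemma QA_rcosets:
  fixes A :: "int^'n^'n"
  assumes A: "dilation_matrix A"
  shows "bij_betw (\<lambda>m. QA A \<times> {- m}) UNIV (rcosets\<^bsub>QA_group A\<^esub> (QA_normal A))"
proof -
  have coset: "QA_normal A #>\<^bsub>QA_group A\<^esub> (\<beta>, m) = QA A \<times> {m}" if b: "\<beta> \<in> QA A" for \<beta> m
  proof
    show "QA_normal A #>\<^bsub>QA_group A\<^esub> (\<beta>, m) \<subseteq> QA A \<times> {m}"
      using b by (auto simp: r_coset_def QA_normal_def theta_simps[OF A] QA_add[OF A])
    show "QA A \<times> {m} \<subseteq> QA_normal A #>\<^bsub>QA_group A\<^esub> (\<beta>, m)"
    proof
      fix p assume "p \<in> QA A \<times> {m}"
      then obtain \<gamma> where p: "p = (\<gamma>, m)" "\<gamma> \<in> QA A" by auto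
      have "\<gamma> + - \<beta> \<in> QA A" by (rule QA_add[OF A p(2) QA_minus[OF b]])
      then have "(\<gamma> - \<beta>, 0) \<in> QA_normal A" by (simp add: QA_normal_def)
      moreover have "p = (\<gamma> - \<beta>, 0) \<otimes>\<^bsub>QA_group A\<^esub> (\<beta>, m)"
        by (simp add: p theta_simps[OF A])
      ultimately show "p \<in> QA_normal A #>\<^bsub>QA_group A\<^esub> (\<beta>, m)"
        unfolding r_coset_def by blast
    qed
  qed
  have "rcosets\<^bsub>QA_group A\<^esub> (QA_normal A) = range (\<lambda>m. QA A \<times> {- m})"
  proof
    show "rcosets\<^bsub>QA_group A\<^esub> (QA_normal A) \<subseteq> range (\<lambda>m. QA A \<times> {- m})"
    proof
      fix C assume "C \<in> rcosets\<^bsub>QA_group A\<^esub> (QA_normal A)"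
      then obtain \<beta> m where "\<beta> \<in> QA A" "C = QA_normal A #>\<^bsub>QA_group A\<^esub> (\<beta>, m)"
        by (auto simp: RCOSETS_def)
      then have "C = QA A \<times> {- (- m)}" by (simp add: coset)
      then show "C \<in> range (\<lambda>m. QA A \<times> {- m})" by (rule range_eqI)
    qed
    show "range (\<lambda>m. QA A \<times> {- m}) \<subseteq> rcosets\<^bsub>QA_group A\<^esub> (QA_normal A)"
    proof
      fix C :: "((real^'n) \<times> int) set" assume "C \<in> range (\<lambda>m. QA A \<times> {- m})"
      then obtain m where "C = QA_normal A #>\<^bsub>QA_group A\<^esub> (0, - m)"
        using coset[OF QA_zero] by blast
      moreover have "(0, - m) \<in> carrier (QA_group A)" using QA_zero by simp
      ultimately show "C \<in> rcosets\<^bsub>QA_group A\<^esub> (QA_normal A)"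
        unfolding RCOSETS_def by blast
    qed
  qed
  moreover have "inj (\<lambda>m. QA A \<times> {- m :: int})"
  proof (rule injI)
    fix m m' :: int assume "QA A \<times> {- m} = QA A \<times> {- m'}"
    then have "(0, - m) \<in> QA A \<times> {- m'}" using QA_zero by blast
    then show "m = m'" by simp
  qed
  ultimately show ?thesis by (simp add: bij_betw_def)
qed

lemma coset_rep_QA:
  obtains \<beta> where "\<beta> \<in> QA A" "coset_rep (QA A \<times> {m}) = (\<beta>, m)"
proof -
  have "(0, m) \<in> QA A \<times> {m}" using QA_zero by simp
  then have "coset_rep (QA A \<times> {m}) \<in> QA A \<times> {m}"
    unfolding coset_rep_def by (rule someI[where P = "\<lambda>g. g \<in> QA A \<times> {m}"])
  then show ?thesis using that by auto
qed

text \<open>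
  A function in the induced space is determined by its values at the points \<open>(0, -k)\<close>. These form a
  square summable sequence, since its modulus is constant on cosets.
\<close>

lemma monomial_W_tilde:
  fixes A :: "int^'n^'n"
  assumes A: "dilation_matrix A"
  shows "monomial_rep (QA_group A) (QA_normal A) l2_int (W_tilde A x)"
proof -
  define \<eta> where "\<eta> = (\<lambda>g :: (real^'n) \<times> int. cis (- (x \<bullet> fst g)))"
  have \<eta>1: "cmod (\<eta> g) = 1" for g by (simp add: \<eta>_def)
  let ?K = "induced_space (QA_group A) (QA_normal A) \<eta>"
  have char: "group_character ((QA_group A)\<lparr>carrier := QA_normal A\<rparr>) \<eta>"
    unfolding group_character_def
  proof (rule homI)
    fix g h assume "g \<in> carrier ((QA_group A)\<lparr>carrier := QA_normal A\<rparr>)"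
        "h \<in> carrier ((QA_group A)\<lparr>carrier := QA_normal A\<rparr>)"
    then obtain \<beta> \<gamma> where g: "g = (\<beta>, 0)" "h = (\<gamma>, 0)"
      by (auto simp: QA_normal_def)
    have "\<eta> (\<beta> + \<gamma>, 0) = \<eta> (\<beta>, 0) * \<eta> (\<gamma>, 0)"
      by (simp add: \<eta>_def cis_mult inner_add_right)
    then show "\<eta> (g \<otimes>\<^bsub>(QA_group A)\<lparr>carrier := QA_normal A\<rparr>\<^esub> h) = \<eta> g \<otimes>\<^bsub>circle_group\<^esub> \<eta> h"
      by (simp add: g circle_group_def theta_simps[OF A])
  qed (simp add: circle_group_def \<eta>1)
  define U where "U g = (\<lambda>(\<beta>, k). if \<beta> \<in> QA A then cis (- (x \<bullet> \<beta>)) * g (- k) else 0)"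
    for g :: "int \<Rightarrow> complex"
  have U_rep: "U g (coset_rep (QA A \<times> {- m})) = \<eta> (coset_rep (QA A \<times> {- m})) * g m" for g m
    by (rule coset_rep_QA[of A "- m"]) (simp add: U_def \<eta>_def)
  have Kcarr: "carrier ?K = {f. (\<forall>g. g \<notin> carrier (QA_group A) \<longrightarrow> f g = 0) \<and>
      (\<forall>h\<in>QA_normal A. \<forall>g\<in>carrier (QA_group A). f (h \<otimes>\<^bsub>QA_group A\<^esub> g) = \<eta> h * f g) \<and>
      (\<lambda>m. (cmod (f (coset_rep (QA A \<times> {- m}))))\<^sup>2) summable_on UNIV}"
  proof -
    have "(\<lambda>C. (cmod (f (coset_rep C)))\<^sup>2) summable_on (rcosets\<^bsub>QA_group A\<^esub> (QA_normal A)) \<longleftrightarrow>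
        (\<lambda>m. (cmod (f (coset_rep (QA A \<times> {- m}))))\<^sup>2) summable_on UNIV" for f :: "(real^'n) \<times> int \<Rightarrow>
            complex"
      by (rule summable_on_reindex_bij_betw[OF QA_rcosets[OF A], symmetric])
    then show ?thesis
      by (simp add: induced_space_def)
  qed
  have U_in: "U g \<in> carrier ?K" if g: "g \<in> carrier l2_int" for g
  proof -
    have "(\<lambda>m. (cmod (U g (coset_rep (QA A \<times> {- m}))))\<^sup>2) summable_on UNIV"
      using g by (simp add: U_rep norm_mult \<eta>1 l2_int_def)
    then show ?thesis
      unfolding Kcarr
      by (auto simp: U_def QA_normal_def \<eta>_def theta_simps[OF A] QA_add[OF A] cis_mult inner_add_right)
  qed
  define V where "V f = (\<lambda>k. f (0, - k))" for f :: "(real^'n) \<times> int \<Rightarrow> complex"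
  have K_eq: "f (\<beta>, m) = \<eta> (\<beta>, 0) * f (0, m)" if f: "f \<in> carrier ?K" and b: "\<beta> \<in> QA A" for f \<beta> m
  proof -
    have "f ((\<beta>, 0) \<otimes>\<^bsub>QA_group A\<^esub> (0, m)) = \<eta> (\<beta>, 0) * f (0, m)"
      using f b QA_zero[of A] unfolding Kcarr by (auto simp: QA_normal_def)
    then show ?thesis by (simp add: theta_simps[OF A])
  qed
  have V_in: "V f \<in> carrier l2_int" if f: "f \<in> carrier ?K" for f
  proof -
    have "cmod (f (coset_rep (QA A \<times> {- m}))) = cmod (V f m)" for m
      by (rule coset_rep_QA[of A "- m"]) (simp add: V_def K_eq[OF f] norm_mult \<eta>1)
    then show ?thesis
      using f unfolding Kcarr by (simp add: l2_int_def)
  qed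
  have UV: "U (V f) = f" if f: "f \<in> carrier ?K" for f
  proof
    fix p :: "(real^'n) \<times> int"
    obtain \<beta> m where p: "p = (\<beta>, m)" by (cases p)
    show "U (V f) p = f p"
    proof (cases "\<beta> \<in> QA A")
      case True
      then show ?thesis using K_eq[OF f True, of m] by (simp add: p U_def V_def \<eta>_def)
    next
      case False
      then show ?thesis using f unfolding Kcarr by (simp add: p U_def)
    qed
  qed
  have VU: "V (U g) = g" for g
    using QA_zero[of A] by (simp add: U_def V_def)
  have unit: "unitary_map l2_int ?K U"
    unfolding unitary_map_def
  proof (intro conjI ballI allI)
    show "bij_betw U (carrier l2_int) (carrier ?K)"
      by (rule bij_betw_byWitness[where f' = V]) (use U_in V_in UV VU in auto)
  next
    fix u v assume uv: "u \<in> carrier l2_int" "v \<in> carrier l2_int"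
    show "U (vadd l2_int u v) = vadd ?K (U u) (U v)"
      by (auto simp: U_def induced_space_def fun_eq_iff distrib_left)
    have "cinner ?K (U u) (U v)
        = (\<Sum>\<^sub>\<infinity>m. U u (coset_rep (QA A \<times> {- m})) * cnj (U v (coset_rep (QA A \<times> {- m}))))"
      unfolding induced_space_def
      using infsum_reindex_bij_betw[OF QA_rcosets[OF A], of "\<lambda>C. U u (coset_rep C)
          * cnj (U v (coset_rep C))"]
      by simp
    also have "\<dots> = (\<Sum>\<^sub>\<infinity>m. u m * cnj (v m))"
    proof (rule infsum_cong)
      fix m :: int
      let ?e = "\<eta> (coset_rep (QA A \<times> {- m}))"
      have "U u (coset_rep (QA A \<times> {- m})) * cnj (U v (coset_rep (QA A \<times> {- m})))
          = (?e * cnj ?e) * (u m * cnj (v m))"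
        by (simp add: U_rep)
      also have "?e * cnj ?e = 1"
        by (simp add: complex_norm_square[symmetric] \<eta>1)
      finally show "U u (coset_rep (QA A \<times> {- m})) * cnj (U v (coset_rep (QA A \<times> {- m})))
          = u m * cnj (v m)"
        by simp
    qed
    finally show "cinner ?K (U u) (U v) = cinner l2_int u v"
      by (simp add: l2_int_def)
  next
    fix c v
    show "U (vscale l2_int c v) = vscale ?K c (U v)"
      by (auto simp: U_def induced_space_def fun_eq_iff)
  qed
  have "unitarily_equivalent (QA_group A) l2_int (W_tilde A x) ?K (induced_rep (QA_group A) (QA_normal A) \<eta>)"
  proof (rule unitarily_equivalentI[OF unitary_rep_W_tilde[OF A] unit closed_ops_l2])
    fix g show "induced_rep (QA_group A) (QA_normal A) \<eta> g \<in> extensional (carrier ?K)"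
      by (simp add: induced_rep_def)
  next
    fix g v assume g: "g \<in> carrier (QA_group A)" and v: "v \<in> carrier l2_int"
    obtain \<beta> m where g': "g = (\<beta>, m)" "\<beta> \<in> QA A" using g by auto
    have "U (W_tilde A x g v) s = (if s \<in> carrier (QA_group A) then U v (s \<otimes>\<^bsub>QA_group A\<^esub> g) else 0)"
        for s
    proof -
      obtain \<gamma> k where s: "s = (\<gamma>, k)" by (cases s)
      have "phase A x \<beta> (- k) = cis (- (x \<bullet> theta A k \<beta>))"
        by (simp add: phase_def theta_def)
      then have "cis (- (x \<bullet> \<gamma>)) * phase A x \<beta> (- k) = cis (- (x \<bullet> (\<gamma> + theta A k \<beta>)))"
        by (simp add: cis_mult inner_add_right)
      then have "cis (- (x \<bullet> \<gamma>)) * (phase A x \<beta> (- k) * v (- k - m))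
          = cis (- (x \<bullet> (\<gamma> + theta A k \<beta>))) * v (- (k + m))"
        by (simp add: mult.assoc[symmetric])
      moreover have "\<gamma> + theta A k \<beta> \<in> QA A" if "\<gamma> \<in> QA A"
        by (rule QA_add[OF A that theta_QA[OF A g'(2)]])
      ultimately show ?thesis
        by (auto simp: s g'(1) U_def W_tilde_eq[OF v])
    qed
    then show "U (W_tilde A x g v) = induced_rep (QA_group A) (QA_normal A) \<eta> g (U v)"
      using U_in[OF v] by (simp add: induced_rep_def fun_eq_iff)
  qed
  with char show ?thesis
    unfolding monomial_rep_def by blast
qed

subsection \<open>Irreducibility\<close>

lemma norm_midpoint_unimodular:
  assumes z: "cmod z = 1" "z \<noteq> 1"
  shows "cmod ((1 + z) / 2) < 1"
proof -
  have s: "(Re z)\<^sup>2 + (Im z)\<^sup>2 = 1"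
    using z(1) by (simp add: cmod_def)
  then have "\<bar>Re z\<bar> \<le> 1"
    using abs_square_le_1[of "Re z"] zero_le_power2[of "Im z"] by linarith
  moreover have "Re z \<noteq> 1"
    using s z(2) by (auto simp: complex_eq_iff)
  ultimately have r: "Re z < 1" by linarith
  have "(cmod (1 + z))\<^sup>2 = 2 + 2 * Re z"
    using s by (simp only: cmod_power2) (simp add: power2_eq_square algebra_simps)
  also have "\<dots> < 2\<^sup>2" using r by simp
  finally have "cmod (1 + z) < 2"
    by (rule power2_less_imp_less) simp
  then show ?thesis by (simp add: norm_divide)
qed

text \<open>
  Dominated convergence on \<open>\<int>\<close>, with majorant \<open>4 \<bar>f\<bar>\<^sup>2\<close>.
\<close>

lemma closed_subspace_multiplier_limit:
  assumes S: "closed_subspace l2_int S" and f: "f \<in> carrier l2_int"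
    and m: "\<And>n. (\<lambda>k. m n k * f k) \<in> S" and m1: "\<And>n k. cmod (m n k) \<le> 1"
    and lim: "\<And>k. (\<lambda>n. m n k) \<longlonglongrightarrow> l k"
  shows "(\<lambda>k. l k * f k) \<in> S"
proof -
  let ?M = "count_space (UNIV :: int set)"
  have l1: "cmod (l k) \<le> 1" for k
    by (rule LIMSEQ_le_const2[OF tendsto_norm[OF lim]]) (use m1 in auto)
  have fi: "integrable ?M (\<lambda>k. (cmod (f k))\<^sup>2)"
    using f by (simp add: l2_carrier sq_integrable_def)
  have bd: "(cmod (c * f k))\<^sup>2 \<le> (cmod (f k))\<^sup>2" if "cmod c \<le> 1" for c k
    using that by (intro power_mono) (auto simp: norm_mult mult_left_le_one_le)
  have lf: "(\<lambda>k. l k * f k) \<in> carrier l2_int"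
    unfolding l2_carrier by (rule sq_integrableI_bound[OF _ fi]) (use bd l1 in auto)
  have mf: "(\<lambda>k. m n k * f k) \<in> carrier l2_int" for n
    using S m by (auto simp: closed_subspace_def)
  have "(\<lambda>n. \<integral>k. (cmod (m n k * f k - l k * f k))\<^sup>2 \<partial>?M) \<longlonglongrightarrow> (\<integral>k. 0 \<partial>?M)"
  proof (rule integral_dominated_convergence[where w = "\<lambda>k. 4 * (cmod (f k))\<^sup>2"])
    show "integrable ?M (\<lambda>k. 4 * (cmod (f k))\<^sup>2)" using fi by simp
    show "AE k in ?M. (\<lambda>n. (cmod (m n k * f k - l k * f k))\<^sup>2) \<longlonglongrightarrow> 0"
    proof (rule AE_I2)
      fix k
      have "(\<lambda>n. (cmod (m n k * f k - l k * f k))\<^sup>2) \<longlonglongrightarrow> (cmod (l k * f k - l k * f k))\<^sup>2"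
        by (intro tendsto_intros lim)
      then show "(\<lambda>n. (cmod (m n k * f k - l k * f k))\<^sup>2) \<longlonglongrightarrow> 0" by simp
    qed
    show "AE k in ?M. norm ((cmod (m n k * f k - l k * f k))\<^sup>2) \<le> 4 * (cmod (f k))\<^sup>2" for n
    proof (rule AE_I2)
      fix k
      have "cmod (m n k - l k) \<le> 2"
        using norm_triangle_ineq4[of "m n k" "l k"] m1[of n k] l1[of k] by linarith
      then have "cmod (m n k * f k - l k * f k) \<le> 2 * cmod (f k)"
        by (simp add: left_diff_distrib[symmetric] norm_mult mult_right_mono)
      then have "(cmod (m n k * f k - l k * f k))\<^sup>2 \<le> (2 * cmod (f k))\<^sup>2"
        by (intro power_mono) auto
      then show "norm ((cmod (m n k * f k - l k * f k))\<^sup>2) \<le> 4 * (cmod (f k))\<^sup>2"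
        by (simp add: power_mult_distrib)
    qed
  qed auto
  then have "(\<lambda>n. L2_norm ?M (\<lambda>k. m n k * f k - l k * f k)) \<longlonglongrightarrow> 0"
    unfolding L2_norm_def using tendsto_real_sqrt by fastforce
  moreover have "vnorm l2_int (vadd l2_int (\<lambda>k. m n k * f k) (vscale l2_int (- 1) (\<lambda>k. l k * f k)))
      = L2_norm ?M (\<lambda>k. m n k * f k - l k * f k)" for n
    using mf lf by (subst l2_vnorm) (auto simp: l2_carrier sq_integrable_diff)
  ultimately have "(\<lambda>n. vnorm l2_int (vadd l2_int (\<lambda>k. m n k * f k) (vscale l2_int (- 1) (\<lambda>k. l k
      * f k)))) \<longlonglongrightarrow> 0"
    by simp
  then show ?thesis
    using S lf m unfolding closed_subspace_def by (elim conjE allE[where x = "\<lambda>n k. m n k * f k"]) blast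
qed

text \<open>
  An invariant subspace is stable under multiplication by the functions \<open>k \<mapsto> \<chi>\<^sub>k(\<beta>)\<close>, where \<open>\<chi>\<^sub>k\<close> is the
  character on the coordinate \<open>k\<close>. Let it contain \<open>f\<close> with \<open>f(j) \<noteq> 0\<close>. For each \<open>k \<noteq> j\<close> choose \<open>b\<^sub>k\<close> with
  \<open>\<chi>\<^sub>k(b\<^sub>k) \<noteq> \<chi>\<^sub>j(b\<^sub>k)\<close>. The multiplier \<open>u\<^sub>k(i) = (1 + \<chi>\<^sub>i(b\<^sub>k) / \<chi>\<^sub>j(b\<^sub>k)) / 2\<close> has modulus at most \<open>1\<close>
  everywhere, the value \<open>1\<close> at \<open>j\<close>, and modulus less than \<open>1\<close> at \<open>k\<close>. The products of the \<open>n\<close>-th powers of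
  \<open>u\<^sub>k\<close> over \<open>\<bar>k\<bar> \<le> n\<close>, \<open>k \<noteq> j\<close>, converge to the indicator function of \<open>{j}\<close>. So the subspace contains a unit
  vector, by the shift all of them, and hence everything.
\<close>

lemma irreducible_W_tilde:
  fixes A :: "int^'n^'n"
  assumes A: "dilation_matrix A" and E: "transformation_wavelet_set (transpose (real_mat A)) E"
      and x: "x \<in> E"
  shows "irreducible_rep (QA_group A) l2_int (W_tilde A x)"
  unfolding irreducible_rep_def
proof (intro conjI allI impI)
  show "unitary_rep (QA_group A) l2_int (W_tilde A x)"
    by (rule unitary_rep_W_tilde[OF A])
  define \<delta> where "\<delta> j = (\<lambda>k::int. if k = j then 1 else 0 :: complex)" for j
  have \<delta>: "\<delta> j \<in> carrier l2_int" for j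
  proof -
    have "(\<lambda>k. (cmod (\<delta> j k))\<^sup>2) summable_on {j}" by (rule summable_on_finite) simp
    also have "?this \<longleftrightarrow> (\<lambda>k. (cmod (\<delta> j k))\<^sup>2) summable_on UNIV"
      by (rule summable_on_cong_neutral) (auto simp: \<delta>_def)
    finally show ?thesis by (simp add: l2_int_def)
  qed
  have "\<delta> 0 \<noteq> vzero l2_int" by (auto simp: \<delta>_def fun_eq_iff)
  then show "carrier l2_int \<noteq> {vzero l2_int}" using \<delta>[of 0] by auto
  fix S assume S: "closed_subspace l2_int S \<and> (\<forall>g\<in>carrier (QA_group A). \<forall>v\<in>S. W_tilde A x g v \<in> S)"
  then have cs: "closed_subspace l2_int S" by blast
  have Sl2: "f \<in> carrier l2_int" if "f \<in> S" for f using cs that by (auto simp: closed_subspace_def)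
  have Sadd: "(\<lambda>k. f k + g k) \<in> S" if "f \<in> S" "g \<in> S" for f g
    using cs that by (auto simp: closed_subspace_def)
  have Sscale: "(\<lambda>k. c * f k) \<in> S" if "f \<in> S" for c f
    using cs that by (auto simp: closed_subspace_def)
  have Sphase: "(\<lambda>k. phase A x \<beta> k * f k) \<in> S" if "f \<in> S" "\<beta> \<in> QA A" for f \<beta>
  proof -
    have "W_tilde A x (\<beta>, 0) f \<in> S" using S that by simp
    then show ?thesis using Sl2[OF that(1)] by (simp add: W_tilde_eq)
  qed
  have Sshift: "(\<lambda>k. f (k - m)) \<in> S" if "f \<in> S" for f m
  proof -
    have "W_tilde A x (0, m) f \<in> S" using S that QA_zero[of A] by simp
    then show ?thesis using Sl2[OF that(1)] by (simp add: W_tilde_eq)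
  qed
  \<comment> \<open>Otherwise \<open>\<beta> \<mapsto> exp (i y \<bullet> \<beta>)\<close> is trivial on \<open>\<rat>\<^sub>A\<close> for \<open>y = B\<^sup>k x - B\<^sup>j x\<close>, and \<open>B\<^sup>k E\<close> meets \<open>B\<^sup>j E\<close>.\<close>
  have sep: "\<exists>\<beta>\<in>QA A. phase A x \<beta> k * cnj (phase A x \<beta> j) \<noteq> 1" if kj: "k \<noteq> j" for k j
  proof (rule ccontr)
    assume "\<not> ?thesis"
    then have triv: "phase A x \<beta> j * cnj (phase A x \<beta> k) = 1" if "\<beta> \<in> QA A" for \<beta>
      using that by (metis complex_cnj_cnj complex_cnj_mult complex_cnj_one mult.commute)
    let ?B = "\<lambda>k. mat_powi (transpose (real_mat A)) k"
    define y where "y = ?B k *v x - ?B j *v x"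
    have dot: "(?B i *v x) \<bullet> \<beta> = x \<bullet> (mat_powi (real_mat A) i *v \<beta>)" for i \<beta>
      using dot_transpose[of "mat_powi (real_mat A) i" x \<beta>]
      by (simp only: transpose_mat_powi[OF dilation_invertible[OF A]])
    have "cis (y \<bullet> \<beta>) = 1" if "\<beta> \<in> QA A" for \<beta>
      using triv[OF that] by (simp add: y_def inner_diff_left dot phase_def cis_cnj cis_mult
          algebra_simps)
    then have "y = 0" by (rule characters_separate[OF A])
    then have "?B k *v x = ?B j *v x" by (simp add: y_def)
    then have "?B k *v x \<in> ((*v) (?B k) ` E) \<inter> ((*v) (?B j) ` E)"
      using x by (metis IntI imageI)
    then show False
      using E kj unfolding transformation_wavelet_set_def by blast
  qed
  show "S = {vzero l2_int} \<or> S = carrier l2_int"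
  proof (cases "S = {vzero l2_int}")
    case False
    moreover have "vzero l2_int \<in> S" using cs by (simp add: closed_subspace_def)
    ultimately obtain f where f: "f \<in> S" "f \<noteq> (\<lambda>k. 0)" by fastforce
    then obtain j where j: "f j \<noteq> 0" by (auto simp: fun_eq_iff)
    have "\<forall>k. \<exists>\<beta>. k \<noteq> j \<longrightarrow> \<beta> \<in> QA A \<and> phase A x \<beta> k * cnj (phase A x \<beta> j) \<noteq> 1"
      using sep by blast
    then obtain b where "\<forall>k. k \<noteq> j \<longrightarrow> b k \<in> QA A \<and> phase A x (b k) k * cnj (phase A x (b k) j) \<noteq> 1"
      using choice by metis
    then have b: "\<And>k. k \<noteq> j \<Longrightarrow> b k \<in> QA A"
        "\<And>k. k \<noteq> j \<Longrightarrow> phase A x (b k) k * cnj (phase A x (b k) j) \<noteq> 1"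
      by auto
    define z where "z k i = phase A x (b k) i * cnj (phase A x (b k) j)" for k i
    define u where "u k i = (1 + z k i) / 2" for k i
    have z1: "cmod (z k i) = 1" for k i by (simp add: z_def norm_mult)
    have zj: "z k j = 1" for k
      by (simp add: z_def complex_norm_square[symmetric])
    have u1: "cmod (u k i) \<le> 1" for k i
      using norm_triangle_ineq[of 1 "z k i"] z1[of k i] by (simp add: u_def norm_divide)
    have uj: "u k j = 1" for k by (simp add: u_def zj)
    have ulim: "(\<lambda>n. u k k ^ n) \<longlonglongrightarrow> 0" if "k \<noteq> j" for k
      using norm_midpoint_unimodular[OF z1] b(2)[OF that]
          by (intro LIMSEQ_power_zero) (simp add: u_def z_def)
    have Su: "(\<lambda>i. u k i * g i) \<in> S" if "g \<in> S" "k \<noteq> j" for g k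
    proof -
      have "(\<lambda>i. (1/2) * (g i + cnj (phase A x (b k) j) * (phase A x (b k) i * g i))) \<in> S"
        by (rule Sscale[OF Sadd[OF that(1) Sscale[OF Sphase[OF that(1) b(1)[OF that(2)]]]]])
      then show ?thesis by (simp add: u_def z_def algebra_simps add_divide_distrib)
    qed
    have Spow: "(\<lambda>i. u k i ^ n * g i) \<in> S" if "g \<in> S" "k \<noteq> j" for g k n
    proof (induction n)
      case (Suc n)
      then show ?case using Su[OF Suc that(2)] by (simp add: mult.assoc)
    qed (use that in simp)
    have Sprod: "(\<lambda>i. (\<Prod>k\<in>K. u k i ^ n) * g i) \<in> S" if "finite K" "j \<notin> K" "g \<in> S" for K g n
      using that
    proof (induction K)
      case (insert k K)
      then have "(\<lambda>i. u k i ^ n * ((\<Prod>k\<in>K. u k i ^ n) * g i)) \<in> S"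
        by (intro Spow) auto
      then show ?case using insert by (simp add: mult.assoc)
    qed simp
    \<comment> \<open>The exponent and the index set grow together, so that each factor is raised to arbitrarily high powers.\<close>
    define m where "m n i = (\<Prod>k\<in>{- int n..int n} - {j}. u k i ^ n)" for n i
    have m_le: "cmod (m n i) \<le> 1" for n i
      unfolding m_def prod_norm[symmetric] norm_power by (intro prod_le_1) (auto simp: power_le_one u1)
    have m_lim: "(\<lambda>n. m n i) \<longlonglongrightarrow> \<delta> j i" for i
    proof (cases "i = j")
      case True
      then show ?thesis by (simp add: m_def uj \<delta>_def)
    next
      case False
      have "cmod (m n i) \<le> cmod (u i i ^ n)" if n: "n \<ge> nat \<bar>i\<bar>" for n
      proof -
        have "i \<in> {- int n..int n} - {j}" using n False by auto
        then have "cmod (m n i) = cmod (u i i ^ n)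
            * (\<Prod>k\<in>{- int n..int n} - {j} - {i}. cmod (u k i ^ n))"
          unfolding m_def prod_norm[symmetric] by (subst prod.remove[of _ i]) auto
        also have "\<dots> \<le> cmod (u i i ^ n) * 1"
          by (intro mult_left_mono prod_le_1) (auto simp: norm_power power_le_one u1)
        finally show ?thesis by simp
      qed
      then have "\<forall>\<^sub>F n in sequentially. norm (m n i) \<le> norm (u i i ^ n)"
        by (auto simp: eventually_sequentially)
      then have "(\<lambda>n. m n i) \<longlonglongrightarrow> 0"
        by (rule Lim_null_comparison[OF _ tendsto_norm_zero[OF ulim[OF False]]])
      then show ?thesis using False by (simp add: \<delta>_def)
    qed
    have "(\<lambda>k. \<delta> j k * f k) \<in> S"
      by (rule closed_subspace_multiplier_limit[OF cs Sl2[OF f(1)] _ m_le m_lim])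
         (unfold m_def, intro Sprod f, auto)
    then have "(\<lambda>k. (1 / f j) * (\<delta> j k * f k)) \<in> S" by (rule Sscale)
    also have "(\<lambda>k. (1 / f j) * (\<delta> j k * f k)) = \<delta> j"
      using j by (auto simp: \<delta>_def fun_eq_iff)
    finally have "\<delta> j \<in> S" .
    then have \<delta>S: "\<delta> i \<in> S" for i
    proof -
      assume "\<delta> j \<in> S"
      then have "(\<lambda>k. \<delta> j (k - (i - j))) \<in> S" by (rule Sshift)
      moreover have "(\<lambda>k. \<delta> j (k - (i - j))) = \<delta> i" by (auto simp: \<delta>_def fun_eq_iff)
      ultimately show ?thesis by simp
    qed
    have "g \<in> S" if g: "g \<in> carrier l2_int" for g
    proof -
      define c where "c n k = (if k \<in> {- int n..int n} then 1 else 0 :: complex)" for n and k :: int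
      have "(\<lambda>k. 1 * g k) \<in> S"
      proof (rule closed_subspace_multiplier_limit[OF cs g, where m = c])
        have "(\<lambda>k. \<Sum>i\<in>I. g i * \<delta> i k) \<in> S" if "finite I" for I
          using that
        proof (induction I)
          case empty
          then show ?case using \<open>vzero l2_int \<in> S\<close> by simp
        next
          case (insert i I)
          then show ?case by (simp add: Sadd Sscale \<delta>S)
        qed
        then have "(\<lambda>k. \<Sum>i\<in>{- int n..int n}. g i * \<delta> i k) \<in> S" for n by blast
        moreover have "(\<Sum>i\<in>{- int n..int n}. g i * \<delta> i k) = c n k * g k" for n k
        proof -
          have "(\<Sum>i\<in>{- int n..int n}. g i * \<delta> i k) = (\<Sum>i\<in>{- int n..int n}. if k = i then g i else 0)"
            by (rule sum.cong) (auto simp: \<delta>_def)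
          then show ?thesis by (simp add: c_def)
        qed
        ultimately show "(\<lambda>k. c n k * g k) \<in> S" for n by simp
        show "cmod (c n k) \<le> 1" for n k by (simp add: c_def)
        show "(\<lambda>n. c n k) \<longlonglongrightarrow> 1" for k
        proof (rule tendsto_eventually)
          have "c n k = 1" if "n \<ge> nat \<bar>k\<bar>" for n
            using that by (auto simp: c_def)
          then show "\<forall>\<^sub>F n in sequentially. c n k = 1"
            by (auto simp: eventually_sequentially)
        qed
      qed
      then show ?thesis by simp
    qed
    then show ?thesis using Sl2 by blast
  qed simp
qed

section \<open>The wavelet representation\<close>

text \<open>
  The normalising factor \<open>\<bar>det A\<bar>\<^sup>k\<^sup>/\<^sup>2\<close>, in a form that is visibly multiplicative in \<open>k\<close>.
\<close>

definition dilation_factor :: "int^'n^'n \<Rightarrow> int \<Rightarrow> real" where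
  "dilation_factor A k = sqrt \<bar>det (mat_powi (real_mat A) k)\<bar>"

lemma dilation_factor_add: "dilation_matrix A
    \<Longrightarrow> dilation_factor A (j + k) = dilation_factor A j * dilation_factor A k"
  by (simp add: dilation_factor_def mat_powi_add dilation_invertible det_mul abs_mult real_sqrt_mult)

lemma dilation_factor_0 [simp]: "dilation_factor A 0 = 1"
  by (simp add: dilation_factor_def)

lemma dilation_factor_pos: "dilation_matrix A \<Longrightarrow> 0 < dilation_factor A k"
  using invertible_mat_powi[OF dilation_invertible, of A k]
      by (simp add: dilation_factor_def invertible_det_nz)

text \<open>
  The action of \<open>T\<^sub>\<beta> D\<^sub>A\<^sup>m\<close> on functions, with the power carried out.
\<close>

definition wavelet_fun :: "int^'n^'n \<Rightarrow> (real^'n) \<times> int \<Rightarrow> (real^'n \<Rightarrow> complex) \<Rightarrow> real^'n \<Rightarrow> complex" where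
  "wavelet_fun A = (\<lambda>(\<beta>, m) f t. of_real (dilation_factor A m)
      * f (mat_powi (real_mat A) m *v (t - \<beta>)))"

lemma weight_pushes_wavelet:
  assumes A: "dilation_matrix A"
  shows "weight_pushes lebesgue (\<lambda>t. of_real (dilation_factor A m)) (\<lambda>t. mat_powi (real_mat A) m *v (t - \<beta>)) lebesgue"
  using weight_pushes_compose[OF weight_pushes_lebesgue_translate[of \<beta>]
      weight_pushes_lebesgue_linear[OF invertible_mat_powi[OF dilation_invertible[OF A], of m]]]
  by (simp add: dilation_factor_def)

lemma wavelet_fun_sq_integrable:
  assumes A: "dilation_matrix A" and f: "f \<in> sq_integrable lebesgue"
  shows "wavelet_fun A g f \<in> sq_integrable lebesgue"
  using weighted_comp_sq_integrable[OF weight_pushes_wavelet[OF A] f]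
  by (cases g) (simp add: wavelet_fun_def)

lemma wavelet_op_class:
  assumes A: "dilation_matrix A" and f: "f \<in> sq_integrable lebesgue"
  shows "L2_op lebesgue (wavelet_fun A g) (L2_class lebesgue f) = L2_class lebesgue (wavelet_fun A g f)"
  using L2_op_weighted_comp[OF weight_pushes_wavelet[OF A] f]
  by (cases g) (simp add: wavelet_fun_def[abs_def])

lemma unitary_rep_wavelet_op:
  fixes A :: "int^'n^'n"
  assumes A: "dilation_matrix A"
  shows "unitary_rep (QA_group A) (L2_space lebesgue) (\<lambda>g. L2_op lebesgue (wavelet_fun A g))"
proof (rule unitary_repI)
  show "group (QA_group A)" by (rule group_QA_group[OF A])
next
  fix g show "L2_op lebesgue (wavelet_fun A g) \<in> extensional (carrier (L2_space lebesgue))"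
    by (rule L2_op_extensional)
next
  fix g :: "(real^'n) \<times> int" and F :: "(real^'n \<Rightarrow> complex) set"
  obtain \<beta> m where g: "g = (\<beta>, m)" by (cases g)
  assume "F \<in> carrier (L2_space lebesgue)"
  then obtain f where f: "f \<in> sq_integrable lebesgue" "F = L2_class lebesgue f" by (rule L2_carrierE)
  note W = wavelet_fun_sq_integrable[OF A f(1)]
  show "L2_op lebesgue (wavelet_fun A g) F \<in> carrier (L2_space lebesgue)"
    by (simp add: f(2) wavelet_op_class[OF A f(1)] L2_class_in W)
  fix c
  have "wavelet_fun A g (\<lambda>x. c * f x) = (\<lambda>x. c * wavelet_fun A g f x)"
    by (simp add: g wavelet_fun_def fun_eq_iff)
  then show "L2_op lebesgue (wavelet_fun A g) (vscale (L2_space lebesgue) c F)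
      = vscale (L2_space lebesgue) c (L2_op lebesgue (wavelet_fun A g) F)"
    by (simp add: f L2_vscale_class wavelet_op_class[OF A] W sq_integrable_scale)
next
  fix g :: "(real^'n) \<times> int" and F F' :: "(real^'n \<Rightarrow> complex) set"
  obtain \<beta> m where g: "g = (\<beta>, m)" by (cases g)
  assume "F \<in> carrier (L2_space lebesgue)" "F' \<in> carrier (L2_space lebesgue)"
  then obtain f f' where f: "f \<in> sq_integrable lebesgue" "F = L2_class lebesgue f" 
    and f': "f' \<in> sq_integrable lebesgue" "F' = L2_class lebesgue f'" by (metis L2_carrierE)
  note W = wavelet_fun_sq_integrable[OF A f(1)] wavelet_fun_sq_integrable[OF A f'(1)]
  have "wavelet_fun A g (\<lambda>x. f x + f' x) = (\<lambda>x. wavelet_fun A g f x + wavelet_fun A g f' x)"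
    by (simp add: g wavelet_fun_def fun_eq_iff distrib_left)
  then show "L2_op lebesgue (wavelet_fun A g) (vadd (L2_space lebesgue) F F')
      = vadd (L2_space lebesgue) (L2_op lebesgue (wavelet_fun A g) F)
          (L2_op lebesgue (wavelet_fun A g) F')"
    by (simp add: f f' L2_vadd_class wavelet_op_class[OF A] W sq_integrable_add)
  have "L2_inner lebesgue (wavelet_fun A g f) (wavelet_fun A g f') = L2_inner lebesgue f f'"
    using weighted_comp_L2_inner[OF weight_pushes_wavelet[OF A, of m \<beta>] f(1) f'(1)]
    by (simp add: g wavelet_fun_def)
  then show "cinner (L2_space lebesgue) (L2_op lebesgue (wavelet_fun A g) F) (L2_op lebesgue (wavelet_fun A g) F')
      = cinner (L2_space lebesgue) F F'"
    by (simp add: f f' L2_cinner_class wavelet_op_class[OF A] W)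
next
  fix F :: "(real^'n \<Rightarrow> complex) set"
  assume "F \<in> carrier (L2_space lebesgue)"
  then obtain f where f: "f \<in> sq_integrable lebesgue" "F = L2_class lebesgue f" by (rule L2_carrierE)
  show "L2_op lebesgue (wavelet_fun A \<one>\<^bsub>QA_group A\<^esub>) F = F"
    by (simp only: f(2) wavelet_op_class[OF A f(1)]) (simp add: wavelet_fun_def)
next
  fix g h :: "(real^'n) \<times> int" and F :: "(real^'n \<Rightarrow> complex) set"
  obtain \<beta> m \<gamma> l where g: "g = (\<beta>, m)" "h = (\<gamma>, l)" by (cases g, cases h)
  note inv = dilation_invertible[OF A]
  assume "F \<in> carrier (L2_space lebesgue)"
  then obtain f where f: "f \<in> sq_integrable lebesgue" "F = L2_class lebesgue f" by (rule L2_carrierE)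
  have arg: "mat_powi (real_mat A) (m + l) *v (t - (\<beta> + theta A m \<gamma>))
      = mat_powi (real_mat A) l *v (mat_powi (real_mat A) m *v (t - \<beta>) - \<gamma>)" for t
    by (simp add: theta_def matrix_vector_mult_diff_distrib matrix_vector_right_distrib
        mat_powi_mult_vec[OF inv] add.commute)
  have "wavelet_fun A (g \<otimes>\<^bsub>QA_group A\<^esub> h) f = wavelet_fun A g (wavelet_fun A h f)"
    by (simp add: g wavelet_fun_def fun_eq_iff arg dilation_factor_add[OF A])
  then show "L2_op lebesgue (wavelet_fun A (g \<otimes>\<^bsub>QA_group A\<^esub> h)) F
      = L2_op lebesgue (wavelet_fun A g) (L2_op lebesgue (wavelet_fun A h) F)"
    by (simp add: f wavelet_op_class[OF A] wavelet_fun_sq_integrable[OF A])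
qed

text \<open>
  The closed form is a representation with the values \<open>T\<^sub>\<beta>\<close> at \<open>(\<beta>, 0)\<close> and \<open>D\<^sub>A\<close> at \<open>(0, 1)\<close>, and homomorphisms
  commute with integer powers.
\<close>

lemma wavelet_rep_eq:
  fixes A :: "int^'n^'n"
  assumes A: "dilation_matrix A" and g: "g \<in> carrier (QA_group A)"
  shows "wavelet_rep A g = L2_op lebesgue (wavelet_fun A g)"
proof -
  obtain \<beta> m where g': "g = (\<beta>, m)" "\<beta> \<in> QA A" using g by auto
  let ?W = "\<lambda>g. L2_op lebesgue (wavelet_fun A g)"
  let ?G = "QA_group A" and ?U = "unitary_group (L2_space (lebesgue :: (real^'n) measure))"
  have hom: "?W \<in> hom ?G ?U"
    using unitary_rep_wavelet_op[OF A] by (simp add: unitary_rep_def)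
  have "translation_op \<beta> = ?W (\<beta>, 0)"
    by (simp add: translation_op_def wavelet_fun_def)
  moreover have "dilation_op A = ?W (0, 1)"
    by (simp add: dilation_op_def wavelet_fun_def dilation_factor_def powr_half_sqrt)
  moreover have "?W (0, 1) [^]\<^bsub>?U\<^esub> m = ?W (0, m)"
    using hom_int_pow[OF hom _ group_QA_group[OF A] group_unitary_group[OF closed_ops_L2], of "(0, 1)"
        m]
    by (simp add: QA_group_int_pow[OF A] QA_zero)
  moreover have "?W (\<beta>, 0) \<otimes>\<^bsub>?U\<^esub> ?W (0, m) = ?W ((\<beta>, 0) \<otimes>\<^bsub>?G\<^esub> (0, m))"
    using g' QA_zero[of A] by (intro hom_mult[OF hom, symmetric]) auto
  moreover have "(\<beta>, 0) \<otimes>\<^bsub>?G\<^esub> (0, m) = g"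
    by (simp add: g' theta_def)
  ultimately show ?thesis
    by (simp add: wavelet_rep_def g'(1))
qed

lemma unitary_rep_wavelet_rep:
  assumes A: "dilation_matrix A"
  shows "unitary_rep (QA_group A) (L2_space lebesgue) (wavelet_rep A)"
proof -
  interpret group "QA_group A" by (rule group_QA_group[OF A])
  have hom: "(\<lambda>g. L2_op lebesgue (wavelet_fun A g)) \<in> hom (QA_group A) (unitary_group (L2_space lebesgue))"
    using unitary_rep_wavelet_op[OF A] by (simp add: unitary_rep_def)
  have "wavelet_rep A \<in> hom (QA_group A) (unitary_group (L2_space lebesgue))"
  proof (rule homI)
    fix g assume g: "g \<in> carrier (QA_group A)"
    show "wavelet_rep A g \<in> carrier (unitary_group (L2_space lebesgue))"
      using hom_in_carrier[OF hom g] by (simp only: wavelet_rep_eq[OF A g])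
    fix h assume h: "h \<in> carrier (QA_group A)"
    show "wavelet_rep A (g \<otimes>\<^bsub>QA_group A\<^esub> h)
        = wavelet_rep A g \<otimes>\<^bsub>unitary_group (L2_space lebesgue)\<^esub> wavelet_rep A h"
      using hom_mult[OF hom g h]
      by (simp only: wavelet_rep_eq[OF A g] wavelet_rep_eq[OF A h] wavelet_rep_eq[OF A m_closed[OF g
          h]])
  qed
  then show ?thesis by (simp add: unitary_rep_def is_group)
qed

section \<open>The direct integral\<close>

lemma sigma_finite_lebesgue: "sigma_finite_measure (lebesgue :: 'a::euclidean_space measure)"
proof
  obtain \<C> :: "'a set set" where C: "countable \<C>" "\<C> \<subseteq> sets lborel" "\<Union>\<C> = space lborel"
      "\<forall>a\<in>\<C>. emeasure lborel a \<noteq> \<infinity>"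
    using lborel.sigma_finite_countable by blast
  have "\<C> \<subseteq> sets lebesgue" "\<forall>a\<in>\<C>. emeasure lebesgue a \<noteq> \<infinity>"
    using C(2,4) by (auto simp: subset_iff)
  then show "\<exists>\<C>. countable \<C> \<and> \<C> \<subseteq> sets (lebesgue :: 'a measure) \<and> \<Union>\<C> = space lebesgue \<and>
      (\<forall>a\<in>\<C>. emeasure lebesgue a \<noteq> \<infinity>)"
    using C(1,3) by (intro exI[of _ \<C>]) simp
qed

lemma pair_sigma_finite_E_times_int:
  assumes E: "E \<in> sets lebesgue"
  shows "pair_sigma_finite (lebesgue_on E) (count_space (UNIV :: int set))"
proof -
  have "sigma_finite_measure (lebesgue_on E)"
    by (rule sigma_finite_measure_restrict_space[OF sigma_finite_lebesgue E])
  moreover have "sigma_finite_measure (count_space (UNIV :: int set))"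
    by (rule sigma_finite_measure_count_space)
  ultimately show ?thesis by (simp add: pair_sigma_finite_def)
qed

lemma space_E_times_int [simp]: "space (E_times_int E) = E \<times> UNIV"
  by (simp add: E_times_int_def space_pair_measure)

lemma measurable_E_times_int:
  assumes "\<And>k. (\<lambda>x. f (x, k)) \<in> lebesgue_on E \<rightarrow>\<^sub>M K"
  shows "f \<in> E_times_int E \<rightarrow>\<^sub>M K"
proof -
  have "(\<lambda>p. f (fst p, snd p)) \<in> E_times_int E \<rightarrow>\<^sub>M K"
    unfolding E_times_int_def
  proof (rule measurable_compose_countable'[where f = "\<lambda>k p. f (fst p, k)" and g = snd and I = UNIV])
    show "(\<lambda>p. f (fst p, k)) \<in> lebesgue_on E \<Otimes>\<^sub>M count_space UNIV \<rightarrow>\<^sub>M K" for k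
      by (rule measurable_compose[OF measurable_fst assms])
  qed auto
  then show ?thesis by simp
qed

lemma measurable_slice:
  "f \<in> E_times_int E \<rightarrow>\<^sub>M K \<Longrightarrow> (\<lambda>x. f (x, k)) \<in> lebesgue_on E \<rightarrow>\<^sub>M K"
  unfolding E_times_int_def
  by (rule measurable_compose[of "\<lambda>x. (x, k)" _ "lebesgue_on E \<Otimes>\<^sub>M count_space UNIV"]) measurable

lemma nn_integral_E_times_int:
  assumes E: "E \<in> sets lebesgue" and f: "f \<in> borel_measurable (E_times_int E)"
  shows "(\<integral>\<^sup>+p. f p \<partial>E_times_int E) = (\<integral>\<^sup>+k. (\<integral>\<^sup>+x. f (x, k) \<partial>lebesgue_on E) \<partial>count_space UNIV)"
  using pair_sigma_finite.nn_integral_snd[OF pair_sigma_finite_E_times_int[OF E]] f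
  unfolding E_times_int_def by metis

locale dilation_tiling =
  fixes A :: "int^'n^'n" and E :: "(real^'n) set"
  assumes dilation_mat: "dilation_matrix A"
    and tws: "transformation_wavelet_set (transpose (real_mat A)) E"
begin

definition B_pow :: "int \<Rightarrow> real^'n^'n" where
  "B_pow k = mat_powi (transpose (real_mat A)) k"

lemma inv_B: "invertible (transpose (real_mat A))"
  using dilation_invertible[OF dilation_mat] by (simp add: invertible_det_nz)

lemma inv_B_pow: "invertible (B_pow k)"
  unfolding B_pow_def by (rule invertible_mat_powi[OF inv_B])

lemma B_pow_mult: "B_pow j *v (B_pow k *v x) = B_pow (j + k) *v x"
  unfolding B_pow_def by (rule mat_powi_mult_vec[OF inv_B])

lemma B_pow_0 [simp]: "B_pow 0 = mat 1"
  by (simp add: B_pow_def)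

lemma B_pow_transpose: "B_pow k = transpose (mat_powi (real_mat A) k)"
  by (simp add: B_pow_def transpose_mat_powi[OF dilation_invertible[OF dilation_mat]])

lemma dilation_factor_B_pow: "dilation_factor A k = sqrt \<bar>det (B_pow k)\<bar>"
  by (simp add: dilation_factor_def B_pow_transpose)

lemma E_sets: "E \<in> sets lebesgue"
  using tws by (simp add: transformation_wavelet_set_def)

lemma B_pow_image: "\<xi> \<in> (*v) (B_pow k) ` E \<longleftrightarrow> B_pow (- k) *v \<xi> \<in> E"
proof
  assume "\<xi> \<in> (*v) (B_pow k) ` E"
  then show "B_pow (- k) *v \<xi> \<in> E" by (auto simp: B_pow_mult)
next
  assume *: "B_pow (- k) *v \<xi> \<in> E"
  have "\<xi> = B_pow k *v (B_pow (- k) *v \<xi>)" by (simp add: B_pow_mult)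
  then show "\<xi> \<in> (*v) (B_pow k) ` E" using * by (rule image_eqI)
qed

lemma B_pow_image_sets: "(*v) (B_pow k) ` E \<in> sets lebesgue"
proof -
  have "(*v) (B_pow k) ` E = (*v) (B_pow (- k)) -` E \<inter> space lebesgue"
    using B_pow_image by auto
  then show ?thesis
    using measurable_sets[OF lebesgue_linear_measurable[OF inv_B_pow] E_sets] by simp
qed

lemma B_pow_disjoint: "j \<noteq> k \<Longrightarrow> ((*v) (B_pow j) ` E) \<inter> ((*v) (B_pow k) ` E) = {}"
  using tws unfolding transformation_wavelet_set_def B_pow_def by blast

lemma B_pow_unique: "\<lbrakk>\<xi> \<in> (*v) (B_pow j) ` E; \<xi> \<in> (*v) (B_pow k) ` E\<rbrakk> \<Longrightarrow> j = k"
  using B_pow_disjoint[of j k] by blast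

lemma B_pow_cover: "UNIV - (\<Union>k. (*v) (B_pow k) ` E) \<in> null_sets lebesgue"
  using tws unfolding transformation_wavelet_set_def B_pow_def by blast

lemma measurable_orbit: "(\<lambda>(x, k). B_pow k *v x) \<in> E_times_int E \<rightarrow>\<^sub>M lebesgue"
proof (rule measurable_E_times_int)
  fix k
  show "(\<lambda>x. case (x, k) of (x, k) \<Rightarrow> B_pow k *v x) \<in> lebesgue_on E \<rightarrow>\<^sub>M lebesgue"
    using measurable_restrict_space1[OF lebesgue_linear_measurable[OF inv_B_pow[of k]]] by simp
qed

text \<open>
  On the slice \<open>k\<close> the map is \<open>x \<mapsto> B\<^sup>k x\<close>, whose Jacobian determinant is the squared weight, so that the slice
  contributes the measure of \<open>B\<^sup>k E \<inter> X\<close>. These sets are disjoint and cover \<open>X\<close> up to a null set.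
\<close>

lemma weight_pushes_orbit:
  "weight_pushes (E_times_int E) (\<lambda>(x, k). of_real (dilation_factor A k)) (\<lambda>(x, k). B_pow k *v x) lebesgue"
proof (rule weight_pushesI[OF measurable_orbit])
  show w: "(\<lambda>(x, k). complex_of_real (dilation_factor A k)) \<in> borel_measurable (E_times_int E)"
    by (rule measurable_E_times_int) simp
  fix X :: "(real^'n) set" assume X: "X \<in> sets lebesgue"
  have dil2: "(cmod (complex_of_real (dilation_factor A k)))\<^sup>2 = \<bar>det (B_pow k)\<bar>" for k
    by (simp add: dilation_factor_B_pow)
  have piece: "(\<integral>\<^sup>+x. ennreal \<bar>det (B_pow k)\<bar> * indicator X (B_pow k *v x) \<partial>lebesgue_on E)
      = emeasure lebesgue ((*v) (B_pow k) ` E \<inter> X)" for k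
  proof -
    let ?Y = "(*v) (B_pow k) ` E \<inter> X"
    have Y: "?Y \<in> sets lebesgue" using B_pow_image_sets X by blast
    have eq: "indicator ?Y (B_pow k *v x) = indicator E x * (indicator X (B_pow k *v x) :: ennreal)"
        for x
      using B_pow_image[of "B_pow k *v x" k] by (simp add: B_pow_mult indicator_def)
    have "(\<integral>\<^sup>+x. ennreal \<bar>det (B_pow k)\<bar> * indicator X (B_pow k *v x) \<partial>lebesgue_on E)
        = (\<integral>\<^sup>+x. ennreal ((cmod (complex_of_real (sqrt \<bar>det (B_pow k)\<bar>)))\<^sup>2) * indicator ?Y (B_pow k *v
            x) \<partial>lebesgue)"
      using E_sets by (subst nn_integral_restrict_space) (simp_all add: eq mult_ac)
    also have "\<dots> = (\<integral>\<^sup>+y. indicator ?Y y \<partial>lebesgue)"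
      using Y by (intro weighted_comp_nn_integral[OF weight_pushes_lebesgue_linear[OF inv_B_pow]])
          (rule borel_measurable_indicator)
    also have "\<dots> = emeasure lebesgue ?Y"
      using Y by (rule nn_integral_indicator)
    finally show ?thesis .
  qed
  note [measurable] = measurable_orbit w
  have m: "(\<lambda>p. ennreal ((cmod (case p of (x, k) \<Rightarrow> complex_of_real (dilation_factor A k)))\<^sup>2)
      * indicator X (case p of (x, k) \<Rightarrow> B_pow k *v x)) \<in> borel_measurable (E_times_int E)"
    using measurable_compose[OF measurable_orbit borel_measurable_indicator[OF X]] w by measurable
  have "(\<integral>\<^sup>+p. ennreal ((cmod (case p of (x, k) \<Rightarrow> complex_of_real (dilation_factor A k)))\<^sup>2)
      * indicator X (case p of (x, k) \<Rightarrow> B_pow k *v x) \<partial>E_times_int E)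
      = (\<integral>\<^sup>+k. emeasure lebesgue ((*v) (B_pow k) ` E \<inter> X) \<partial>count_space UNIV)"
    by (subst nn_integral_E_times_int[OF E_sets m]) (simp only: prod.case dil2 piece)
  also have "\<dots> = emeasure lebesgue (\<Union>k. (*v) (B_pow k) ` E \<inter> X)"
  proof (rule emeasure_UN_countable[symmetric])
    show "disjoint_family_on (\<lambda>k. (*v) (B_pow k) ` E \<inter> X) UNIV"
      unfolding disjoint_family_on_def using B_pow_disjoint by blast
  qed (use B_pow_image_sets X in auto)
  also have "\<dots> = emeasure lebesgue X"
  proof (rule emeasure_eq_AE)
    have "AE \<xi> in lebesgue. \<xi> \<notin> UNIV - (\<Union>k. (*v) (B_pow k) ` E)"
      by (rule AE_not_in[OF B_pow_cover])
    then show "AE \<xi> in lebesgue. \<xi> \<in> (\<Union>k. (*v) (B_pow k) ` E \<inter> X) \<longleftrightarrow> \<xi> \<in> X"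
      by eventually_elim auto
  qed (use B_pow_image_sets X in auto)
  finally show "(\<integral>\<^sup>+p. ennreal ((cmod (case p of (x, k) \<Rightarrow> complex_of_real (dilation_factor A k)))\<^sup>2)
      * indicator X (case p of (x, k) \<Rightarrow> B_pow k *v x) \<partial>E_times_int E) = emeasure lebesgue X" .
qed

text \<open>
  The map \<open>V\<close> from \<open>L\<^sup>2(\<real>\<^sup>n)\<close> to \<open>L\<^sup>2(E \<times> \<int>)\<close>.
\<close>

definition unfold_orbit :: "(real^'n \<Rightarrow> complex) \<Rightarrow> (real^'n) \<times> int \<Rightarrow> complex" where
  "unfold_orbit g = (\<lambda>(x, k). of_real (dilation_factor A k) * g (B_pow k *v x))"

lemma unfold_orbit_alt:
  "unfold_orbit g = (\<lambda>p. (case p of (x, k) \<Rightarrow> of_real (dilation_factor A k))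
      * g (case p of (x, k) \<Rightarrow> B_pow k *v x))"
  by (auto simp: unfold_orbit_def fun_eq_iff)

lemma unfold_orbit_sq_integrable:
  "g \<in> sq_integrable lebesgue \<Longrightarrow> unfold_orbit g \<in> sq_integrable (E_times_int E)"
  unfolding unfold_orbit_alt by (rule weighted_comp_sq_integrable[OF weight_pushes_orbit])

lemma unfold_orbit_L2_inner:
  "\<lbrakk>g \<in> sq_integrable lebesgue; g' \<in> sq_integrable lebesgue\<rbrakk>
    \<Longrightarrow> L2_inner (E_times_int E) (unfold_orbit g) (unfold_orbit g') = L2_inner lebesgue g g'"
  unfolding unfold_orbit_alt by (rule weighted_comp_L2_inner[OF weight_pushes_orbit])

text \<open>
  Since the sets \<open>B\<^sup>k E\<close> are disjoint, \<open>g\<close> can be prescribed on each of them separately; on the complement of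
  their union it is set to \<open>0\<close>.
\<close>

lemma unfold_orbit_surj:
  assumes h: "h \<in> sq_integrable (E_times_int E)"
  shows "\<exists>g\<in>sq_integrable lebesgue. \<forall>p\<in>E \<times> UNIV. unfold_orbit g p = h p"
proof -
  \<comment> \<open>The index of the set \<open>B\<^sup>k E\<close> containing \<open>\<xi>\<close>; the default \<open>0\<close> off their union is harmless, since \<open>F\<close> vanishes there.\<close>
  define level where "level \<xi> = (if \<exists>k. \<xi> \<in> (*v) (B_pow k) ` E then SOME k. \<xi> \<in> (*v) (B_pow k) ` E else 0)" for \<xi>
  have level: "level \<xi> = k" if "\<xi> \<in> (*v) (B_pow k) ` E" for \<xi> k
  proof -
    have "\<xi> \<in> (*v) (B_pow (SOME k. \<xi> \<in> (*v) (B_pow k) ` E)) ` E"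
      using that by (rule someI[where P = "\<lambda>k. \<xi> \<in> (*v) (B_pow k) ` E"])
    then show ?thesis using B_pow_unique that by (auto simp: level_def)
  qed
  have level_m: "level \<in> lebesgue \<rightarrow>\<^sub>M count_space UNIV"
  proof (subst measurable_count_space_eq2_countable, intro conjI ballI)
    fix k :: int
    let ?rest = "UNIV - (\<Union>k. (*v) (B_pow k) ` E)"
    have cases: "\<xi> \<in> (*v) (B_pow (level \<xi>)) ` E \<or> level \<xi> = 0 \<and> \<xi> \<in> ?rest" for \<xi>
    proof (cases "\<exists>k. \<xi> \<in> (*v) (B_pow k) ` E")
      case True
      then obtain k where "\<xi> \<in> (*v) (B_pow k) ` E" by blast
      then show ?thesis using level[of \<xi> k] by metis
    next
      case False
      then have "level \<xi> = 0" unfolding level_def by (rule if_not_P)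
      then show ?thesis using False by blast
    qed
    have "level -` {k} \<inter> space lebesgue = (*v) (B_pow k) ` E \<union> (if k = 0 then ?rest else {})"
    proof (intro equalityI subsetI)
      fix \<xi> assume "\<xi> \<in> level -` {k} \<inter> space lebesgue"
      then show "\<xi> \<in> (*v) (B_pow k) ` E \<union> (if k = 0 then ?rest else {})"
        using cases[of \<xi>] by auto
    next
      fix \<xi> assume "\<xi> \<in> (*v) (B_pow k) ` E \<union> (if k = 0 then ?rest else {})"
      then consider "\<xi> \<in> (*v) (B_pow k) ` E" | "k = 0" "\<xi> \<in> ?rest"
        by (auto split: if_splits)
      then show "\<xi> \<in> level -` {k} \<inter> space lebesgue"
      proof cases
        case 1
        then show ?thesis using level[of \<xi> k] by simp
      next
        case 2
        then show ?thesis using cases[of \<xi>] by auto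
      qed
    qed
    then show "level -` {k} \<inter> space lebesgue \<in> sets lebesgue"
      using B_pow_image_sets[of k] null_setsD2[OF B_pow_cover]
          by (simp only: sets.Un split: if_split) simp
  qed auto
  define F where "F k \<xi> = of_real (1 / dilation_factor A k)
      * (if B_pow (- k) *v \<xi> \<in> E then h (B_pow (- k) *v \<xi>, k) else 0)" for k \<xi>
  have F_m: "F k \<in> borel_measurable lebesgue" for k
  proof -
    have "(\<lambda>x. h (x, k)) \<in> borel_measurable (lebesgue_on E)"
      by (rule measurable_slice[OF sq_integrableD(1)[OF h]])
    then have "(\<lambda>x. if x \<in> E then h (x, k) else 0) \<in> borel_measurable lebesgue"
      using E_sets by (rule borel_measurable_if_I)
    then have "(\<lambda>\<xi>. (\<lambda>x. if x \<in> E then h (x, k) else 0) (B_pow (- k) *v \<xi>)) \<in> borel_measurable lebesgue"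
      by (rule measurable_compose[OF lebesgue_linear_measurable[OF inv_B_pow]])
    then show ?thesis
      unfolding F_def by simp
  qed
  define g where "g \<xi> = F (level \<xi>) \<xi>" for \<xi>
  have g_m: "g \<in> borel_measurable lebesgue"
    unfolding g_def
    by (rule measurable_compose_countable'[where I = UNIV, OF F_m level_m]) auto
  have Vg: "unfold_orbit g (x, k) = h (x, k)" if "x \<in> E" for x k
  proof -
    have "level (B_pow k *v x) = k" using that by (intro level) auto
    then show ?thesis
      using that dilation_factor_pos[OF dilation_mat, of k]
      by (simp add: unfold_orbit_def g_def F_def B_pow_mult flip: mult.assoc of_real_mult)
  qed
  have "(\<integral>\<^sup>+\<xi>. ennreal ((cmod (g \<xi>))\<^sup>2) \<partial>lebesgue)
      = (\<integral>\<^sup>+p. ennreal ((cmod (case p of (x, k) \<Rightarrow> complex_of_real (dilation_factor A k)))\<^sup>2)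
          * ennreal ((cmod (g (case p of (x, k) \<Rightarrow> B_pow k *v x)))\<^sup>2) \<partial>E_times_int E)"
    by (rule weighted_comp_nn_integral[OF weight_pushes_orbit, symmetric]) (use g_m in measurable)
  also have "\<dots> = (\<integral>\<^sup>+p. ennreal ((cmod (h p))\<^sup>2) \<partial>E_times_int E)"
  proof (rule nn_integral_cong)
    fix p assume "p \<in> space (E_times_int E)"
    then obtain x k where p: "p = (x, k)" "x \<in> E" by auto
    show "ennreal ((cmod (case p of (x, k) \<Rightarrow> complex_of_real (dilation_factor A k)))\<^sup>2)
          * ennreal ((cmod (g (case p of (x, k) \<Rightarrow> B_pow k *v x)))\<^sup>2) = ennreal ((cmod (h p))\<^sup>2)"
      using Vg[OF p(2), of k]
      by (simp add: p(1) unfold_orbit_def norm_mult power_mult_distrib ennreal_mult flip: Vg[OF p(2), of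
          k])
  qed
  also have "\<dots> < \<infinity>"
    using sq_integrableD(2)[OF h] by (simp add: integrable_iff_bounded)
  finally have "g \<in> sq_integrable lebesgue"
    using g_m by (simp add: sq_integrable_def integrable_iff_bounded)
  then show ?thesis using Vg by auto
qed

subsection \<open>Fibrewise operators\<close>

text \<open>
  The operators of the direct integral in closed form.
\<close>

definition fibre_fun :: "(real^'n) \<times> int \<Rightarrow> ((real^'n) \<times> int \<Rightarrow> complex) \<Rightarrow> (real^'n) \<times> int \<Rightarrow> complex"
    where
  "fibre_fun = (\<lambda>(\<beta>, m) h (x, k). phase A x \<beta> k * h (x, k - m))"

lemma weight_pushes_fibre:
  "weight_pushes (E_times_int E) (\<lambda>(x, k). phase A x \<beta> k) (\<lambda>(x, k). (x, k - m)) (E_times_int E)"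
proof -
  have shift: "distr (count_space UNIV) (count_space UNIV) (\<lambda>k. k - m) = count_space (UNIV :: int set)"
  proof -
    have "bij_betw (\<lambda>k. k - m) UNIV (UNIV :: int set)"
      by (rule bij_betw_byWitness[where f' = "\<lambda>k. k + m"]) auto
    then show ?thesis by (rule distr_bij_count_space)
  qed
  have "distr (lebesgue_on E) (lebesgue_on E) (\<lambda>x. x) \<Otimes>\<^sub>M distr (count_space UNIV) (count_space UNIV) (\<lambda>k::int. k - m)
      = distr (E_times_int E) (E_times_int E) (\<lambda>(x, k). (x, k - m))"
    unfolding E_times_int_def
    by (rule pair_measure_distr) (auto simp: shift sigma_finite_measure_count_space)
  then have distr: "distr (E_times_int E) (E_times_int E) (\<lambda>(x, k). (x, k - m)) = E_times_int E"
    by (simp add: shift distr_id2 E_times_int_def[symmetric])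
  have "(\<lambda>(x, k). (x, k - m)) \<in> E_times_int E \<rightarrow>\<^sub>M E_times_int E"
    unfolding E_times_int_def by measurable
  moreover have "(\<lambda>(x, k). phase A x \<beta> k) \<in> borel_measurable (E_times_int E)"
  proof (rule measurable_E_times_int)
    fix k
    have "(\<lambda>x. phase A x \<beta> k) \<in> borel_measurable borel"
      unfolding phase_def by measurable
    then have "(\<lambda>x. phase A x \<beta> k) \<in> borel_measurable (lebesgue_on E)"
      by (simp add: measurable_completion measurable_restrict_space1)
    then show "(\<lambda>x. case (x, k) of (x, k) \<Rightarrow> phase A x \<beta> k) \<in> borel_measurable (lebesgue_on E)"
      by simp
  qed
  ultimately show ?thesis
    by (simp add: weight_pushes_def case_prod_beta density_1) (use distr in \<open>simp add: case_prod_beta\<close>)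
qed

lemma fibre_fun_alt:
  "fibre_fun (\<beta>, m) h = (\<lambda>p. (case p of (x, k) \<Rightarrow> phase A x \<beta> k) * h (case p of (x, k) \<Rightarrow> (x, k - m)))"
  by (auto simp: fibre_fun_def fun_eq_iff)

lemma fibre_fun_sq_integrable:
  "h \<in> sq_integrable (E_times_int E) \<Longrightarrow> fibre_fun g h \<in> sq_integrable (E_times_int E)"
  by (cases g) (simp only: fibre_fun_alt weighted_comp_sq_integrable[OF weight_pushes_fibre])

lemma fibre_fun_AE_cong:
  assumes "h \<in> sq_integrable (E_times_int E)" "h' \<in> sq_integrable (E_times_int E)"
    "AE p in E_times_int E. h p = h' p"
  shows "AE p in E_times_int E. fibre_fun g h p = fibre_fun g h' p"
  using weighted_comp_AE_cong[OF weight_pushes_fibre assms]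
  by (cases g) (simp only: fibre_fun_alt)

text \<open>
  The slice of \<open>f\<close> at \<open>x\<close> is not in \<open>l\<^sup>2(\<int>)\<close> exactly if \<open>I x = \<infinity>\<close>, where \<open>I x\<close> is the integral of \<open>\<bar>f\<bar>\<^sup>2\<close> over
  the slice. There \<open>W_tilde\<close> returns an unspecified function of \<open>k\<close>. The set of these \<open>x\<close> is measurable
  and null, so neither measurability nor the class is affected.
\<close>

lemma direct_integral_fun:
  fixes g :: "(real^'n) \<times> int"
  assumes f: "f \<in> sq_integrable (E_times_int E)"
  defines "\<Phi> \<equiv> (\<lambda>(x, k). W_tilde A x g (\<lambda>j. f (x, j)) k)"
  shows "AE p in E_times_int E. \<Phi> p = fibre_fun g f p"
    and "\<Phi> \<in> sq_integrable (E_times_int E)"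
proof -
  interpret P: pair_sigma_finite "lebesgue_on E" "count_space (UNIV :: int set)"
    by (rule pair_sigma_finite_E_times_int[OF E_sets])
  obtain \<beta> m where g: "g = (\<beta>, m)" by (cases g)
  note fm = sq_integrableD(1)[OF f]
  have fm2: "(\<lambda>p. ennreal ((cmod (f p))\<^sup>2)) \<in> borel_measurable (lebesgue_on E \<Otimes>\<^sub>M count_space UNIV)"
    using fm unfolding E_times_int_def by measurable
  define I where "I x = (\<integral>\<^sup>+k. ennreal ((cmod (f (x, k)))\<^sup>2) \<partial>count_space UNIV)" for x
  have Im [measurable]: "I \<in> borel_measurable (lebesgue_on E)"
    unfolding I_def by (rule P.M2.borel_measurable_nn_integral_fst[OF fm2])
  have slice: "(\<lambda>k. f (x, k)) \<in> carrier l2_int \<longleftrightarrow> I x \<noteq> \<infinity>" for x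
    by (simp add: l2_carrier sq_integrable_def integrable_iff_bounded I_def less_top)
  have "(\<integral>\<^sup>+x. I x \<partial>lebesgue_on E) = (\<integral>\<^sup>+p. ennreal ((cmod (f p))\<^sup>2) \<partial>E_times_int E)"
    unfolding I_def E_times_int_def by (rule P.M2.nn_integral_fst[OF fm2])
  also have "\<dots> < \<infinity>"
    using sq_integrableD(2)[OF f] by (simp add: integrable_iff_bounded)
  finally have "AE x in lebesgue_on E. I x \<noteq> \<infinity>"
    by (intro nn_integral_PInf_AE Im) simp
  moreover have G: "{p \<in> space (E_times_int E). I (fst p) \<noteq> \<infinity>} \<in> sets (E_times_int E)"
    unfolding E_times_int_def by measurable
  ultimately have "AE p in E_times_int E. I (fst p) \<noteq> \<infinity>"
    unfolding E_times_int_def by (intro P.AE_pair_measure) auto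
  moreover have val: "\<Phi> p = (if I (fst p) \<noteq> \<infinity> then fibre_fun g f p else undefined (snd p))" for p
    using slice[of "fst p"] W_tilde_eq[of "\<lambda>j. f (fst p, j)" A "fst p" \<beta> m]
    by (cases p) (auto simp: \<Phi>_def g fibre_fun_def W_tilde_def)
  ultimately show ae: "AE p in E_times_int E. \<Phi> p = fibre_fun g f p"
    by (auto elim: eventually_mono)
  have "(\<lambda>p. undefined (snd p) :: complex) \<in> borel_measurable (E_times_int E)"
    unfolding E_times_int_def by (rule measurable_compose[OF measurable_snd]) simp
  then have "(\<lambda>p. if I (fst p) \<noteq> \<infinity> then fibre_fun g f p else undefined (snd p)) \<in> borel_measurable (E_times_int E)"
    by (intro measurable_If sq_integrableD(1)[OF fibre_fun_sq_integrable[OF f]] G)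
  then have "\<Phi> \<in> borel_measurable (E_times_int E)"
    unfolding val[abs_def] .
  then show "\<Phi> \<in> sq_integrable (E_times_int E)"
    by (rule sq_integrable_AE_cong[OF fibre_fun_sq_integrable[OF f, of g]])
       (use ae in \<open>auto elim: eventually_mono\<close>)
qed

lemma direct_integral_class:
  assumes h: "h \<in> sq_integrable (E_times_int E)"
  shows "direct_integral_rep E (W_tilde A) g (L2_class (E_times_int E) h)
      = L2_class (E_times_int E) (fibre_fun g h)"
  unfolding direct_integral_rep_def
proof (rule L2_op_class[OF h _ _ fibre_fun_sq_integrable[OF h]])
  fix f assume f: "f \<in> sq_integrable (E_times_int E)"
  show "(\<lambda>(x, k). W_tilde A x g (\<lambda>j. f (x, j)) k) \<in> sq_integrable (E_times_int E)"
    by (rule direct_integral_fun(2)[OF f])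
  assume "AE p in E_times_int E. f p = h p"
  with direct_integral_fun(1)[OF f, of g] fibre_fun_AE_cong[OF f h, of g]
  show "AE p in E_times_int E. (\<lambda>(x, k). W_tilde A x g (\<lambda>j. f (x, j)) k) p = fibre_fun g h p"
    by (auto elim: eventually_elim2)
qed

subsection \<open>The intertwiner\<close>

text \<open>
  The graph of \<open>V\<close> after the Fourier transform.
\<close>

definition decompose :: "(real^'n \<Rightarrow> complex) \<Rightarrow> ((real^'n) \<times> int \<Rightarrow> complex) \<Rightarrow> bool" where
  "decompose f h \<longleftrightarrow> h \<in> sq_integrable (E_times_int E) \<and>
     (\<exists>g. plancherel f g \<and> (AE p in E_times_int E. h p = unfold_orbit g p))"

lemma plancherel_wavelet_fun:
  assumes "plancherel f g"
  shows "plancherel (wavelet_fun A (\<beta>, m) f)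
           (\<lambda>\<xi>. cis (- (\<xi> \<bullet> \<beta>)) * (of_real (dilation_factor A (- m)) * g (B_pow (- m) *v \<xi>)))"
  using plancherel_translate[OF plancherel_linear[OF assms mat_powi_inverse[OF dilation_invertible[OF
      dilation_mat], of m]], of \<beta>]
  by (simp add: wavelet_fun_def dilation_factor_def B_pow_transpose del: transpose_matrix_vector)

text \<open>
  The computation behind the theorem: \<open>B\<^sup>k x \<bullet> \<beta> = x \<bullet> A\<^sup>k \<beta>\<close> and \<open>B\<^sup>-\<^sup>m B\<^sup>k x = B\<^sup>k\<^sup>-\<^sup>m x\<close>.
\<close>

lemma unfold_orbit_wavelet:
  "unfold_orbit (\<lambda>\<xi>. cis (- (\<xi> \<bullet> \<beta>)) * (of_real (dilation_factor A (- m)) * g (B_pow (- m) *v \<xi>)))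
    = fibre_fun (\<beta>, m) (unfold_orbit g)"
proof -
  have "(B_pow k *v x) \<bullet> \<beta> = x \<bullet> (mat_powi (real_mat A) k *v \<beta>)" for k x
    unfolding B_pow_transpose by (rule dot_transpose)
  moreover have "dilation_factor A (k - m) = dilation_factor A k * dilation_factor A (- m)" for k
    using dilation_factor_add[OF dilation_mat, of k "- m"] by simp
  ultimately show ?thesis
    by (auto simp: unfold_orbit_def fibre_fun_def phase_def B_pow_mult fun_eq_iff)
qed

lemma decompose_wavelet_fun:
  assumes d: "decompose f h"
  shows "decompose (wavelet_fun A g f) (fibre_fun g h)"
proof -
  obtain \<beta> m where g: "g = (\<beta>, m)" by (cases g)
  obtain f' where h: "h \<in> sq_integrable (E_times_int E)" and p: "plancherel f f'"
    and ae: "AE p in E_times_int E. h p = unfold_orbit f' p"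
    using d by (auto simp: decompose_def)
  have f': "f' \<in> sq_integrable lebesgue" using p by (simp add: plancherel_def)
  have "AE p in E_times_int E. fibre_fun (\<beta>, m) h p = fibre_fun (\<beta>, m) (unfold_orbit f') p"
    by (rule fibre_fun_AE_cong[OF h unfold_orbit_sq_integrable[OF f'] ae])
  then show ?thesis
    unfolding decompose_def g
    using plancherel_wavelet_fun[OF p, of \<beta> m] fibre_fun_sq_integrable[OF h, of "(\<beta>, m)"]
    by (auto simp only: unfold_orbit_wavelet[symmetric])
qed

lemma decompose_unitary:
  "\<exists>U. unitary_map (L2_space lebesgue) (L2_space (E_times_int E)) U \<and>
     (\<forall>f h. decompose f h \<longrightarrow> U (L2_class lebesgue f) = L2_class (E_times_int E) h)"
proof (rule L2_unitary_of_relation)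
  show "f \<in> sq_integrable lebesgue \<and> h \<in> sq_integrable (E_times_int E)" if "decompose f h" for f h
    using that by (auto simp: decompose_def plancherel_def)
  show "\<exists>h. decompose f h" if f: "f \<in> sq_integrable lebesgue" for f
  proof -
    obtain g where g: "plancherel f g" using plancherel_total[OF f] by blast
    then have "unfold_orbit g \<in> sq_integrable (E_times_int E)"
      by (intro unfold_orbit_sq_integrable) (simp add: plancherel_def)
    then have "decompose f (unfold_orbit g)" using g by (auto simp: decompose_def)
    then show ?thesis by blast
  qed
  show "\<exists>f. decompose f h" if h: "h \<in> sq_integrable (E_times_int E)" for h
  proof -
    obtain g where g: "g \<in> sq_integrable lebesgue" "\<forall>p\<in>E \<times> UNIV. unfold_orbit g p = h p"
      using unfold_orbit_surj[OF h] by blast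
    obtain f where f: "plancherel f g" using plancherel_surj[OF g(1)] by blast
    have "AE p in E_times_int E. h p = unfold_orbit g p"
      by (rule AE_I2) (use g(2) in auto)
    then show ?thesis using f h by (auto simp: decompose_def)
  qed
  fix f h f' h' assume "decompose f h" "decompose f' h'"
  then obtain g g' where h: "h \<in> sq_integrable (E_times_int E)" "h' \<in> sq_integrable (E_times_int E)"
    and p: "plancherel f g" "plancherel f' g'"
    and ae: "AE p in E_times_int E. h p = unfold_orbit g p"
        "AE p in E_times_int E. h' p = unfold_orbit g' p"
    by (auto simp: decompose_def)
  have g: "g \<in> sq_integrable lebesgue" "g' \<in> sq_integrable lebesgue"
    using p by (auto simp: plancherel_def)
  have "L2_inner (E_times_int E) h h' = L2_inner (E_times_int E) (unfold_orbit g) (unfold_orbit g')"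
    by (intro L2_inner_AE_cong ae) (auto intro: sq_integrableD(1) h g unfold_orbit_sq_integrable)
  also have "\<dots> = L2_inner lebesgue g g'"
    by (rule unfold_orbit_L2_inner[OF g])
  also have "\<dots> = L2_inner lebesgue f f'"
    by (rule plancherel_L2_inner[OF p])
  finally show "L2_inner (E_times_int E) h h' = L2_inner lebesgue f f'" .
qed

lemma wavelet_rep_equivalent:
  "unitarily_equivalent (QA_group A) (L2_space lebesgue) (wavelet_rep A)
     (L2_space (E_times_int E)) (direct_integral_rep E (W_tilde A))"
proof -
  obtain U where U: "unitary_map (L2_space lebesgue) (L2_space (E_times_int E)) U"
    and Uc: "\<And>f h. decompose f h \<Longrightarrow> U (L2_class lebesgue f) = L2_class (E_times_int E) h"
    using decompose_unitary by blast
  show ?thesis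
  proof (rule unitarily_equivalentI[OF unitary_rep_wavelet_rep[OF dilation_mat] U closed_ops_L2])
    fix g show "direct_integral_rep E (W_tilde A) g \<in> extensional (carrier (L2_space (E_times_int E)))"
      unfolding direct_integral_rep_def by (rule L2_op_extensional)
  next
    fix g F assume g: "g \<in> carrier (QA_group A)"
        and "F \<in> carrier (L2_space (lebesgue :: (real^'n) measure))"
    then obtain f where f: "f \<in> sq_integrable lebesgue" "F = L2_class lebesgue f"
        by (auto elim: L2_carrierE)
    obtain f' where f': "plancherel f f'" using plancherel_total[OF f(1)] by blast
    define h where "h = unfold_orbit f'"
    have h: "h \<in> sq_integrable (E_times_int E)"
      unfolding h_def using f' by (intro unfold_orbit_sq_integrable) (simp add: plancherel_def)
    have d: "decompose f h"
      using f' h by (auto simp: decompose_def h_def)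
    have "U (wavelet_rep A g F) = L2_class (E_times_int E) (fibre_fun g h)"
      by (simp add: wavelet_rep_eq[OF dilation_mat g] f(2) wavelet_op_class[OF dilation_mat f(1)] Uc[OF
          decompose_wavelet_fun[OF d]])
    also have "\<dots> = direct_integral_rep E (W_tilde A) g (U F)"
      by (simp add: f(2) Uc[OF d] direct_integral_class[OF h])
    finally show "U (wavelet_rep A g F) = direct_integral_rep E (W_tilde A) g (U F)" .
  qed
qed

end

theorem theorem2p1:
  fixes A :: "int^'n^'n" and E :: "(real^'n) set"
  assumes "dilation_matrix A"
    and "transformation_wavelet_set (transpose (real_mat A)) E"
  shows "normal (QA_normal A) (QA_group A) \<and>
    comm_group ((QA_group A)\<lparr>carrier := QA_normal A\<rparr>) \<and>
    (\<forall>x\<in>E. unitary_rep (QA_group A) l2_int (W_tilde A x) \<and>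
            irreducible_rep (QA_group A) l2_int (W_tilde A x) \<and>
            monomial_rep (QA_group A) (QA_normal A) l2_int (W_tilde A x)) \<and>
    unitarily_equivalent (QA_group A)
      (L2_space lebesgue) (wavelet_rep A)
      (L2_space (E_times_int E)) (direct_integral_rep E (W_tilde A))"
proof -
  interpret dilation_tiling A E
    using assms by unfold_locales
  show ?thesis
    using normal_QA_normal[OF assms(1)] comm_group_QA_normal[OF assms(1)]
        unitary_rep_W_tilde[OF assms(1)]
      irreducible_W_tilde[OF assms] monomial_W_tilde[OF assms(1)] wavelet_rep_equivalent
    by blast
qed

end
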